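(* Let $r\ge1$, $s\ge0$, let $a$, $b_1,\dots,b_r$, $c$, $d$, $e_1,\dots,e_r$, $f_1,\dots,f_r$, $z_1,\dots,z_r$, $h_1,\dots,h_s$ be indeterminates, let $N_1,\dots,N_s$ be nonnegative integers, $|N|=\sum_{i=1}^sN_i$, and suppose none of the denominators below vanishes. Set $B=b_1\cdots b_r$, $E=e_1\cdots e_r$, $F=f_1\cdots f_r$. Then, provided $|a^{r+1}q^{1-|N|}/BcdE|<1$, \begin{multline*} {}_{6+2s}\Psi_{6+2s}^{(r)}\bigg[a;b_1,\dots,b_r;c,d;e_1,\dots,e_r;z_1,\dots,z_r;\frac{aq^{1+N_1}}{h_1},\dots,\frac{aq^{1+N_s}}{h_s};h_1,\dots,h_s\bigg|\,q,\frac{a^{r+1}q^{1-|N|}}{BcdE}\bigg]\\ =\prod_{j=1}^s\left[\frac{(Fq/h_j;q)_{N_j}}{(q/h_j;q)_{N_j}}\prod_{i=1}^r\frac{(az_iq/f_ih_j;q)_{N_j}}{(az_iq/h_j;q)_{N_j}}\right] \frac{(Fq/d,aq/cF;q)_{\infty}}{(aq/c,q/d;q)_{\infty}} \prod_{i,j=1}^r\frac{(qz_i/z_j,az_iq/e_jf_iz_j,f_jz_iq/b_iz_j;q)_{\infty}}{(qf_jz_i/f_iz_j,qz_i/b_iz_j,az_iq/e_jz_j;q)_{\infty}}\\ \times\prod_{i=1}^r\frac{(az_iq,q/az_i,Fq/e_iz_i,az_iq/b_iF,az_iq/df_i,f_iq/cz_i;q)_{\infty}}{(Ff_iq/az_i,az_iq/Ff_i,az_iq/b_i,q/e_iz_i,q/cz_i,az_iq/d;q)_{\infty}}\\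 \times{}_{6+2s}\Psi_{6+2s}^{(r)}\bigg[\frac Fa;\frac{e_1f_1}a,\dots,\frac{e_rf_r}a;\frac da,\frac{cF}a;\frac{b_1F}{af_1},\dots,\frac{b_rF}{af_r};\frac{f_1}{z_1},\dots,\frac{f_r}{z_r};\frac{h_1}a,\dots,\frac{h_s}a;\frac{Fq^{1+N_1}}{h_1},\dots,\frac{Fq^{1+N_s}}{h_s}\bigg|\,q,\frac{a^{r+1}q^{1-|N|}}{BcdE}\bigg]. \end{multline*}
   Context: Fix $q\in\mathbb C$ with $0<|q|<1$. Define $(x;q)_\infty=\prod_{j\ge0}(1-xq^j)$ and, for any integer $k$, $(x;q)_k=(x;q)_\infty/(xq^k;q)_\infty$; write $(x_1,\dots,x_m;q)_k=(x_1;q)_k\cdots(x_m;q)_k$ (also for $k=\infty$). For $\mathbf k\in\mathbb Z^r$ let $|\mathbf k|=k_1+\dots+k_r$. For indeterminates $a,b_1,\dots,b_r,c,d,e_1,\dots,e_r,z_1,\dots,z_r,g_1,\dots,g_s,h_1,\dots,h_s,w$ define \begin{multline*} {}_{6+2s}\Psi_{6+2s}^{(r)}\big[a;b_1,\dots,b_r;c,d;e_1,\dots,e_r;z_1,\dots,z_r;g_1,\dots,g_s;h_1,\dots,h_s\big|\,q,w\big]\\ :=\sum_{k_1,\dots,k_r=-\infty}^{\infty}\Bigg(\prod_{1\le i<j\le r}\frac{z_iq^{k_i}-z_jq^{k_j}}{z_i-z_j}\prod_{i=1}^r\frac{1-az_iq^{k_i+|\mathbf k|}}{1-az_i} \prod_{i,j=1}^r\frac{(b_jz_i/z_j;q)_{k_i}}{(az_iq/e_jz_j;q)_{k_i}}\prod_{i=1}^r\frac{(e_iz_i;q)_{|\mathbf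 k|}}{(az_iq/b_i;q)_{|\mathbf k|}}\\ \times\prod_{i=1}^r\frac{(cz_i,g_1z_i,\dots,g_sz_i;q)_{k_i}}{(az_iq/d,az_iq/h_1,\dots,az_iq/h_s;q)_{k_i}}\cdot\frac{(d,h_1,\dots,h_s;q)_{|\mathbf k|}}{(aq/c,aq/g_1,\dots,aq/g_s;q)_{|\mathbf k|}}\,w^{|\mathbf k|}\Bigg). \end{multline*} *)

theory Defs
  imports "HOL-Analysis.Analysis"
begin

definition qpinf :: "complex \<Rightarrow> complex \<Rightarrow> complex" where
  "qpinf x q = (\<Prod>j. 1 - x * q ^ j)"

definition qpoch :: "complex \<Rightarrow> complex \<Rightarrow> int \<Rightarrow> complex" where
  "qpoch x q k = qpinf x q / qpinf (x * q powi k) q"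

definition multi_idx :: "nat \<Rightarrow> (nat \<Rightarrow> int) set" where
  "multi_idx r = {k. \<forall>i. i \<notin> {1..r} \<longrightarrow> k i = 0}"

definition absk :: "nat \<Rightarrow> (nat \<Rightarrow> int) \<Rightarrow> int" where
  "absk r k = (\<Sum>i\<in>{1..r}. k i)"

definition psi_term ::
  "nat \<Rightarrow> nat \<Rightarrow> complex \<Rightarrow> complex \<Rightarrow> (nat \<Rightarrow> complex) \<Rightarrow> complex \<Rightarrow> complex \<Rightarrow>
   (nat \<Rightarrow> complex) \<Rightarrow> (nat \<Rightarrow> complex) \<Rightarrow> (nat \<Rightarrow> complex) \<Rightarrow> (nat \<Rightarrow> complex) \<Rightarrow>
   complex \<Rightarrow> (nat \<Rightarrow> int) \<Rightarrow> complex" where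
  "psi_term r s q a b c d e z g h w k =
    (let K = absk r k in
      (\<Prod>i\<in>{1..r}. \<Prod>j\<in>{i<..r}. (z i * q powi k i - z j * q powi k j) / (z i - z j))
    * (\<Prod>i\<in>{1..r}. (1 - a * z i * q powi (k i + K)) / (1 - a * z i))
    * (\<Prod>i\<in>{1..r}. \<Prod>j\<in>{1..r}. qpoch (b j * z i / z j) q (k i) / qpoch (a * z i * q / (e j * z j)) q (k i))
    * (\<Prod>i\<in>{1..r}. qpoch (e i * z i) q K / qpoch (a * z i * q / b i) q K)
    * (\<Prod>i\<in>{1..r}. (qpoch (c * z i) q (k i) * (\<Prod>j\<in>{1..s}. qpoch (g j * z i) q (k i)))
                    / (qpoch (a * z i * q / d) q (k i) * (\<Prod>j\<in>{1..s}. qpoch (a * z i * q / h j) q (k i))))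
    * ((qpoch d q K * (\<Prod>j\<in>{1..s}. qpoch (h j) q K))
       / (qpoch (a * q / c) q K * (\<Prod>j\<in>{1..s}. qpoch (a * q / g j) q K)))
    * w powi K)"

definition Psi ::
  "nat \<Rightarrow> nat \<Rightarrow> complex \<Rightarrow> complex \<Rightarrow> (nat \<Rightarrow> complex) \<Rightarrow> complex \<Rightarrow> complex \<Rightarrow>
   (nat \<Rightarrow> complex) \<Rightarrow> (nat \<Rightarrow> complex) \<Rightarrow> (nat \<Rightarrow> complex) \<Rightarrow> (nat \<Rightarrow> complex) \<Rightarrow>
   complex \<Rightarrow> complex" where
  "Psi r s q a b c d e z g h w = (\<Sum>\<^sub>\<infinity>k\<in>multi_idx r. psi_term r s q a b c d e z g h w k)"

text \<open>Genericity ("indeterminate"): x q^n \<noteq> 1 for all integers n, so that no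
  factor of any q-shifted factorial (x;q)_k, k \<in> Z, vanishes.\<close>

definition generic :: "complex \<Rightarrow> complex \<Rightarrow> bool" where
  "generic q x \<longleftrightarrow> (\<forall>n::int. x * q powi n \<noteq> 1)"

definition psi_generic ::
  "nat \<Rightarrow> nat \<Rightarrow> complex \<Rightarrow> complex \<Rightarrow> (nat \<Rightarrow> complex) \<Rightarrow> complex \<Rightarrow> complex \<Rightarrow>
   (nat \<Rightarrow> complex) \<Rightarrow> (nat \<Rightarrow> complex) \<Rightarrow> (nat \<Rightarrow> complex) \<Rightarrow> (nat \<Rightarrow> complex) \<Rightarrow> bool" where
  "psi_generic r s q a b c d e z g h \<longleftrightarrow>
     a \<noteq> 0 \<and> c \<noteq> 0 \<and> d \<noteq> 0 \<and>
     (\<forall>i\<in>{1..r}. b i \<noteq> 0 \<and> e i \<noteq> 0 \<and> z i \<noteq> 0 \<and> 1 - a * z i \<noteq> 0) \<and>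
     (\<forall>j\<in>{1..s}. g j \<noteq> 0 \<and> h j \<noteq> 0) \<and>
     (\<forall>i\<in>{1..r}. \<forall>j\<in>{1..r}. i < j \<longrightarrow> z i \<noteq> z j) \<and>
     (\<forall>i\<in>{1..r}. \<forall>j\<in>{1..r}. generic q (b j * z i / z j) \<and> generic q (a * z i * q / (e j * z j))) \<and>
     (\<forall>i\<in>{1..r}. generic q (e i * z i) \<and> generic q (a * z i * q / b i) \<and>
                  generic q (c * z i) \<and> generic q (a * z i * q / d) \<and>
                  (\<forall>j\<in>{1..s}. generic q (g j * z i) \<and> generic q (a * z i * q / h j))) \<and>
     generic q d \<and> generic q (a * q / c) \<and>
     (\<forall>j\<in>{1..s}. generic q (h j) \<and> generic q (a * q / g j))"

end

theory Submission
  imports Defs "HOL-Complex_Analysis.Complex_Analysis"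
begin

text \<open>
  In the variables \<open>x i = z i * q powi k i\<close> for \<open>i \<le> r\<close> and \<open>x (r + 1) = q powi (- \<bar>k\<bar>) / a\<close>, whose
  product is constant, the summand is a Vandermonde product of \<open>r + 1\<close> variables times
  \<open>\<Prod>i. R (x i)\<close> for a single function \<open>R\<close>, and both series of the theorem are sums of this
  expression over \<open>q\<close>-lattices, through the points \<open>z i, 1 / a\<close> and \<open>z i / f i, F / a\<close> respectively.
  Dropping the constraint on the product at the expense of a new variable \<open>t\<close>, one obtains a series that,
  after multiplication by theta functions, is holomorphic, antisymmetric and quasi-periodic of
  degree \<open>r + 1\<close> in each \<open>x i\<close>. As a function of one \<open>x i\<close> it vanishes at the other \<open>r\<close> coordinates,
  which determines it up to a factor: it is a constant multiple of the product of all
  \<open>x i * \<theta> (x j / x i)\<close>, \<open>i < j\<close>, and one theta function of \<open>t * \<Prod>i. x i\<close>. Hence the ratio of its values at two base points with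
  equal \<open>\<Prod>i. x i\<close> does not depend on \<open>t\<close>, and comparing the coefficients of \<open>t ^ 0\<close> gives the transformation.
  Since \<open>R\<close> may contain an arbitrary polynomial factor, the parameters \<open>h j\<close> cost nothing.
\<close>

section \<open>Theta functions\<close>

text \<open>Convergence shapes the proof. Once the constraint is dropped, every variable runs over a
  bilateral series whose term ratio tends to \<open>t\<close> times a power of \<open>q\<close> at
  one end and to another constant at the other end, so \<open>t\<close> is confined to an annulus;
  \<open>norm w < 1\<close> is what makes this annulus nonempty. The summand moreover has poles as a
  function of the base point. They are cleared by a product \<open>numer\<close> in each coordinate,
  and its values at the two base points, together with those of the polynomial carrying the
  \<open>h j\<close> and of the theta product, make up the prefactor of the transformation.

  The second series does not look like the first one at another point because it is written in
  inverted coordinates. Replacing every coordinate by its reciprocal and every index by its negative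
  exchanges the parameters \<open>A m\<close> and \<open>q / B m\<close> and turns \<open>a\<close>
  into \<open>F / a\<close>; no extra monomial arises, since the indices sum to zero. The
  \<open>f i\<close> are free because any \<open>r\<close> base coordinates are admissible as long
  as the last one keeps the product fixed.\<close>

locale nome =
  fixes q :: complex
  assumes q_nz [simp]: "q \<noteq> 0" and q_lt1: "norm q < 1"
begin

section \<open>Infinite products and q-shifted factorials\<close>

lemma powi_add: "q powi (m + n) = q powi m * q powi n"
  using q_nz by (simp add: power_int_add)

lemma powi_nz [simp]: "q powi m \<noteq> 0"
  using q_nz by simp

lemma convergent_prod_qpinf: "convergent_prod (\<lambda>j. 1 - x * q ^ j)"
proof (rule abs_convergent_prod_imp_convergent_prod, rule summable_imp_abs_convergent_prod)
  have "summable (\<lambda>i. norm x * norm q ^ i)"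
    using q_lt1 by (intro summable_mult summable_geometric) auto
  then show "summable (\<lambda>i. norm (1 - x * q ^ i - 1))"
    by (simp add: norm_mult norm_power)
qed

lemma qpinf_rec: "qpinf x q = (1 - x) * qpinf (x * q) q"
proof -
  have "(\<lambda>j. 1 - x * q ^ j) has_prod ((\<Prod>k<1. 1 - x * q ^ k) * (\<Prod>k. 1 - x * q ^ (k + 1)))"
    by (rule has_prod_ignore_initial_segment'[OF convergent_prod_qpinf])
  then show ?thesis
    unfolding qpinf_def by (subst has_prod_unique[symmetric]) (auto simp: mult_ac)
qed

lemma qpinf_eq_0_iff: "qpinf x q = 0 \<longleftrightarrow> (\<exists>j. x * q ^ j = 1)"
proof -
  have "(\<lambda>j. 1 - x * q ^ j) has_prod qpinf x q"
    unfolding qpinf_def using convergent_prod_qpinf by (simp add: convergent_prod_has_prod_iff)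
  from has_prod_eq_0_iff[OF this] show ?thesis
    by (auto simp: image_iff)
qed

lemma qpinf_nz: "norm x < 1 \<Longrightarrow> qpinf x q \<noteq> 0"
proof
  assume x: "norm x < 1" and "qpinf x q = 0"
  then obtain j where j: "x * q ^ j = 1" by (auto simp: qpinf_eq_0_iff)
  have "norm (x * q ^ j) \<le> norm x * 1"
    unfolding norm_mult norm_power using q_lt1 by (intro mult_left_mono power_le_one) auto
  then show False using x j by simp
qed

text \<open>The partial products converge uniformly on closed discs, because the deviations of their
  factors from 1 are dominated by a geometric series.\<close>

lemma qpinf_holomorphic_UNIV: "(\<lambda>x. qpinf x q) holomorphic_on UNIV"
proof (rule holomorphic_uniform_sequence[where f = "\<lambda>n x. \<Prod>k<n. 1 - x * q ^ k"])
  fix z :: complex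
  have "uniform_limit (cball z 1) (\<lambda>n x. \<Prod>k<n. 1 - x * q ^ k) (\<lambda>x. qpinf x q) sequentially"
  proof -
    have "uniformly_convergent_on (cball z 1) (\<lambda>n x. \<Prod>k<n. 1 - x * q ^ k)"
    proof (rule uniformly_convergent_on_prod')
      show "uniformly_convergent_on (cball z 1) (\<lambda>N x. \<Sum>n<N. norm (1 - x * q ^ n - 1))"
      proof (rule Weierstrass_m_test')
        show "summable (\<lambda>n. (norm z + 1) * norm q ^ n)"
          using q_lt1 by (intro summable_mult summable_geometric) auto
        fix n x assume "x \<in> cball z 1"
        then have "norm x \<le> norm z + 1"
          by (metis add.commute dist_commute dist_norm mem_cball norm_triangle_sub
              order.trans add_mono_thms_linordered_semiring(3))
        then show "norm (norm (1 - x * q ^ n - 1)) \<le> (norm z + 1) * norm q ^ n"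
          by (simp add: norm_mult norm_power mult_right_mono)
      qed
    qed (auto intro!: continuous_intros)
    then obtain l where l: "uniform_limit (cball z 1) (\<lambda>n x. \<Prod>k<n. 1 - x * q ^ k) l sequentially"
      by (auto simp: uniformly_convergent_on_def)
    have "l x = qpinf x q" if "x \<in> cball z 1" for x
    proof -
      have "(\<lambda>n. \<Prod>k<n. 1 - x * q ^ k) \<longlonglongrightarrow> l x"
        using tendsto_uniform_limitI[OF l that] .
      moreover have "(\<lambda>n. \<Prod>k<n. 1 - x * q ^ k) \<longlonglongrightarrow> qpinf x q"
        using convergent_prod_LIMSEQ[OF convergent_prod_qpinf[of x]]
        by (simp add: qpinf_def LIMSEQ_lessThan_iff_atMost)
      ultimately show ?thesis using LIMSEQ_unique by blast
    qed
    then have "uniform_limit (cball z 1) (\<lambda>n x. \<Prod>k<n. 1 - x * q ^ k) l sequentially \<longleftrightarrow>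
      uniform_limit (cball z 1) (\<lambda>n x. \<Prod>k<n. 1 - x * q ^ k) (\<lambda>x. qpinf x q) sequentially"
      by (intro uniform_limit_cong') auto
    then show ?thesis using l by simp
  qed
  then show "\<exists>d>0. cball z d \<subseteq> UNIV \<and> uniform_limit (cball z d) (\<lambda>n x. \<Prod>k<n. 1 - x * q ^ k) (\<lambda>x. qpinf x q) sequentially"
    by (intro exI[of _ 1]) auto
qed (auto intro!: holomorphic_intros)

lemma qpinf_holomorphic [holomorphic_intros]:
  "f holomorphic_on S \<Longrightarrow> (\<lambda>s. qpinf (f s) q) holomorphic_on S"
  using holomorphic_on_compose_gen[OF _ qpinf_holomorphic_UNIV, of f S] by (auto simp: o_def)

lemma qpinf_generic_nz: "generic q y \<Longrightarrow> qpinf (y * q powi k) q \<noteq> 0"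
proof
  assume y: "generic q y" and "qpinf (y * q powi k) q = 0"
  then obtain l where "y * q powi k * q ^ l = 1" by (auto simp: qpinf_eq_0_iff)
  then have "y * q powi (k + int l) = 1" by (simp add: powi_add mult.assoc)
  then show False using y by (auto simp: generic_def)
qed

text \<open>Genericity excludes exactly the integer powers of \<open>q\<close>, a set stable under
  inversion and under multiplication by \<open>q\<close>.\<close>

lemma generic_reflect:
  assumes "x \<noteq> 0" "generic q x" shows "generic q (q / x)"
  unfolding generic_def
proof (intro allI notI)
  fix m assume "q / x * q powi m = 1"
  then have "x = q powi (m + 1)" using assms by (simp add: powi_add field_simps)
  then have "x * q powi (- (m + 1)) = 1" using q_nz by (simp only: flip: powi_add) simp
  then show False using assms by (auto simp: generic_def)
qed

lemma qpoch_Suc: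
  assumes y: "generic q y"
  shows "qpoch y q (k + 1) = qpoch y q k * (1 - y * q powi k)"
proof -
  have "qpinf (y * q powi k) q = (1 - y * q powi k) * qpinf (y * q powi (k + 1)) q"
    by (subst qpinf_rec) (simp add: power_int_add_1 mult.assoc)
  moreover have "1 - y * q powi k \<noteq> 0" using y by (auto simp: generic_def)
  ultimately show ?thesis
    using qpinf_generic_nz[OF y, of k] qpinf_generic_nz[OF y, of "k + 1"] by (simp add: qpoch_def)
qed

lemma qpoch_0: "generic q y \<Longrightarrow> qpoch y q 0 = 1"
  using qpinf_generic_nz[of y 0] by (simp add: qpoch_def)

lemma qpoch_nz: "generic q y \<Longrightarrow> qpoch y q k \<noteq> 0"
  using qpinf_generic_nz[of y 0] qpinf_generic_nz[of y k] by (simp add: qpoch_def)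

lemma qpoch_nat:
  assumes y: "generic q y"
  shows "qpoch y q (int N) = (\<Prod>l<N. 1 - y * q ^ l)"
proof (induction N)
  case 0
  then show ?case using qpoch_0[OF y] by simp
next
  case (Suc N)
  have "qpoch y q (int (Suc N)) = qpoch y q (int N + 1)" by (simp add: add.commute)
  then show ?case using Suc qpoch_Suc[OF y, of "int N"] by simp
qed

text \<open>Both sides are the same quotient of four infinite products. Read from left to right, a
  pair of parameters differing by the factor \<open>q ^ N\<close> becomes a quotient of values of a
  polynomial of degree at most \<open>N\<close>.\<close>

lemma qpoch_shift_ratio:
  assumes u: "generic q u"
  shows "qpoch (u * q ^ N) q k / qpoch u q k = (\<Prod>l<N. 1 - u * q powi k * q ^ l) / (\<Prod>l<N. 1 - u * q ^ l)"
proof -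
  have gk: "generic q (u * q powi k)"
    using u unfolding generic_def mult.assoc powi_add[symmetric] by blast
  have "(\<Prod>l<N. 1 - u * q powi k * q ^ l) / (\<Prod>l<N. 1 - u * q ^ l) = qpoch (u * q powi k) q (int N) / qpoch u q (int N)"
    by (simp only: qpoch_nat[OF u] qpoch_nat[OF gk])
  moreover have "u * q powi k * q ^ N = u * q ^ N * q powi k" by (simp only: mult_ac)
  ultimately show ?thesis
    using qpinf_generic_nz[OF u, of 0] qpinf_generic_nz[OF u, of k] by (simp add: qpoch_def)
qed

lemma qpoch_reflect_ratio:
  assumes uv: "u \<noteq> 0" "v \<noteq> 0" and u: "generic q u" and v: "generic q v"
  shows "qpoch v q (- k) / qpoch u q (- k) = (u / v) powi k * (qpoch (q / u) q k / qpoch (q / v) q k)"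
proof -
  have gu: "generic q (q / u)" and gv: "generic q (q / v)" using generic_reflect uv u v by auto
  \<comment> \<open>\<open>H u\<close> obeys a first-order recurrence in \<open>k\<close> in which
    \<open>u\<close> does not occur, and \<open>H u 0 = 1\<close>. Hence \<open>H u k\<close> is the
    same for all generic nonzero \<open>u\<close>, and comparing \<open>u\<close> with
    \<open>v\<close> gives the claim.\<close>
  define H where "H = (\<lambda>u k. qpoch u q (- k) * qpoch (q / u) q k * u powi k)"
  have H: "H u (k + 1) = - (q powi (k + 1)) * H u k" if "u \<noteq> 0" "generic q u" for u k
  proof -
    have g: "generic q (q / u)" using generic_reflect that by auto
    have 1: "qpoch u q (- k) = qpoch u q (- (k + 1)) * (1 - u * q powi (- (k + 1)))"
      using qpoch_Suc[OF that(2), of "- (k + 1)"] by simp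
    have 2: "(1 - q / u * q powi k) * u = - (q powi (k + 1)) * (1 - u * q powi (- (k + 1)))"
    proof -
      have "q powi (k + 1) * q powi (- (k + 1)) = 1" by (simp flip: powi_add)
      then show ?thesis using that(1) by (simp add: powi_add algebra_simps)
    qed
    have "H u (k + 1) = qpoch u q (- (k + 1)) * qpoch (q / u) q k * ((1 - q / u * q powi k) * u) * u powi k"
      unfolding H_def qpoch_Suc[OF g] using that(1) by (simp add: power_int_add_1)
    also have "\<dots> = - (q powi (k + 1)) * (qpoch u q (- (k + 1)) * (1 - u * q powi (- (k + 1)))) * qpoch (q / u) q k * u powi k"
      unfolding 2 by (simp only: mult_ac mult_minus_left mult_minus_right)
    finally show ?thesis unfolding H_def 1 by (simp only: mult_ac mult_minus_left mult_minus_right)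
  qed
  have "H u k = H v k"
  proof (induction k rule: int_induct[where k = 0])
    case base
    then show ?case using u v gu gv by (simp add: H_def qpoch_0)
  next
    case (step1 i)
    then show ?case using H[OF uv(1) u] H[OF uv(2) v] by simp
  next
    case (step2 i)
    have "- (q powi (i - 1 + 1)) * H u (i - 1) = - (q powi (i - 1 + 1)) * H v (i - 1)"
      using step2 H[OF uv(1) u, of "i - 1"] H[OF uv(2) v, of "i - 1"] by simp
    then show ?case by simp
  qed
  then show ?thesis
    using uv qpoch_nz[OF u, of "- k"] qpoch_nz[OF v, of "- k"] qpoch_nz[OF gu, of k] qpoch_nz[OF gv, of k]
    by (simp add: H_def power_int_divide_distrib field_simps)
qed

section \<open>The modified Jacobi theta function and its simple zeros\<close>

definition \<theta> :: "complex \<Rightarrow> complex" where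
  "\<theta> x = qpinf x q * qpinf (q / x) q"

lemma theta_holomorphic [holomorphic_intros]:
  assumes "f holomorphic_on S" "\<And>s. s \<in> S \<Longrightarrow> f s \<noteq> 0"
  shows "(\<lambda>s. \<theta> (f s)) holomorphic_on S"
  unfolding \<theta>_def using assms by (intro holomorphic_intros) auto

lemma theta_shift: "x \<noteq> 0 \<Longrightarrow> \<theta> (q * x) = - \<theta> x / x"
  using q_nz by (simp add: \<theta>_def qpinf_rec[of x] qpinf_rec[of "1 / x"] field_simps)

lemma theta_eq_0_iff:
  assumes "x \<noteq> 0"
  shows "\<theta> x = 0 \<longleftrightarrow> (\<exists>m. x = q powi m)"
proof
  assume "\<theta> x = 0"
  then consider j where "x * q ^ j = 1" | j where "q / x * q ^ j = 1"
    by (auto simp: \<theta>_def qpinf_eq_0_iff)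
  then show "\<exists>m. x = q powi m"
  proof cases
    case 1
    then have "x = q powi (- int j)"
      using q_nz by (simp add: power_int_minus field_simps)
    then show ?thesis ..
  next
    case 2
    then have "x = q powi (int (Suc j))"
      using assms unfolding power_int_of_nat by (simp add: field_simps)
    then show ?thesis ..
  qed
next
  assume "\<exists>m. x = q powi m"
  then obtain m where m: "x = q powi m" ..
  show "\<theta> x = 0"
  proof (cases "m \<le> 0")
    case True
    then have "x * q ^ nat (- m) = 1"
      using m q_nz by (simp add: power_int_def field_simps)
    then show ?thesis by (auto simp: \<theta>_def qpinf_eq_0_iff)
  next
    case False
    then have "q / x * q ^ nat (m - 1) = 1"
      using m q_nz by (simp add: power_int_def nat_diff_distrib flip: power_Suc)
    then show ?thesis unfolding \<theta>_def qpinf_eq_0_iff mult_eq_0_iff by blast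
  qed
qed

lemma theta_holo: "\<theta> holomorphic_on - {0}"
  using theta_holomorphic[of "\<lambda>x. x" "-{0}"] by (auto intro: holomorphic_intros)

lemma theta_has_deriv: "x \<noteq> 0 \<Longrightarrow> (\<theta> has_field_derivative deriv \<theta> x) (at x)"
  using holomorphic_derivI[OF theta_holo] by auto

text \<open>Differentiate \<open>\<theta> s = - s * \<theta> (q * s)\<close>. At a zero
  \<open>x\<close> the summand without a derivative drops out, because \<open>q * x\<close> is a
  zero as well.\<close>

lemma deriv_theta_shift:
  assumes x: "x \<noteq> 0" and z: "\<theta> x = 0"
  shows "deriv \<theta> x = - x * q * deriv \<theta> (q * x)"
proof (rule DERIV_imp_deriv)
  have D: "((\<lambda>s. - s * \<theta> (q * s)) has_field_derivative - x * q * deriv \<theta> (q * x)) (at x)"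
    using x z q_nz theta_shift[OF x]
    by (auto intro!: derivative_eq_intros DERIV_chain2[where f = \<theta> and g = "\<lambda>s. q * s", OF theta_has_deriv])
  have ev: "eventually (\<lambda>s. - s * \<theta> (q * s) = \<theta> s) (nhds x)"
    using t1_space_nhds[of x 0] x by (auto elim!: eventually_mono simp: theta_shift)
  show "(\<theta> has_field_derivative - x * q * deriv \<theta> (q * x)) (at x)"
    using D DERIV_cong_ev[OF refl ev refl, THEN iffD1] by simp
qed

text \<open>The factor \<open>1 - x\<close> carries the zero at 1; the cofactor \<open>w\<close>
  takes the value \<open>qpinf q q ^ 2\<close> there.\<close>

lemma deriv_theta_1: "deriv \<theta> 1 \<noteq> 0"
proof -
  define w where "w = (\<lambda>x. qpinf (x * q) q * qpinf (q / x) q)"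
  have w: "w holomorphic_on - {0}"
    unfolding w_def by (intro holomorphic_intros) auto
  have "((\<lambda>x. (1 - x) * w x) has_field_derivative - w 1) (at 1)"
    by (auto intro!: derivative_eq_intros holomorphic_derivI[OF w])
  moreover have "\<theta> = (\<lambda>x. (1 - x) * w x)"
    unfolding \<theta>_def w_def by (subst qpinf_rec) (simp add: mult.assoc)
  ultimately have "deriv \<theta> 1 = - w 1" by (simp add: DERIV_imp_deriv)
  moreover have "w 1 \<noteq> 0"
    unfolding w_def using qpinf_nz[of q] q_lt1 by simp
  ultimately show ?thesis by simp
qed

text \<open>The zeros form the orbit of 1 under multiplication by \<open>q\<close>, and
  \<open>deriv_theta_shift\<close> carries a nonzero derivative along the orbit in both directions.
  Simplicity of the zeros is what permits division by theta functions later.\<close>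

lemma deriv_theta_nz:
  assumes "x \<noteq> 0" "\<theta> x = 0"
  shows "deriv \<theta> x \<noteq> 0"
proof -
  obtain m where m: "x = q powi m" using assms theta_eq_0_iff by auto
  have zero: "\<theta> (q powi k) = 0" for k 

    by (subst theta_eq_0_iff) (use q_nz in auto)
  have step: "deriv \<theta> (q powi k) = - (q powi k) * q * deriv \<theta> (q powi (k + 1))" for k
    using deriv_theta_shift[of "q powi k"] zero[of k] q_nz by (simp add: power_int_add_1 mult.commute)
  have "deriv \<theta> (q powi m) \<noteq> 0"
  proof (induction m rule: int_induct[where k = 0])
    case base
    then show ?case using deriv_theta_1 by simp
  next
    case (step1 i)
    then show ?case using step[of i] by auto
  next
    case (step2 i)
    then show ?case using step[of "i - 1"] q_nz by auto
  qed
  then show ?thesis using m by simp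
qed

end

text \<open>At a zero of \<open>h\<close> the quotient receives its limit
  \<open>deriv f s / deriv h s\<close>. Such a zero is isolated because the derivative does not
  vanish, so the removable singularity theorem applies.\<close>

lemma holomorphic_divide_simple_zeros:
  assumes S: "open S" and f: "f holomorphic_on S" and h: "h holomorphic_on S"
    and zeros: "\<And>s. s \<in> S \<Longrightarrow> h s = 0 \<Longrightarrow> f s = 0 \<and> deriv h s \<noteq> 0"
  obtains g where "g holomorphic_on S" "\<And>s. s \<in> S \<Longrightarrow> f s = h s * g s"
proof -
  define g where "g = (\<lambda>s. if h s = 0 then deriv f s / deriv h s else f s / h s)"
  have "g field_differentiable at s0" if s0: "s0 \<in> S" for s0
  proof -
    have df: "(f has_field_derivative deriv f s0) (at s0)"
      and dh: "(h has_field_derivative deriv h s0) (at s0)"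
      using holomorphic_derivI[OF _ S s0] f h by auto
    show ?thesis
    proof (cases "h s0 = 0")
      case False
      have "open (S \<inter> h -` (- {0}))"
        using continuous_open_preimage[OF holomorphic_on_imp_continuous_on[OF h] S, of "- {0}"]
        by auto
      moreover have "(\<lambda>s. f s / h s) holomorphic_on S \<inter> h -` (- {0})"
        by (intro holomorphic_intros holomorphic_on_subset[OF f] holomorphic_on_subset[OF h]) auto
      then have "g holomorphic_on S \<inter> h -` (- {0})"
        by (rule holomorphic_transform) (auto simp: g_def)
      ultimately show ?thesis
        using s0 False by (auto intro!: holomorphic_on_imp_differentiable_at)
    next
      case True
      have f0: "f s0 = 0" and dh0: "deriv h s0 \<noteq> 0" using zeros[OF s0 True] by auto
      have lim: "((\<lambda>s. f s / (s - s0)) \<longlongrightarrow> deriv f s0) (at s0)"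
        and limh: "((\<lambda>s. h s / (s - s0)) \<longlongrightarrow> deriv h s0) (at s0)"
        using df dh f0 True by (auto simp: has_field_derivative_iff)
      have "eventually (\<lambda>s. h s / (s - s0) \<noteq> 0) (at s0)"
        using tendsto_imp_eventually_ne[OF limh dh0] .
      then obtain d where d: "d > 0" "\<And>s. s \<noteq> s0 \<Longrightarrow> dist s s0 < d \<Longrightarrow> h s \<noteq> 0"
        unfolding eventually_at by force
      obtain e where e: "e > 0" "ball s0 e \<subseteq> S" using S s0 open_contains_ball by blast
      define B where "B = ball s0 (min d e)"
      have B: "B \<subseteq> S" "s0 \<in> B" "open B" and Bh: "s \<in> B \<Longrightarrow> s \<noteq> s0 \<Longrightarrow> h s \<noteq> 0" for s
        using d e by (auto simp: B_def dist_commute)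
      have "((\<lambda>s. (f s / (s - s0)) / (h s / (s - s0))) \<longlongrightarrow> deriv f s0 / deriv h s0) (at s0)"
        using lim limh dh0 by (intro tendsto_divide)
      then have "((\<lambda>s. f s / h s) \<longlongrightarrow> deriv f s0 / deriv h s0) (at s0)"
        by (rule Lim_transform_eventually) (auto simp: eventually_at intro!: exI[of _ 1])
      moreover have "(\<lambda>s. f s / h s) holomorphic_on B - {s0}"
        using B Bh by (intro holomorphic_intros holomorphic_on_subset[OF f] holomorphic_on_subset[OF h]) auto
      ultimately have "(\<lambda>s. if s = s0 then deriv f s0 / deriv h s0 else f s / h s) holomorphic_on B"
        using B(3) by (intro removable_singularity)
      then have "g holomorphic_on B"
        by (rule holomorphic_transform) (use Bh True in \<open>auto simp: g_def\<close>)
      then show ?thesis using B by (auto intro: holomorphic_on_imp_differentiable_at)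
    qed
  qed
  then have "g holomorphic_on S"
    using S by (simp add: holomorphic_on_def field_differentiable_at_within)
  moreover have "f s = h s * g s" if "s \<in> S" for s
    using zeros[OF that] by (auto simp: g_def)
  ultimately show ?thesis using that by blast
qed

section \<open>Uniqueness for quasi-periodic functions on the punctured plane\<close>

context nome begin

text \<open>In the coordinate \<open>s = exp z\<close>, and with its real growth rate removed, the
  function is bounded because its modulus is doubly periodic. Liouville's theorem leaves only
  \<open>c * exp (\<beta> * z)\<close>, and a nonzero \<open>c\<close> would make \<open>K\<close> a
  power of \<open>q\<close>.\<close>

lemma multiplicatively_periodic_zero:
  assumes v: "v holomorphic_on - {0}" and K: "\<And>s. s \<noteq> 0 \<Longrightarrow> v (q * s) = K * v s"
    and nK: "\<And>m. K \<noteq> q powi m" and s: "s \<noteq> 0"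
  shows "v s = 0"
proof (cases "K = 0")
  case True
  then show ?thesis using K[of "s / q"] s q_nz by simp
next
  case K0: False
  define L where "L = - ln (norm q)"
  have L: "L > 0" using q_lt1 q_nz by (simp add: L_def)
  \<comment> \<open>\<beta> is the real exponent for which \<open>exp (\<beta> * l)\<close> with
    \<open>l = Ln q\<close> has the modulus of \<open>K\<close>. With it \<open>norm (W z)\<close>,
    though in general not \<open>W z\<close>, has the periods \<open>l\<close> and
    \<open>2 * pi * \<i>\<close>.\<close>
  define \<beta> where "\<beta> = - ln (norm K) / L"
  define W where "W = (\<lambda>z. v (exp z) * exp (- of_real \<beta> * z))"
  define l where "l = Ln q"
  have expl: "exp l = q" unfolding l_def using q_nz by simp
  have Rel: "Re l = - L" unfolding l_def L_def using q_nz by (simp add: Re_Ln)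
  have "(v \<circ> exp) holomorphic_on UNIV"
    by (rule holomorphic_on_compose_gen[OF _ v]) (auto intro!: holomorphic_intros)
  then have W: "W holomorphic_on UNIV"
    unfolding W_def by (intro holomorphic_intros) (auto simp: o_def)
  have per1: "norm (W (z + l)) = norm (W z)" for z
  proof -
    have "v (exp (z + l)) = K * v (exp z)"
      using K[of "exp z"] by (simp add: exp_add expl mult.commute)
    moreover have "norm (exp (- of_real \<beta> * (z + l))) = norm (exp (- of_real \<beta> * z)) * exp (\<beta> * L)"
      by (simp add: Rel algebra_simps flip: exp_add)
    moreover have "exp (\<beta> * L) = inverse (norm K)"
      using L K0 by (simp add: \<beta>_def exp_minus)
    ultimately show ?thesis using K0 unfolding W_def norm_mult
      by (simp only: norm_mult) (simp add: field_simps)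
  qed
  have per1': "norm (W (z + of_int n * l)) = norm (W z)" for z n
  proof (induction n rule: int_induct[where k = 0])
    case base
    then show ?case by simp
  next
    case (step1 i)
    then show ?case using per1[of "z + of_int i * l"] by (simp add: algebra_simps)
  next
    case (step2 i)
    then show ?case using per1[of "z + of_int (i - 1) * l"] by (simp add: algebra_simps)
  qed
  have per2: "norm (W (z + of_int n * (2 * of_real pi * \<i>))) = norm (W z)" for z n
  proof -
    have "exp (z + of_int n * (2 * of_real pi * \<i>)) = exp z"
      using exp_plus_2pin[of z n] by (simp add: mult_ac)
    then show ?thesis unfolding W_def norm_mult by simp
  qed
  \<comment> \<open>A disc that meets every orbit of the lattice spanned by the two periods.\<close>
  define C where "C = cball (0::complex) (L + norm l + 2 * pi)"
  have "compact (W ` C)"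
    unfolding C_def by (intro compact_continuous_image holomorphic_on_imp_continuous_on
        holomorphic_on_subset[OF W]) auto
  then obtain M where M: "\<And>z. z \<in> C \<Longrightarrow> norm (W z) \<le> M"
    by (meson compact_imp_bounded bounded_iff imageI)
  have bound: "norm (W z) \<le> M" for z
  proof -
    define n where "n = \<lfloor>Re z / L\<rfloor>"
    define z1 where "z1 = z + of_int n * l"
    define k where "k = \<lfloor>Im z1 / (2 * pi)\<rfloor>"
    define z2 where "z2 = z1 + of_int (- k) * (2 * of_real pi * \<i>)"
    have "norm (W z2) = norm (W z)"
      unfolding z2_def z1_def by (simp only: per2 per1')
    moreover have "z2 \<in> C"
    proof -
      have "Re z1 = Re z - of_int n * L" by (simp add: z1_def Rel)
      moreover have "of_int n * L \<le> Re z" "Re z < (of_int n + 1) * L"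
        using L floor_divide_lower[of L "Re z"] floor_divide_upper[of L "Re z"] by (auto simp: n_def)
      ultimately have "\<bar>Re z2\<bar> \<le> L" by (simp add: z2_def algebra_simps)
      moreover have "of_int k * (2 * pi) \<le> Im z1" "Im z1 < (of_int k + 1) * (2 * pi)"
        using floor_divide_lower[of "2 * pi" "Im z1"] floor_divide_upper[of "2 * pi" "Im z1"]
        by (auto simp: k_def)
      then have "\<bar>Im z2\<bar> \<le> 2 * pi" by (simp add: z2_def algebra_simps)
      ultimately have "norm z2 \<le> L + 2 * pi" using cmod_le[of z2] by linarith
      also have "\<dots> \<le> L + norm l + 2 * pi" by simp
      finally show ?thesis unfolding C_def mem_cball_0 .
    qed
    ultimately show ?thesis using M by metis
  qed
  then have "bounded (range W)" by (auto simp: bounded_iff)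
  then obtain c where c: "\<And>z. W z = c"
    using Liouville_theorem[OF W] by (auto simp: constant_on_def)
  have vexp: "v (exp z) = c * exp (of_real \<beta> * z)" for z
    using c[of z] by (simp add: W_def exp_minus field_simps)
  have "c = 0"
  \<comment> \<open>For nonzero \<open>c\<close>, invariance of \<open>v (exp z)\<close> under
    \<open>z + 2 * pi * \<i>\<close> makes \<beta> an integer \<open>m\<close>, and comparing
    \<open>v q\<close> with \<open>v 1\<close> yields the excluded value
    \<open>K = q powi m\<close>.\<close>
  proof (rule ccontr)
    assume c0: "c \<noteq> 0"
    have "exp (2 * of_real pi * \<i>) = (1::complex)" by (rule exp_two_pi_i)
    then have "exp (of_real \<beta> * (2 * of_real pi * \<i>)) = (1::complex)"
      using vexp[of 0] vexp[of "2 * of_real pi * \<i>"] c0 by simp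
    then obtain m where m: "\<beta> = of_int m"
      unfolding exp_eq_1 by (auto simp: algebra_simps)
    have "v q = K * v 1" using K[of 1] by simp
    then have "exp (of_real \<beta> * l) = K"
      using vexp[of l] vexp[of 0] c0 expl by simp
    then have "K = q powi m"
      using expl by (metis m exp_power_int of_real_of_int_eq mult.commute)
    then show False using nK by blast
  qed
  moreover obtain z where "s = exp z" using s by (metis exp_Ln)
  ultimately show ?thesis using vexp by simp
qed

end

context nome begin
text \<open>A nonzero function with this multiplier has \<open>card P\<close> zeros modulo powers of
  \<open>q\<close>, and \<open>K\<close> prescribes their product; the points of \<open>P\<close>
  have the wrong product. The induction divides by one factor \<open>\<theta> (s / p)\<close> at a
  time, which replaces \<open>K\<close> by \<open>- K / p\<close> and lowers the degree by one, down
  to the multiplicatively periodic case.\<close>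

lemma theta_space_zero:
  assumes "finite P" and "0 \<notin> P"
    and "f holomorphic_on - {0}"
    and "\<And>s. s \<noteq> 0 \<Longrightarrow> f (q * s) = K * s powi (- int (card P)) * f s"
    and "\<And>p. p \<in> P \<Longrightarrow> f p = 0"
    and "\<And>p p' m. p \<in> P \<Longrightarrow> p' \<in> P \<Longrightarrow> p = p' * q powi m \<Longrightarrow> p = p'"
    and "\<And>m. K \<noteq> (-1) ^ card P * \<Prod>P * q powi m"
    and "s \<noteq> 0"
  shows "f s = 0"
  using assms
proof (induction P arbitrary: f K s rule: finite_induct)
  case empty
  then show ?case using multiplicatively_periodic_zero[of f K s] by simp
next
  case (insert p P)
  note P0 = insert.prems(1) and f = insert.prems(2) and per = insert.prems(3)
    and van = insert.prems(4) and dist = insert.prems(5) and nK = insert.prems(6) and s = insert.prems(7)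
  show ?case
  proof (cases "K = 0")
    case True
    then show ?thesis using per[of "s / q"] s q_nz by simp
  next
    case K0: False
    have p0: "p \<noteq> 0" using P0 by auto
    define h where "h = (\<lambda>s. \<theta> (s / p))"
    have h: "h holomorphic_on - {0}"
      unfolding h_def using p0 by (intro holomorphic_intros) auto
    \<comment> \<open>Quasi-periodicity spreads a zero over its whole orbit. This is needed for the
      division by \<open>h\<close>, which vanishes on the entire orbit of \<open>p\<close>.\<close>
    have fz: "f (p' * q powi m) = 0" if p': "p' \<in> insert p P" for p' m
    proof (induction m rule: int_induct[where k = 0])
      case base
      then show ?case using van[OF p'] by simp
    next
      case (step1 i)
      have "p' \<noteq> 0" using p' P0 by auto
      then show ?case using per[of "p' * q powi i"] step1 q_nz
        by (simp add: power_int_add mult_ac)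
    next
      case (step2 i)
      have p'0: "p' \<noteq> 0" using p' P0 by auto
      have "q * (p' * q powi (i - 1)) = p' * q powi i"
        using q_nz by (simp add: power_int_diff)
      then have "f (p' * q powi i) = K * (p' * q powi (i - 1)) powi (- int (card (insert p P))) * f (p' * q powi (i - 1))"
        using per[of "p' * q powi (i - 1)"] p'0 by (metis mult_eq_0_iff powi_nz)
      then show ?case using step2 p'0 K0 q_nz by simp
    qed
    have "f x = 0 \<and> deriv h x \<noteq> 0" if x: "x \<in> - {0}" "h x = 0" for x
    proof
      obtain m where "x / p = q powi m" using x theta_eq_0_iff[of "x / p"] p0 by (auto simp: h_def)
      then have "x = p * q powi m" using p0 by (simp add: field_simps)
      then show "f x = 0" using fz by simp
      have "(h has_field_derivative deriv \<theta> (x / p) * (1 / p)) (at x)"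
        unfolding h_def using x p0
        by (intro DERIV_chain2[OF theta_has_deriv]) (auto intro!: derivative_eq_intros)
      then have "deriv h x = deriv \<theta> (x / p) * (1 / p)" by (rule DERIV_imp_deriv)
      then show "deriv h x \<noteq> 0" using deriv_theta_nz[of "x / p"] x p0 by (auto simp: h_def)
    qed
    then obtain g where g: "g holomorphic_on - {0}" and fg: "\<And>s. s \<noteq> 0 \<Longrightarrow> f s = h s * g s"
      using holomorphic_divide_simple_zeros[OF _ f h] by auto
    have hq: "h (q * s) = - p / s * h s" if "s \<noteq> 0" for s
      using that p0 theta_shift[of "s / p"] by (simp add: h_def)
    define K' where "K' = - K / p"
    have gper: "g (q * s) = K' * s powi (- int (card P)) * g s" if s0: "s \<noteq> 0" for s
    proof -
      txt \<open>At a zero of \<open>h\<close> the identity follows by continuity.\<close>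
      define u where "u = (\<lambda>s. g (q * s) - K' * s powi (- int (card P)) * g s)"
      have u: "u holomorphic_on - {0}"
        unfolding u_def using q_nz
        by (intro holomorphic_intros holomorphic_on_compose_gen[OF _ g, unfolded o_def] g) auto
      have hu: "h s * u s = 0" if "s \<noteq> 0" for s
      proof -
        have "- int (card (insert p P)) = - int (card P) - 1" using insert.hyps by simp
        then have "s powi (- int (card (insert p P))) = s powi (- int (card P)) / s"
          using that power_int_diff[of s "- int (card P)" 1] by (simp only:) simp
        then have "- p / s * h s * g (q * s) = K * (s powi (- int (card P)) / s) * (h s * g s)"
          using per[OF that] fg[of s] fg[of "q * s"] hq[OF that] that q_nz by simp
        then have "- p * (h s * g (q * s)) = K * s powi (- int (card P)) * (h s * g s)"
          using that by (simp add: field_simps)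
        moreover have "p * (h s * u s) = p * (h s * g (q * s)) + K * s powi (- int (card P)) * (h s * g s)"
          using p0 by (simp add: u_def K'_def field_simps)
        ultimately have "p * (h s * u s) = 0" by (metis add.right_inverse mult_minus_left)
        then show ?thesis using p0 by simp
      qed
      have "u s = 0"
      proof (rule ccontr)
        assume us: "u s \<noteq> 0"
        have "isCont u s"
          using u s0 by (auto intro!: field_differentiable_imp_continuous_at holomorphic_on_imp_differentiable_at[of _ "- {0}"])
        then have "eventually (\<lambda>y. u y \<noteq> 0) (at s)"
          using us tendsto_imp_eventually_ne by (auto simp: isCont_def)
        moreover have "eventually (\<lambda>y. y \<noteq> 0) (at s)" 
          using s0 by (simp add: eventually_neq_at_within)
        ultimately have ev: "eventually (\<lambda>y. h y = 0) (at s)"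
          by eventually_elim (use hu in auto)
        have hs: "h s = 0" using hu[OF s0] us by auto
        have "eventually (\<lambda>y. h y = 0) (nhds s)"
          using ev hs by (simp add: eventually_nhds_conv_at)
        then have "deriv h s = deriv (\<lambda>_. 0) s" by (intro deriv_cong_ev) auto
        then show False
          using \<open>\<And>x. x \<in> - {0} \<Longrightarrow> h x = 0 \<Longrightarrow> f x = 0 \<and> deriv h x \<noteq> 0\<close>[of s] hs s0 by auto
      qed
      then show ?thesis by (simp add: u_def)
    qed
    have gvan: "g p' = 0" if p': "p' \<in> P" for p'
    proof -
      have p'0: "p' \<noteq> 0" using p' P0 by auto
      have "h p' \<noteq> 0"
      proof
        assume "h p' = 0"
        then obtain m where "p' / p = q powi m"
          using theta_eq_0_iff[of "p' / p"] p0 p'0 by (auto simp: h_def)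
        then have "p' = p" using dist[of p' p m] p' p0 by (simp add: field_simps)
        then show False using insert.hyps p' by simp
      qed
      then show ?thesis using fg[OF p'0] van[of p'] p' by simp
    qed
    have gK: "K' \<noteq> (-1) ^ card P * \<Prod>P * q powi m" for m
    proof
      assume "K' = (-1) ^ card P * \<Prod>P * q powi m"
      moreover have "K = - p * K'" using p0 by (simp add: K'_def)
      ultimately have "K = (-1) ^ card (insert p P) * \<Prod>(insert p P) * q powi m"
        using insert.hyps by simp
      then show False using nK by blast
    qed
    have "g s = 0"
    proof (rule insert.IH[OF _ g gper gvan _ gK s])
      show "0 \<notin> P" using P0 by simp
      show "p1 = p2" if "p1 \<in> P" "p2 \<in> P" "p1 = p2 * q powi m" for p1 p2 m
        using dist[OF _ _ that(3)] that(1,2) by simp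
    qed
    then show ?thesis using fg[OF s] by simp
  qed
qed

end

section \<open>Bilateral series in one variable\<close>

lemma summable_on_power_abs_int:
  fixes \<rho> :: real
  assumes "0 \<le> \<rho>" "\<rho> < 1"
  shows "(\<lambda>k::int. \<rho> ^ nat \<bar>k\<bar>) summable_on UNIV"
proof -
  have s: "(\<lambda>n::nat. \<rho> ^ n) summable_on UNIV"
    using assms by (intro norm_summable_imp_summable_on) (simp add: summable_geometric)
  have "(\<lambda>k::int. \<rho> ^ nat \<bar>k\<bar>) summable_on range int"
    by (subst summable_on_reindex) (auto simp: o_def s)
  moreover have "(\<lambda>k::int. \<rho> ^ nat \<bar>k\<bar>) summable_on range (\<lambda>n. - int n)"
    by (subst summable_on_reindex) (auto simp: o_def s inj_on_def)
  ultimately have "(\<lambda>k::int. \<rho> ^ nat \<bar>k\<bar>) summable_on range int \<union> range (\<lambda>n. - int n)"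
    by (rule summable_on_union)
  moreover have "range int \<union> range (\<lambda>n. - int n) = UNIV"
  proof -
    have "k \<in> range int \<union> range (\<lambda>n. - int n)" for k :: int
      by (cases k rule: int_cases2) auto
    then show ?thesis by auto
  qed
  ultimately show ?thesis by simp
qed

context nome begin

text \<open>The ratio of consecutive terms is controlled through \<open>x * q powi k\<close> alone, near \<open>0\<close> and near \<open>\<infinity>\<close>.\<close>

lemma bilateral_majorant:
  fixes T :: "int \<Rightarrow> complex \<Rightarrow> complex"
  assumes T: "\<And>k. continuous_on (- {0}) (T k)"
    and \<rho>: "0 < \<rho>" "\<rho> < 1" and \<delta>: "\<delta> > 0"
    and near_0: "\<And>k x. x \<noteq> 0 \<Longrightarrow> norm (x * q powi k) < \<delta> \<Longrightarrow> norm (T (k + 1) x) \<le> \<rho> * norm (T k x)"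
    and near_inf: "\<And>k x. x \<noteq> 0 \<Longrightarrow> norm (x * q powi k) > R \<Longrightarrow> norm (T k x) \<le> \<rho> * norm (T (k + 1) x)"
    and X: "compact X" "0 \<notin> X"
  obtains M where "M summable_on UNIV" "\<And>k x. x \<in> X \<Longrightarrow> norm (T k x) \<le> M k"
proof -
  obtain m0 where m0: "m0 > 0" "\<And>x. x \<in> X \<Longrightarrow> m0 \<le> norm x"
    using separate_point_closed[of X 0] X compact_imp_closed by force
  obtain m1 where m1: "m1 > 0" "\<And>x. x \<in> X \<Longrightarrow> norm x \<le> m1"
    using compact_imp_bounded[OF X(1)] by (auto simp: bounded_pos)
  have qpos: "norm q > 0" using q_nz by simp
  \<comment> \<open>From \<open>k1\<close> on, all points \<open>x * q powi k\<close> with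
    \<open>x\<close> in \<open>X\<close> lie in the disc of radius \<delta>; below
    \<open>- k2\<close> they all lie outside radius \<open>R\<close>. The number
    \<open>\<bar>R\<bar> + 1\<close> exceeds \<open>R\<close> and is positive whatever the sign of
    \<open>R\<close>.\<close>
  obtain k1 :: nat where k1: "norm q ^ k1 < \<delta> / m1"
    using real_arch_pow_inv[of "\<delta> / m1" "norm q"] \<delta> m1 q_lt1 by auto
  obtain k2 :: nat where k2: "norm q ^ k2 < m0 / (\<bar>R\<bar> + 1)"
    using real_arch_pow_inv[of "m0 / (\<bar>R\<bar> + 1)" "norm q"] m0 q_lt1 by auto
  have "\<exists>b. \<forall>x\<in>X. norm (T k x) \<le> b" for k
  proof -
    have "compact (T k ` X)"
      using X by (intro compact_continuous_image continuous_on_subset[OF T]) auto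
    then show ?thesis using compact_imp_bounded by (force simp: bounded_iff)
  qed
  then obtain b where b: "\<And>k x. x \<in> X \<Longrightarrow> norm (T k x) \<le> b k" by metis
  define C where "C = (\<Sum>k\<in>{- int k2..int k1}. \<bar>b k\<bar>)"
  have C: "norm (T k x) \<le> C" if "x \<in> X" "k \<in> {- int k2..int k1}" for k x
  proof -
    have "norm (T k x) \<le> \<bar>b k\<bar>" using b[OF that(1), of k] by linarith
    also have "\<dots> \<le> C" unfolding C_def by (rule member_le_sum) (use that in auto)
    finally show ?thesis .
  qed
  have C0: "C \<ge> 0" unfolding C_def by (intro sum_nonneg) auto
  have up: "norm (T (int k1 + int l) x) \<le> \<rho> ^ l * C" if x: "x \<in> X" for x l
  proof (induction l)
    case 0
    then show ?case using C[OF x] by simp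
  next
    case (Suc l)
    have "norm (x * q powi (int k1 + int l)) \<le> m1 * norm q ^ (k1 + l)"
      using m1(2)[OF x] by (simp add: norm_mult norm_power norm_power_int mult_right_mono flip: of_nat_add)
    also have "\<dots> \<le> m1 * norm q ^ k1"
      using m1(1) q_lt1 by (intro mult_left_mono power_decreasing) auto
    also have "\<dots> < \<delta>" using k1 m1(1) by (simp add: field_simps)
    finally have "norm (T (int k1 + int l + 1) x) \<le> \<rho> * norm (T (int k1 + int l) x)"
      using x X(2) by (intro near_0) auto
    also have "\<dots> \<le> \<rho> * (\<rho> ^ l * C)" using \<rho> Suc by (intro mult_left_mono) auto
    finally show ?case by (simp add: algebra_simps)
  qed
  have down: "norm (T (- int k2 - int l) x) \<le> \<rho> ^ l * C" if x: "x \<in> X" for x l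
  proof (induction l)
    case 0
    then show ?case using C[OF x] by simp
  next
    case (Suc l)
    have "R < (\<bar>R\<bar> + 1)" by simp
    also have "\<dots> \<le> m0 / norm q ^ k2"
      using k2 qpos by (simp add: field_simps)
    also have "\<dots> \<le> m0 / norm q ^ (k2 + Suc l)"
      using m0(1) q_lt1 qpos by (intro divide_left_mono power_decreasing) auto
    also have "\<dots> \<le> norm (x * q powi (- int k2 - int (Suc l)))"
    proof -
      have "- int k2 - int (Suc l) = - int (k2 + Suc l)" by simp
      then have "norm (x * q powi (- int k2 - int (Suc l))) = norm x / norm q ^ (k2 + Suc l)"
        by (simp only: norm_mult norm_power norm_inverse power_int_minus power_int_of_nat divide_inverse)
      then show ?thesis using m0(2)[OF x] by (simp add: divide_right_mono)
    qed
    finally have "norm (T (- int k2 - int (Suc l)) x) \<le> \<rho> * norm (T (- int k2 - int (Suc l) + 1) x)"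
      using x X(2) by (intro near_inf) auto
    also have "- int k2 - int (Suc l) + 1 = - int k2 - int l" by simp
    also have "\<rho> * norm (T (- int k2 - int l) x) \<le> \<rho> * (\<rho> ^ l * C)"
      using \<rho> Suc by (intro mult_left_mono) auto
    finally show ?case by (simp add: algebra_simps)
  qed
  \<comment> \<open>\<open>\<bar>k\<bar>\<close> exceeds the number of geometric steps available by
    at most \<open>k1 + k2\<close>; dividing by \<open>\<rho> ^ (k1 + k2)\<close> makes one bound
    serve both tails and the middle range.\<close>
  define M where "M = (\<lambda>k::int. C / \<rho> ^ (k1 + k2) * \<rho> ^ nat \<bar>k\<bar>)"
  show ?thesis
  proof (rule that)
    show "M summable_on UNIV"
      unfolding M_def using \<rho> by (intro summable_on_cmult_right summable_on_power_abs_int) auto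
    fix k x assume x: "x \<in> X"
    have le: "\<rho> ^ l * C \<le> M k" if "nat \<bar>k\<bar> \<le> l + (k1 + k2)" for l
    proof -
      have "\<rho> ^ l * \<rho> ^ (k1 + k2) * C \<le> \<rho> ^ nat \<bar>k\<bar> * C"
        using \<rho> C0 power_decreasing[OF that, of \<rho>] by (intro mult_right_mono) (auto simp: power_add)
      then show ?thesis using \<rho> by (simp add: M_def field_simps)
    qed
    consider "k > int k1" | "k < - int k2" | "k \<in> {- int k2..int k1}" by fastforce
    then show "norm (T k x) \<le> M k"
    proof cases
      case 1
      then have "norm (T k x) \<le> \<rho> ^ nat (k - int k1) * C" using up[OF x, of "nat (k - int k1)"] by simp
      also have "\<dots> \<le> M k" by (rule le) (use 1 in auto)
      finally show ?thesis .
    next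
      case 2
      then have "norm (T k x) \<le> \<rho> ^ nat (- int k2 - k) * C" using down[OF x, of "nat (- int k2 - k)"] by simp
      also have "\<dots> \<le> M k" by (rule le) (use 2 in auto)
      finally show ?thesis .
    next
      case 3
      then have "norm (T k x) \<le> \<rho> ^ 0 * C" using C[OF x] by simp
      also have "\<dots> \<le> M k" by (rule le) (use 3 in auto)
      finally show ?thesis .
    qed
  qed
qed

lemma bilateral_series:
  fixes T :: "int \<Rightarrow> complex \<Rightarrow> complex"
  assumes T: "\<And>k. T k holomorphic_on - {0}"
    and \<rho>: "0 < \<rho>" "\<rho> < 1" and \<delta>: "\<delta> > 0"
    and near_0: "\<And>k x. x \<noteq> 0 \<Longrightarrow> norm (x * q powi k) < \<delta> \<Longrightarrow> norm (T (k + 1) x) \<le> \<rho> * norm (T k x)"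
    and near_inf: "\<And>k x. x \<noteq> 0 \<Longrightarrow> norm (x * q powi k) > R \<Longrightarrow> norm (T k x) \<le> \<rho> * norm (T (k + 1) x)"
  shows bilateral_series_holomorphic: "(\<lambda>x. \<Sum>\<^sub>\<infinity>k. T k x) holomorphic_on - {0}"
    and bilateral_series_summable: "x \<noteq> 0 \<Longrightarrow> (\<lambda>k. norm (T k x)) summable_on UNIV"
proof -
  have maj: "\<exists>M. M summable_on UNIV \<and> (\<forall>k. \<forall>x\<in>X. norm (T k x) \<le> M k)" if "compact X" "0 \<notin> X" for X
  proof (rule bilateral_majorant[where T = T and \<rho> = \<rho> and \<delta> = \<delta> and R = R and X = X])
    show "\<And>k. continuous_on (- {0}) (T k)" using T by (simp add: holomorphic_on_imp_continuous_on)
  qed (use assms that in auto)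
  show "(\<lambda>k. norm (T k x)) summable_on UNIV" if x: "x \<noteq> 0"
  proof -
    have "\<exists>M. M summable_on UNIV \<and> (\<forall>k. norm (T k x) \<le> M k)"
      using maj[of "{x}"] x by simp
    then obtain M where M: "M summable_on UNIV" "\<forall>k. norm (T k x) \<le> M k" by blast
    show ?thesis by (rule Infinite_Sum.abs_summable_on_comparison_test'[OF M(1)]) (use M(2) in simp)
  qed
  show "(\<lambda>x. \<Sum>\<^sub>\<infinity>k. T k x) holomorphic_on - {0}"
  proof -
    have "(\<lambda>x. \<Sum>\<^sub>\<infinity>k. T k x) field_differentiable (at z)" if z: "z \<in> - {0}" for z
    proof -
      define r where "r = norm z / 2"
      have r: "r > 0" "cball z r \<subseteq> - {0}" using z by (auto simp: r_def)
      have "\<exists>M. M summable_on UNIV \<and> (\<forall>k. \<forall>x\<in>cball z r. norm (T k x) \<le> M k)"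
        by (rule maj) (use r in auto)
      then obtain M where M: "M summable_on UNIV" "\<forall>k. \<forall>x\<in>cball z r. norm (T k x) \<le> M k" by blast
      have "uniform_limit (cball z r) (\<lambda>X y. \<Sum>k\<in>X. T k y) (\<lambda>y. \<Sum>\<^sub>\<infinity>k. T k y) (finite_subsets_at_top UNIV)"
        by (rule Weierstrass_m_test_general[OF _ M(1)]) (use M(2) in blast)
      then obtain "(\<lambda>y. \<Sum>\<^sub>\<infinity>k. T k y) holomorphic_on ball z r"
      proof (rule holomorphic_uniform_limit[rotated])
        have "(\<lambda>y. \<Sum>k\<in>X. T k y) holomorphic_on cball z r" for X
          using r by (intro holomorphic_intros holomorphic_on_subset[OF T]) auto
        then show "\<forall>\<^sub>F X in finite_subsets_at_top UNIV. continuous_on (cball z r) (\<lambda>y. \<Sum>k\<in>X. T k y) \<and>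
            (\<lambda>y. \<Sum>k\<in>X. T k y) holomorphic_on ball z r"
          by (intro always_eventually allI conjI holomorphic_on_imp_continuous_on)
             (auto intro: holomorphic_on_subset[OF _ ball_subset_cball])
      qed auto
      then show ?thesis using r by (auto intro: holomorphic_on_imp_differentiable_at)
    qed
    then show ?thesis by (simp add: holomorphic_on_def field_differentiable_at_within)
  qed
qed

section \<open>Pole-free normalisation of the bilateral summand\<close>

definition numer :: "nat \<Rightarrow> (nat \<Rightarrow> complex) \<Rightarrow> (nat \<Rightarrow> complex) \<Rightarrow> complex \<Rightarrow> complex" where
  "numer n A B x = (\<Prod>m\<in>{1..n}. qpinf (A m * x) q * qpinf (q / (B m * x)) q)"

text \<open>The constant in the quasi-periodicity of the theta product: replacing \<open>x\<close>
  by \<open>q * x\<close> multiplies the product of all \<open>\<theta> (B m * x)\<close> by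
  \<open>kap n B * x powi (- int n)\<close>.\<close>

definition kap :: "nat \<Rightarrow> (nat \<Rightarrow> complex) \<Rightarrow> complex" where
  "kap n B = (\<Prod>m\<in>{1..n}. - 1 / B m)"

text \<open>The quotient of theta products \<open>\<Prod>m. \<theta> (B m * x) / \<theta> (B m * x * q powi k)\<close>, written as the
  monomial that it is, so that it makes sense at the zeros of the denominator.\<close>

definition shift_factor :: "nat \<Rightarrow> (nat \<Rightarrow> complex) \<Rightarrow> int \<Rightarrow> complex \<Rightarrow> complex" where
  "shift_factor n B k x = kap n B powi (- k) * (x powi k) ^ n * (q powi (k * (k - 1) div 2)) ^ n"

text \<open>This is \<open>numer n A B x\<close> times all quotients
  \<open>qpoch (B m * x) q k / qpoch (A m * x) q k\<close>, in a form free of poles in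
  \<open>x\<close>: \<open>qpinf (A m * x) q\<close> cancels those of the denominators for positive
  \<open>k\<close>, and \<open>qpinf (q / (B m * x)) q\<close> those of the numerators for negative
  \<open>k\<close>.\<close>

definition unit_term :: "nat \<Rightarrow> (nat \<Rightarrow> complex) \<Rightarrow> (nat \<Rightarrow> complex) \<Rightarrow> int \<Rightarrow> complex \<Rightarrow> complex" where
  "unit_term n A B k x = numer n A B (x * q powi k) * shift_factor n B k x"

definition series_term :: "nat \<Rightarrow> (nat \<Rightarrow> complex) \<Rightarrow> (nat \<Rightarrow> complex) \<Rightarrow> complex \<Rightarrow> nat \<Rightarrow> int \<Rightarrow> complex \<Rightarrow> complex" where
  "series_term n A B t j k x = t powi k * (x * q powi k) ^ j * unit_term n A B k x"

lemma kap_nz: "(\<forall>m\<in>{1..n}. B m \<noteq> 0) \<Longrightarrow> kap n B \<noteq> 0"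
  by (simp add: kap_def)

text \<open>One application of \<open>qpinf_rec\<close> to each infinite product. The identity is
  cross-multiplied so that it also holds where a linear factor vanishes.\<close>

lemma numer_shift:
  assumes B: "\<forall>m\<in>{1..n}. B m \<noteq> 0" and x: "x \<noteq> 0"
  shows "numer n A B (q * x) * (\<Prod>m\<in>{1..n}. 1 - A m * x) * x ^ n
       = kap n B * (\<Prod>m\<in>{1..n}. 1 - B m * x) * numer n A B x"
proof -
  have "qpinf (A m * (q * x)) q * qpinf (q / (B m * (q * x))) q * (1 - A m * x) * x
      = (- 1 / B m) * (1 - B m * x) * (qpinf (A m * x) q * qpinf (q / (B m * x)) q)"
    if m: "m \<in> {1..n}" for m
  proof -
    have b: "B m \<noteq> 0" using B m by simp
    have h1: "qpinf (A m * x) q = (1 - A m * x) * qpinf (A m * (q * x)) q"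
      by (subst qpinf_rec) (simp add: mult_ac)
    have h2: "qpinf (q / (B m * (q * x))) q = (1 - 1 / (B m * x)) * qpinf (q / (B m * x)) q"
      using q_nz by (subst qpinf_rec) (simp add: mult_ac)
    have h3: "(1 - 1 / (B m * x)) * x = (- 1 / B m) * (1 - B m * x)"
      using b x by (simp add: field_simps)
    have "qpinf (A m * (q * x)) q * qpinf (q / (B m * (q * x))) q * (1 - A m * x) * x
      = ((1 - 1 / (B m * x)) * x) * ((1 - A m * x) * qpinf (A m * (q * x)) q) * qpinf (q / (B m * x)) q"
      by (simp only: h2) (simp add: mult_ac)
    then show ?thesis by (simp only: h3 flip: h1) (simp add: mult_ac)
  qed
  then have "(\<Prod>m\<in>{1..n}. qpinf (A m * (q * x)) q * qpinf (q / (B m * (q * x))) q * (1 - A m * x) * x)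
      = (\<Prod>m\<in>{1..n}. (- 1 / B m) * (1 - B m * x) * (qpinf (A m * x) q * qpinf (q / (B m * x)) q))"
    by (intro prod.cong) auto
  then show ?thesis
    by (simp only: numer_def kap_def prod.distrib prod_constant card_atLeastAtMost) (simp add: mult_ac)
qed

lemma numer_holomorphic:
  assumes B: "\<forall>m\<in>{1..n}. B m \<noteq> 0"
  shows "numer n A B holomorphic_on - {0}"
proof -
  have "(\<lambda>x. numer n A B x) holomorphic_on - {0}"
    unfolding numer_def by (intro holomorphic_intros) (use B in auto)
  then show ?thesis by simp
qed

lemma triangular_Suc: "(k + 1) * (k + 1 - 1) div 2 = k * (k - 1) div 2 + (k :: int)"
proof -
  have "(k + 1) * (k + 1 - 1) = k * (k - 1) + k * 2" by (simp add: algebra_simps)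
  then show ?thesis by simp
qed

lemma shift_factor_Suc:
  assumes B: "\<forall>m\<in>{1..n}. B m \<noteq> 0" and x: "x \<noteq> 0"
  shows "shift_factor n B (k + 1) x * kap n B = shift_factor n B k x * (x * q powi k) ^ n"
proof -
  have "kap n B powi (- (k + 1)) * kap n B = kap n B powi (- k)"
    using kap_nz[OF B] power_int_add_1[of "kap n B" "- (k + 1)"] by simp
  moreover have "x powi (k + 1) = x powi k * x" using x by (simp add: power_int_add_1)
  moreover have "q powi ((k + 1) * (k + 1 - 1) div 2) = q powi (k * (k - 1) div 2) * q powi k"
    by (simp only: triangular_Suc powi_add)
  ultimately show ?thesis
    by (simp add: shift_factor_def power_mult_distrib)
qed

lemma shift_factor_shift: "shift_factor n B k (q * x) = shift_factor n B k x * (q powi k) ^ n"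
  by (simp add: shift_factor_def power_int_mult_distrib power_mult_distrib)

lemma unit_term_0 [simp]: "unit_term n A B 0 x = numer n A B x"
  by (simp add: unit_term_def shift_factor_def)

lemma unit_term_Suc:
  assumes B: "\<forall>m\<in>{1..n}. B m \<noteq> 0" and x: "x \<noteq> 0"
  shows "unit_term n A B (k + 1) x * (\<Prod>m\<in>{1..n}. 1 - A m * (x * q powi k))
       = (\<Prod>m\<in>{1..n}. 1 - B m * (x * q powi k)) * unit_term n A B k x"
proof -
  define y where "y = x * q powi k"
  have y: "y \<noteq> 0" using x by (simp add: y_def)
  have "x * q powi (k + 1) = q * y" using q_nz by (simp add: y_def power_int_add_1)
  then have U: "unit_term n A B (k + 1) x = numer n A B (q * y) * shift_factor n B (k + 1) x"
    by (simp add: unit_term_def)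
  let ?PA = "\<Prod>m\<in>{1..n}. 1 - A m * y" and ?PB = "\<Prod>m\<in>{1..n}. 1 - B m * y"
  have "unit_term n A B (k + 1) x * ?PA * (y ^ n * kap n B)
      = (numer n A B (q * y) * ?PA * y ^ n) * (shift_factor n B (k + 1) x * kap n B)"
    by (simp add: U mult_ac)
  also have "\<dots> = (kap n B * ?PB * numer n A B y) * (shift_factor n B k x * y ^ n)"
    using numer_shift[where A = A, OF B y] shift_factor_Suc[OF B x, where k = k] by (simp add: y_def)
  also have "\<dots> = ?PB * unit_term n A B k x * (y ^ n * kap n B)"
    by (simp add: unit_term_def y_def mult_ac)
  finally show ?thesis using y kap_nz[OF B] by (simp add: y_def)
qed

text \<open>Moving the base point by \<open>q\<close> and moving the index by one reach the same
  point \<open>x * q powi (k + 1)\<close>; only the monomial \<open>shift_factor\<close> differs, by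
  a factor free of \<open>k\<close>.\<close>

lemma unit_term_shift:
  assumes B: "\<forall>m\<in>{1..n}. B m \<noteq> 0" and x: "x \<noteq> 0"
  shows "unit_term n A B k (q * x) * x ^ n = kap n B * unit_term n A B (k + 1) x"
proof -
  have eq: "q * x * q powi k = x * q powi (k + 1)" using q_nz by (simp add: power_int_add_1)
  have "unit_term n A B k (q * x) * x ^ n
      = numer n A B (x * q powi (k + 1)) * (shift_factor n B k x * (x * q powi k) ^ n)"
    unfolding unit_term_def shift_factor_shift eq by (simp add: power_mult_distrib)
  also have "\<dots> = numer n A B (x * q powi (k + 1)) * (shift_factor n B (k + 1) x * kap n B)"
    by (simp only: shift_factor_Suc[OF B x])
  finally show ?thesis by (simp add: unit_term_def)
qed

lemma unit_term_holomorphic: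
  assumes B: "\<forall>m\<in>{1..n}. B m \<noteq> 0"
  shows "unit_term n A B k holomorphic_on - {0}"
proof -
  have "(\<lambda>x. numer n A B (x * q powi k)) holomorphic_on - {0}"
    by (rule holomorphic_on_compose_gen[OF _ numer_holomorphic[OF B], unfolded o_def])
       (auto intro!: holomorphic_intros)
  then have "(\<lambda>x. unit_term n A B k x) holomorphic_on - {0}"
    unfolding unit_term_def shift_factor_def by (intro holomorphic_intros) auto
  then show ?thesis by simp
qed

lemma series_term_holomorphic:
  assumes B: "\<forall>m\<in>{1..n}. B m \<noteq> 0"
  shows "series_term n A B t j k holomorphic_on - {0}"
proof -
  have "(\<lambda>x. series_term n A B t j k x) holomorphic_on - {0}"
    unfolding series_term_def by (intro holomorphic_intros unit_term_holomorphic[OF B]) auto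
  then show ?thesis by simp
qed

lemma series_term_Suc:
  assumes B: "\<forall>m\<in>{1..n}. B m \<noteq> 0" and x: "x \<noteq> 0" and t: "t \<noteq> 0"
  shows "series_term n A B t j (k + 1) x * (\<Prod>m\<in>{1..n}. 1 - A m * (x * q powi k))
       = t * q ^ j * (\<Prod>m\<in>{1..n}. 1 - B m * (x * q powi k)) * series_term n A B t j k x"
proof -
  have "series_term n A B t j (k + 1) x * (\<Prod>m\<in>{1..n}. 1 - A m * (x * q powi k))
      = t powi (k + 1) * (x * q powi (k + 1)) ^ j *
        (unit_term n A B (k + 1) x * (\<Prod>m\<in>{1..n}. 1 - A m * (x * q powi k)))"
    by (simp add: series_term_def)
  also have "\<dots> = t powi (k + 1) * (x * q powi (k + 1)) ^ j *
        ((\<Prod>m\<in>{1..n}. 1 - B m * (x * q powi k)) * unit_term n A B k x)"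
    by (simp only: unit_term_Suc[OF B x])
  finally show ?thesis
    using t q_nz by (simp add: series_term_def power_int_add_1 power_mult_distrib mult_ac)
qed

lemma series_term_shift:
  assumes B: "\<forall>m\<in>{1..n}. B m \<noteq> 0" and x: "x \<noteq> 0" and t: "t \<noteq> 0"
  shows "series_term n A B t j k (q * x) = kap n B / t * x powi (- int n) * series_term n A B t j (k + 1) x"
proof -
  have 1: "q * x * q powi k = x * q powi (k + 1)" by (simp add: power_int_add_1)
  have 2: "unit_term n A B k (q * x) = kap n B * unit_term n A B (k + 1) x * x powi (- int n)"
    using unit_term_shift[OF B x, where A = A and k = k] x by (simp add: power_int_minus field_simps)
  have 3: "t powi k = t powi (k + 1) / t" using t by (simp add: power_int_add_1)
  show ?thesis unfolding series_term_def 1 2 by (subst 3) (simp add: mult_ac)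
qed

text \<open>With \<open>y = x * q powi k\<close>, the ratio of consecutive terms is
  \<open>t * q ^ j\<close> times the quotient of the products of \<open>1 - B m * y\<close> and
  \<open>1 - A m * y\<close>. It tends to \<open>t * q ^ j\<close> as \<open>y\<close> tends to 0,
  and to that value times the quotient of the products of the \<open>B m\<close> and the
  \<open>A m\<close> at infinity. The bound at infinity is the more demanding the larger
  \<open>j\<close> is, so \<open>J\<close> covers all \<open>j \<le> J\<close>.\<close>

lemma series_term_bounds:
  assumes B: "\<forall>m\<in>{1..n}. B m \<noteq> 0" and t: "t \<noteq> 0" "norm t < 1"
    and J: "norm (\<Prod>m\<in>{1..n}. A m) < norm (t * q ^ J * (\<Prod>m\<in>{1..n}. B m))" and j: "j \<le> J"
  obtains \<rho> \<delta> R where "0 < \<rho>" "\<rho> < 1" "\<delta> > 0"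
    "\<And>k x. x \<noteq> 0 \<Longrightarrow> norm (x * q powi k) < \<delta> \<Longrightarrow>
       norm (series_term n A B t j (k + 1) x) \<le> \<rho> * norm (series_term n A B t j k x)"
    "\<And>k x. x \<noteq> 0 \<Longrightarrow> norm (x * q powi k) > R \<Longrightarrow>
       norm (series_term n A B t j k x) \<le> \<rho> * norm (series_term n A B t j (k + 1) x)"
proof -
  define PA where "PA = (\<lambda>y. \<Prod>m\<in>{1..n}. 1 - A m * y)"
  define PB where "PB = (\<lambda>y. \<Prod>m\<in>{1..n}. 1 - B m * y)"
  \<comment> \<open>The inverse of the limiting term ratio at infinity. The inverse is used because
    some \<open>A m\<close> may be zero.\<close>
  define L where "L = (\<Prod>m\<in>{1..n}. A m) / (\<Prod>m\<in>{1..n}. B m) / (t * q ^ j)"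
  have PBnz: "(\<Prod>m\<in>{1..n}. B m) \<noteq> 0" using B by simp
  have qj: "norm q ^ J \<le> norm q ^ j" using j q_lt1 by (intro power_decreasing) auto
  have "norm (\<Prod>m\<in>{1..n}. A m) < norm (t * q ^ j * (\<Prod>m\<in>{1..n}. B m))"
    using J qj by (auto simp: norm_mult norm_power intro!: mult_right_mono mult_left_mono elim!: less_le_trans)
  then have L1: "norm L < 1"
    unfolding L_def norm_divide using t q_nz PBnz by (simp add: norm_mult field_simps)
  have tj: "norm (t * q ^ j) < 1"
  proof -
    have "norm (t * q ^ j) \<le> norm t * 1"
      unfolding norm_mult norm_power using q_lt1 by (intro mult_left_mono power_le_one) auto
    then show ?thesis using t by simp
  qed
  obtain \<rho> where \<rho>: "max (norm (t * q ^ j)) (norm L) < \<rho>" "\<rho> < 1"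
    using dense[of "max (norm (t * q ^ j)) (norm L)" 1] tj L1 by auto
  have \<rho>0: "0 < \<rho>" using \<rho>(1) norm_ge_zero[of L] by linarith
  have rec: "series_term n A B t j (k + 1) x * PA (x * q powi k)
      = t * q ^ j * PB (x * q powi k) * series_term n A B t j k x" if "x \<noteq> 0" for k x
    unfolding PA_def PB_def using series_term_Suc[OF B that t(1)] .
  have c0: "((\<lambda>y. t * q ^ j * PB y / PA y) \<longlongrightarrow> t * q ^ j * PB 0 / PA 0) (at 0)"
    unfolding PA_def PB_def by (intro tendsto_intros) auto
  then have "((\<lambda>y. t * q ^ j * PB y / PA y) \<longlongrightarrow> t * q ^ j) (at 0)"
    by (simp add: PA_def PB_def)
  then have "eventually (\<lambda>y. norm (t * q ^ j * PB y / PA y) < \<rho>) (at 0)"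
    by (intro order_tendstoD(2)[OF tendsto_norm]) (use \<rho> in auto)
  moreover have "(PA \<longlongrightarrow> PA 0) (at 0)" unfolding PA_def by (intro tendsto_intros)
  then have "eventually (\<lambda>y. PA y \<noteq> 0) (at 0)"
    by (rule tendsto_imp_eventually_ne) (simp add: PA_def)
  ultimately have "eventually (\<lambda>y. norm (t * q ^ j * PB y / PA y) < \<rho> \<and> PA y \<noteq> 0) (at 0)"
    by eventually_elim auto
  then obtain \<delta> where \<delta>: "\<delta> > 0"
    "\<And>y. y \<noteq> 0 \<Longrightarrow> norm y < \<delta> \<Longrightarrow> norm (t * q ^ j * PB y / PA y) < \<rho> \<and> PA y \<noteq> 0"
    unfolding eventually_at by auto
  have quot: "((\<lambda>y. (1 - A m * y) / (1 - B m * y)) \<longlongrightarrow> A m / B m) at_infinity"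
    if m: "m \<in> {1..n}" for m
  proof -
    have "((\<lambda>y. (inverse y - A m) / (inverse y - B m)) \<longlongrightarrow> (0 - A m) / (0 - B m)) at_infinity"
      using bspec[OF B m] by (intro tendsto_intros tendsto_inverse_0) auto
    moreover have "eventually (\<lambda>y. (inverse y - A m) / (inverse y - B m) = (1 - A m * y) / (1 - B m * y)) at_infinity"
    proof -
      have "(inverse y - A m) / (inverse y - B m) = (1 - A m * y) / (1 - B m * y)" if "y \<noteq> 0" for y
      proof -
        have "(inverse y - A m) / (inverse y - B m) = (y * (inverse y - A m)) / (y * (inverse y - B m))"
          using that by simp
        also have "y * (inverse y - A m) = 1 - A m * y" using that by (simp add: algebra_simps)
        also have "y * (inverse y - B m) = 1 - B m * y" using that by (simp add: algebra_simps)
        finally show ?thesis .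
      qed
      then show ?thesis by (intro eventually_mono[OF eventually_not_equal_at_infinity[of 0]]) auto
    qed
    ultimately have "((\<lambda>y. (1 - A m * y) / (1 - B m * y)) \<longlongrightarrow> (0 - A m) / (0 - B m)) at_infinity"
      by (rule Lim_transform_eventually)
    then show ?thesis by simp
  qed
  have "((\<lambda>y. (\<Prod>m\<in>{1..n}. (1 - A m * y) / (1 - B m * y)) / (t * q ^ j)) \<longlongrightarrow>
       (\<Prod>m\<in>{1..n}. A m / B m) / (t * q ^ j)) at_infinity"
    using t q_nz by (intro tendsto_intros quot) auto
  then have "((\<lambda>y. PA y / PB y / (t * q ^ j)) \<longlongrightarrow> L) at_infinity"
    by (simp add: PA_def PB_def L_def prod_dividef)
  then have "eventually (\<lambda>y. norm (PA y / PB y / (t * q ^ j)) < \<rho>) at_infinity"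
    by (intro order_tendstoD(2)[OF tendsto_norm]) (use \<rho> in auto)
  moreover have "eventually (\<lambda>y. PB y \<noteq> 0) at_infinity"
  proof -
    have "eventually (\<lambda>y. \<forall>m\<in>{1..n}. y \<noteq> 1 / B m) at_infinity"
      by (intro eventually_ball_finite) (auto simp: eventually_not_equal_at_infinity)
    then show ?thesis by eventually_elim (use B in \<open>force simp: PB_def field_simps\<close>)
  qed
  ultimately have "eventually (\<lambda>y. norm (PA y / PB y / (t * q ^ j)) < \<rho> \<and> PB y \<noteq> 0) at_infinity"
    by eventually_elim auto
  then obtain R where R: "\<And>y. norm y \<ge> R \<Longrightarrow> norm (PA y / PB y / (t * q ^ j)) < \<rho> \<and> PB y \<noteq> 0"
    unfolding eventually_at_infinity by auto
  show ?thesis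
  proof (rule that[OF \<rho>0 \<rho>(2) \<delta>(1)])
    fix k x assume x: "(x::complex) \<noteq> 0"
    let ?y = "x * q powi k" and ?T = "series_term n A B t j"
    have y: "?y \<noteq> 0" using x by simp
    show "norm (?T (k + 1) x) \<le> \<rho> * norm (?T k x)" if s: "norm ?y < \<delta>"
    proof -
      have "?T (k + 1) x = t * q ^ j * PB ?y / PA ?y * ?T k x"
        using rec[OF x, of k] \<delta>(2)[OF y s] by (simp add: field_simps)
      then have "norm (?T (k + 1) x) = norm (t * q ^ j * PB ?y / PA ?y) * norm (?T k x)"
        by (simp only: norm_mult)
      then show ?thesis using \<delta>(2)[OF y s] by (simp add: mult_right_mono)
    qed
    show "norm (?T k x) \<le> \<rho> * norm (?T (k + 1) x)" if s: "norm ?y > R"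
    proof -
      have PB: "PB ?y \<noteq> 0" and r: "norm (PA ?y / PB ?y / (t * q ^ j)) \<le> \<rho>"
        using R[of ?y] s by auto
      have "?T k x = PA ?y / PB ?y / (t * q ^ j) * ?T (k + 1) x"
        using rec[OF x, of k] PB t(1) q_nz by (simp add: field_simps)
      then have "norm (?T k x) = norm (PA ?y / PB ?y / (t * q ^ j)) * norm (?T (k + 1) x)"
        by (simp only: norm_mult)
      also have "\<dots> \<le> \<rho> * norm (?T (k + 1) x)" by (intro mult_right_mono r) simp
      finally show ?thesis .
    qed
  qed
qed

definition bi_series :: "nat \<Rightarrow> (nat \<Rightarrow> complex) \<Rightarrow> (nat \<Rightarrow> complex) \<Rightarrow> complex \<Rightarrow> nat \<Rightarrow> complex \<Rightarrow> complex" where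
  "bi_series n A B t j x = (\<Sum>\<^sub>\<infinity>k. series_term n A B t j k x)"

lemma
  assumes B: "\<forall>m\<in>{1..n}. B m \<noteq> 0" and t: "t \<noteq> 0" "norm t < 1"
    and J: "norm (\<Prod>m\<in>{1..n}. A m) < norm (t * q ^ J * (\<Prod>m\<in>{1..n}. B m))" and j: "j \<le> J"
  shows bi_series_holomorphic: "bi_series n A B t j holomorphic_on - {0}"
    and series_term_summable: "x \<noteq> 0 \<Longrightarrow> (\<lambda>k. norm (series_term n A B t j k x)) summable_on UNIV"
proof -
  obtain \<rho> \<delta> R where h: "0 < \<rho>" "\<rho> < 1" "\<delta> > 0"
    "\<And>k x. x \<noteq> 0 \<Longrightarrow> norm (x * q powi k) < \<delta> \<Longrightarrow>
       norm (series_term n A B t j (k + 1) x) \<le> \<rho> * norm (series_term n A B t j k x)"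
    "\<And>k x. x \<noteq> 0 \<Longrightarrow> norm (x * q powi k) > R \<Longrightarrow>
       norm (series_term n A B t j k x) \<le> \<rho> * norm (series_term n A B t j (k + 1) x)"
    using series_term_bounds[OF B t J j] by blast
  have "(\<lambda>x. bi_series n A B t j x) holomorphic_on - {0}"
    unfolding bi_series_def by (rule bilateral_series_holomorphic[where T = "series_term n A B t j", OF series_term_holomorphic[OF B] h])
  then show "bi_series n A B t j holomorphic_on - {0}" by simp
  show "(\<lambda>k. norm (series_term n A B t j k x)) summable_on UNIV" if "x \<noteq> 0"
    by (rule bilateral_series_summable[where T = "series_term n A B t j", OF series_term_holomorphic[OF B] h that])
qed

text \<open>The multiplier in \<open>series_term_shift\<close> depends neither on the index
  \<open>k\<close> nor on \<open>j\<close>, so reindexing gives quasi-periodicity with one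
  multiplier for all monomials.\<close>

lemma bi_series_shift:
  assumes B: "\<forall>m\<in>{1..n}. B m \<noteq> 0" and x: "x \<noteq> 0" and t: "t \<noteq> 0"
  shows "bi_series n A B t j (q * x) = kap n B / t * x powi (- int n) * bi_series n A B t j x"
proof -
  have "bi_series n A B t j (q * x)
      = (\<Sum>\<^sub>\<infinity>k. kap n B / t * x powi (- int n) * series_term n A B t j (k + 1) x)"
    unfolding bi_series_def by (intro infsum_cong series_term_shift[OF B x t])
  also have "\<dots> = kap n B / t * x powi (- int n) * (\<Sum>\<^sub>\<infinity>k. series_term n A B t j (k + 1) x)"
    by (rule infsum_cmult_right')
  also have "(\<Sum>\<^sub>\<infinity>k. series_term n A B t j (k + 1) x) = bi_series n A B t j x"
    unfolding bi_series_def
    by (rule infsum_reindex_bij_betw[of "\<lambda>k. k + 1" UNIV UNIV "\<lambda>k. series_term n A B t j k x"])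
       (auto intro!: bij_betwI[where g = "\<lambda>k. k - 1"])
  finally show ?thesis .
qed

text \<open>Both sides obey the same first-order recurrence in \<open>k\<close> and agree at 0.
  Genericity of the \<open>B m * x\<close> makes the recurrence factor nonzero, so that the
  induction can also descend.\<close>

lemma unit_term_qpoch:
  assumes B: "\<forall>m\<in>{1..n}. B m \<noteq> 0" and x: "x \<noteq> 0"
    and gA: "\<And>m. m \<in> {1..n} \<Longrightarrow> generic q (A m * x)" and gB: "\<And>m. m \<in> {1..n} \<Longrightarrow> generic q (B m * x)"
  shows "unit_term n A B k x = numer n A B x * (\<Prod>m\<in>{1..n}. qpoch (B m * x) q k / qpoch (A m * x) q k)"
proof -
  have nz: "1 - y * q powi k \<noteq> 0" if "generic q y" for y k using that by (auto simp: generic_def)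
  define Q where "Q = (\<lambda>k. \<Prod>m\<in>{1..n}. qpoch (B m * x) q k / qpoch (A m * x) q k)"
  define PA where "PA = (\<lambda>k. \<Prod>m\<in>{1..n}. 1 - A m * (x * q powi k))"
  define PB where "PB = (\<lambda>k. \<Prod>m\<in>{1..n}. 1 - B m * (x * q powi k))"
  have PAnz: "PA k \<noteq> 0" for k using nz[OF gA] by (auto simp: PA_def mult.assoc)
  have PBnz: "PB k \<noteq> 0" for k using nz[OF gB] by (auto simp: PB_def mult.assoc)
  have Q0: "Q 0 = 1"
    unfolding Q_def by (intro prod.neutral) (simp add: qpoch_0 gA gB)
  have Qrec: "Q (k + 1) = Q k * (PB k / PA k)" for k
  proof -
    have "Q (k + 1) = (\<Prod>m\<in>{1..n}. qpoch (B m * x) q k / qpoch (A m * x) q k *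
        ((1 - B m * (x * q powi k)) / (1 - A m * (x * q powi k))))"
      unfolding Q_def by (intro prod.cong refl) (simp add: qpoch_Suc gA gB mult.assoc)
    then show ?thesis by (simp add: Q_def PA_def PB_def prod.distrib prod_dividef)
  qed
  have Urec: "unit_term n A B (k + 1) x = unit_term n A B k x * (PB k / PA k)" for k
  proof -
    have "unit_term n A B (k + 1) x * PA k = PB k * unit_term n A B k x"
      unfolding PA_def PB_def by (rule unit_term_Suc[OF B x])
    then show ?thesis using PAnz[of k] by (simp add: field_simps)
  qed
  have "unit_term n A B k x = numer n A B x * Q k"
  proof (induction k rule: int_induct[where k = 0])
    case base
    then show ?case by (simp add: Q0)
  next
    case (step1 i)
    then show ?case by (simp add: Urec Qrec)
  next
    case (step2 i)
    define r where "r = PB (i - 1) / PA (i - 1)"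
    have "unit_term n A B i x = unit_term n A B (i - 1) x * r" "Q i = Q (i - 1) * r"
      using Urec[of "i - 1"] Qrec[of "i - 1"] by (simp_all add: r_def)
    moreover have "r \<noteq> 0" using PAnz PBnz by (simp add: r_def)
    ultimately show ?case using step2.IH by (simp add: mult.assoc[symmetric])
  qed
  then show ?thesis by (simp add: Q_def)
qed

end

section \<open>Antisymmetric multiple series\<close>

lemma summable_on_norm_prod_PiE:
  fixes f :: "'a \<Rightarrow> int \<Rightarrow> complex"
  assumes I: "finite I" and f: "\<And>i. i \<in> I \<Longrightarrow> (\<lambda>k. norm (f i k)) summable_on UNIV"
  shows "(\<lambda>k. norm (\<Prod>i\<in>I. f i (k i))) summable_on (PiE I (\<lambda>_. UNIV))"
proof -
  have "Infinite_Set_Sum.abs_summable_on (\<lambda>k. \<Prod>i\<in>I. f i (k i)) (PiE I (\<lambda>_. UNIV))"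
    using I by (intro abs_summable_on_prod_PiE) (auto simp: f simp flip: abs_summable_equivalent)
  then show ?thesis by (simp add: abs_summable_equivalent)
qed

text \<open>Polynomial functions of degree at most \<open>d i\<close> in the variable
  \<open>i\<close>. The inductive form reduces every statement that is linear in the polynomial to
  monomials, for which the multiple series factors into series in one variable.\<close>

inductive mpoly_le :: "nat set \<Rightarrow> (nat \<Rightarrow> nat) \<Rightarrow> ((nat \<Rightarrow> complex) \<Rightarrow> complex) \<Rightarrow> bool" for I d where
  monom: "(\<And>i. i \<in> I \<Longrightarrow> e i \<le> d i) \<Longrightarrow> mpoly_le I d (\<lambda>y. \<Prod>i\<in>I. y i ^ e i)"
| add: "mpoly_le I d f \<Longrightarrow> mpoly_le I d g \<Longrightarrow> mpoly_le I d (\<lambda>y. f y + g y)"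
| scale: "mpoly_le I d f \<Longrightarrow> mpoly_le I d (\<lambda>y. c * f y)"

lemma mpoly_le_mono:
  assumes "mpoly_le I d f" "\<And>i. i \<in> I \<Longrightarrow> d i \<le> d' i"
  shows "mpoly_le I d' f"
  using assms
proof (induction rule: mpoly_le.induct)
  case (monom e)
  then show ?case by (intro mpoly_le.monom) (use order_trans in blast)
qed (auto intro: mpoly_le.intros)

lemma mpoly_le_const: "mpoly_le I d (\<lambda>_. c)"
proof -
  have "mpoly_le I d (\<lambda>y. c * (\<Prod>i\<in>I. y i ^ 0))"
    by (intro mpoly_le.scale mpoly_le.monom) auto
  then show ?thesis by simp
qed

lemma mpoly_le_mult:
  assumes f: "mpoly_le I d f" and g: "mpoly_le I d' g"
  shows "mpoly_le I (\<lambda>i. d i + d' i) (\<lambda>y. f y * g y)"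
  using f
proof (induction rule: mpoly_le.induct)
  case (monom e)
  from g show ?case
  proof (induction rule: mpoly_le.induct)
    case (monom e')
    have "mpoly_le I (\<lambda>i. d i + d' i) (\<lambda>y. \<Prod>i\<in>I. y i ^ (e i + e' i))"
      using monom.hyps \<open>\<And>i. i \<in> I \<Longrightarrow> e i \<le> d i\<close> by (intro mpoly_le.monom add_mono)
    then show ?case by (simp add: power_add prod.distrib)
  next
    case (add g1 g2)
    then show ?case by (simp add: distrib_left mpoly_le.add)
  next
    case (scale g c)
    then show ?case using mpoly_le.scale[OF scale.IH, of c] by (simp add: mult_ac)
  qed
next
  case (add f1 f2)
  then show ?case by (simp add: distrib_right mpoly_le.add)
next
  case (scale f c)
  then show ?case using mpoly_le.scale[OF scale.IH, of c] by (simp add: mult_ac)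
qed

lemma mpoly_le_prod:
  assumes "finite P" "\<And>p. p \<in> P \<Longrightarrow> mpoly_le I (d p) (f p)"
  shows "mpoly_le I (\<lambda>i. \<Sum>p\<in>P. d p i) (\<lambda>y. \<Prod>p\<in>P. f p y)"
  using assms
proof (induction rule: finite_induct)
  case empty
  then show ?case using mpoly_le_const by simp
next
  case (insert p P)
  then have "mpoly_le I (\<lambda>i. d p i + (\<Sum>p\<in>P. d p i)) (\<lambda>y. f p y * (\<Prod>p\<in>P. f p y))"
    by (intro mpoly_le_mult) auto
  then show ?case using insert.hyps by simp
qed

lemma mpoly_le_sum:
  assumes "finite P" "\<And>p. p \<in> P \<Longrightarrow> mpoly_le I d (f p)"
  shows "mpoly_le I d (\<lambda>y. \<Sum>p\<in>P. f p y)"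
  using assms
proof (induction rule: finite_induct)
  case empty
  then show ?case using mpoly_le_const by simp
next
  case (insert p P)
  then have "mpoly_le I d (\<lambda>y. f p y + (\<Sum>p\<in>P. f p y))"
    by (intro mpoly_le.add) auto
  then show ?case using insert.hyps by simp
qed

lemma mpoly_le_var_power:
  assumes I: "finite I" "i \<in> I" and e: "e \<le> d i"
  shows "mpoly_le I d (\<lambda>y. y i ^ e)"
proof -
  have "mpoly_le I d (\<lambda>y. \<Prod>l\<in>I. y l ^ (if l = i then e else 0))"
    by (rule mpoly_le.monom) (use e in auto)
  moreover have "(\<Prod>l\<in>I. y l ^ (if l = i then e else 0)) = y i ^ e" for y :: "nat \<Rightarrow> complex"
    using I by (subst prod.remove[of I i]) auto
  ultimately show ?thesis by simp
qed

lemma mpoly_le_diff: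
  assumes I: "finite I" "i \<in> I" "j \<in> I" and d: "d i \<ge> 1" "d j \<ge> 1"
  shows "mpoly_le I d (\<lambda>y. y i - y j)"
proof -
  have "mpoly_le I d (\<lambda>y. y i ^ 1 + (-1) * y j ^ 1)"
    by (intro mpoly_le.add mpoly_le.scale mpoly_le_var_power I d)
  then show ?thesis by simp
qed

lemma mpoly_le_poly:
  assumes I: "finite I" "i \<in> I" and d: "d i \<ge> degree p"
  shows "mpoly_le I d (\<lambda>y. poly p (y i))"
proof -
  have "mpoly_le I d (\<lambda>y. \<Sum>j\<le>degree p. coeff p j * y i ^ j)"
    by (intro mpoly_le_sum mpoly_le.scale mpoly_le_var_power I) (use d in auto)
  then show ?thesis by (simp add: poly_altdef)
qed

section \<open>Vandermonde products\<close>

definition vander :: "nat \<Rightarrow> (nat \<Rightarrow> 'a::comm_ring_1) \<Rightarrow> 'a" where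
  "vander n y = (\<Prod>i\<in>{1..n}. \<Prod>j\<in>{i<..n}. (y i - y j))"

lemma prod_pairs_Suc:
  fixes g :: "nat \<Rightarrow> nat \<Rightarrow> 'a::comm_monoid_mult"
  shows "(\<Prod>i\<in>{1..Suc n}. \<Prod>j\<in>{i<..Suc n}. g i j)
    = (\<Prod>i\<in>{1..n}. \<Prod>j\<in>{i<..n}. g i j) * (\<Prod>i\<in>{1..n}. g i (Suc n))"
proof -
  have "(\<Prod>j\<in>{i<..Suc n}. g i j) = (\<Prod>j\<in>{i<..n}. g i j) * g i (Suc n)" if "i \<in> {1..n}" for i
  proof -
    have "{i<..Suc n} = insert (Suc n) {i<..n}" using that by auto
    then show ?thesis by (simp add: mult.commute)
  qed
  then have "(\<Prod>i\<in>{1..n}. \<Prod>j\<in>{i<..Suc n}. g i j) = (\<Prod>i\<in>{1..n}. (\<Prod>j\<in>{i<..n}. g i j) * g i (Suc n))"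
    by (intro prod.cong) auto
  then show ?thesis by (simp add: prod.distrib)
qed

lemma vander_Suc: "vander (Suc n) y = vander n y * (\<Prod>i\<in>{1..n}. (y i - y (Suc n)))"
  unfolding vander_def by (rule prod_pairs_Suc)

text \<open>Each variable occurs in \<open>n - 1\<close> of the differences. The variable set
  \<open>{1..N}\<close> stays fixed so that the induction on \<open>n\<close> does not change the
  predicate.\<close>

lemma mpoly_le_vander:
  assumes "n \<le> N"
  shows "mpoly_le {1..N} (\<lambda>i. if i \<in> {1..n} then n - 1 else 0) (vander n)"
  using assms
proof (induction n)
  case 0
  have "mpoly_le {1..N} (\<lambda>i. if i \<in> {1..0} then 0 - 1 else 0) (\<lambda>_. 1)" by (rule mpoly_le_const)
  then show ?case by (simp add: vander_def[abs_def])
next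
  case (Suc n)
  have "mpoly_le {1..N} (\<lambda>i. \<Sum>p\<in>{1..n}. if i = p \<or> i = Suc n then 1 else 0) (\<lambda>y. \<Prod>i\<in>{1..n}. (y i - y (Suc n)))"
    using Suc.prems by (intro mpoly_le_prod mpoly_le_diff) auto
  then have "mpoly_le {1..N} (\<lambda>i. (if i \<in> {1..n} then n - 1 else 0) + (\<Sum>p\<in>{1..n}. if i = p \<or> i = Suc n then 1 else 0))
     (\<lambda>y. vander n y * (\<Prod>i\<in>{1..n}. (y i - y (Suc n))))"
    using Suc by (intro mpoly_le_mult) auto
  then have "mpoly_le {1..N} (\<lambda>i. if i \<in> {1..Suc n} then Suc n - 1 else 0)
     (\<lambda>y. vander n y * (\<Prod>i\<in>{1..n}. (y i - y (Suc n))))"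
  proof (rule mpoly_le_mono)
    fix i assume "i \<in> {1..N}"
    consider "i \<in> {1..n}" | "i = Suc n" | "i > Suc n" using \<open>i \<in> {1..N}\<close> by fastforce
    then show "(if i \<in> {1..n} then n - 1 else 0) + (\<Sum>p\<in>{1..n}. if i = p \<or> i = Suc n then 1 else 0)
      \<le> (if i \<in> {1..Suc n} then Suc n - 1 else 0)"
    proof cases
      case 1
      then have "(\<Sum>p\<in>{1..n}. if i = p \<or> i = Suc n then 1 else 0) = (\<Sum>p\<in>{1..n}. if i = p then 1 else (0::nat))"
        by (intro sum.cong) auto
      then show ?thesis using 1 by simp
    next
      case 3
      then have "(\<Sum>p\<in>{1..n}. if i = p \<or> i = Suc n then 1 else 0) = (0::nat)"
        by (intro sum.neutral) auto
      then show ?thesis using 3 by simp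
    qed auto
  qed
  then show ?case by (simp add: vander_Suc[abs_def])
qed

lemma vander_cong: "(\<And>i. i \<in> {1..n} \<Longrightarrow> y i = y' i) \<Longrightarrow> vander n y = vander n y'"
  unfolding vander_def by (intro prod.cong) auto

text \<open>Only the factor belonging to the last two indices changes sign; their factors with
  smaller indices are exchanged.\<close>

lemma vander_transpose_adjacent:
  fixes y :: "nat \<Rightarrow> 'a::comm_ring_1"
  shows "vander (Suc (Suc n)) (y \<circ> Transposition.transpose (Suc n) (Suc (Suc n))) = - vander (Suc (Suc n)) y"
proof -
  let ?z = "y \<circ> Transposition.transpose (Suc n) (Suc (Suc n))"
  have z: "?z i = y i" if "i \<in> {1..n}" for i using that by (simp add: Transposition.transpose_def)
  have "vander n ?z = vander n y" by (rule vander_cong) (rule z)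
  moreover have "(\<Prod>i\<in>{1..n}. (?z i - ?z (Suc n))) = (\<Prod>i\<in>{1..n}. (y i - y (Suc (Suc n))))"
    by (intro prod.cong) (auto simp: Transposition.transpose_def)
  moreover have "(\<Prod>i\<in>{1..n}. (?z i - ?z (Suc (Suc n)))) = (\<Prod>i\<in>{1..n}. (y i - y (Suc n)))"
    by (intro prod.cong) (auto simp: Transposition.transpose_def)
  ultimately show ?thesis by (simp add: vander_Suc algebra_simps)
qed

lemma vander_transpose:
  fixes y :: "nat \<Rightarrow> 'a::comm_ring_1"
  assumes "i \<in> {1..n}" "j \<in> {1..n}" "i \<noteq> j"
  shows "vander n (y \<circ> Transposition.transpose i j) = - vander n y"
proof -
  have *: "vander n (y \<circ> Transposition.transpose i j) = - vander n y"
    if "i < j" "i \<in> {1..n}" "j \<in> {1..n}" for i j n and y :: "nat \<Rightarrow> 'a"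
    using that
  proof (induction n arbitrary: i j y)
    case 0
    then show ?case by simp
  next
    case (Suc n)
    have inner: "vander (Suc n) (y \<circ> Transposition.transpose i j) = - vander (Suc n) y"
      if ij: "i < j" "i \<in> {1..n}" "j \<in> {1..n}" for i j and y :: "nat \<Rightarrow> 'a"
    proof -
      have "(\<Prod>l\<in>{1..n}. (y (Transposition.transpose i j l) - y (Suc n))) = (\<Prod>l\<in>{1..n}. (y l - y (Suc n)))"
        by (rule prod.reindex_bij_betw[where h = "Transposition.transpose i j" and g = "\<lambda>l. y l - y (Suc n)"])
           (use ij in \<open>auto intro!: bij_betwI[where g = "Transposition.transpose i j"] simp: Transposition.transpose_def split: if_splits\<close>)
      moreover have "Transposition.transpose i j (Suc n) = Suc n" using ij by (simp add: Transposition.transpose_def)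
      ultimately show ?thesis using Suc.IH[OF ij, of y] by (simp add: vander_Suc o_def)
    qed
    show ?case
    proof (cases "j \<le> n")
      case True
      then show ?thesis using Suc.prems by (intro inner) auto
    next
      case False
      then have j: "j = Suc n" using Suc.prems by simp
      show ?thesis
      proof (cases "i = n")
        case True
        then obtain n' where n': "n = Suc n'" using Suc.prems by (cases n) auto
        show ?thesis unfolding True j n' by (rule vander_transpose_adjacent)
      next
        case i: False
        then obtain n' where n': "n = Suc n'" using Suc.prems j by (cases n) auto
        have "i < n" "i \<in> {1..n}" "n \<in> {1..n}" using Suc.prems i j by auto
        note in_ = inner[OF this]
        \<comment> \<open>The transposition of \<open>i\<close> and \<open>Suc n\<close> is the
          adjacent one of \<open>n\<close> and \<open>Suc n\<close> conjugated by that of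
          \<open>i\<close> and \<open>n\<close>, which gives three changes of sign.\<close>
        have "y \<circ> Transposition.transpose i j
          = y \<circ> Transposition.transpose i n \<circ> Transposition.transpose n (Suc n) \<circ> Transposition.transpose i n"
          using \<open>i < n\<close> by (auto simp: fun_eq_iff Transposition.transpose_def j)
        then have "vander (Suc n) (y \<circ> Transposition.transpose i j)
          = vander (Suc n) (y \<circ> Transposition.transpose i n \<circ> Transposition.transpose n (Suc n) \<circ> Transposition.transpose i n)"
          by simp
        also have "\<dots> = - vander (Suc n) (y \<circ> Transposition.transpose i n \<circ> Transposition.transpose n (Suc n))"
          by (rule in_)
        also have "\<dots> = vander (Suc n) (y \<circ> Transposition.transpose i n)"
          unfolding n' by (subst vander_transpose_adjacent) simp
        also have "\<dots> = - vander (Suc n) y" by (rule in_)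
        finally show ?thesis .
      qed
    qed
  qed
  show ?thesis
  proof (cases "i < j")
    case True
    then show ?thesis using * assms by blast
  next
    case False
    then have "j < i" using assms by simp
    then have "vander n (y \<circ> Transposition.transpose j i) = - vander n y" using * assms by blast
    then show ?thesis by (simp add: transpose_commute)
  qed
qed

lemma power_int_sum: "t \<noteq> 0 \<Longrightarrow> t powi (\<Sum>i\<in>S. k i) = (\<Prod>i\<in>S. t powi k i)"
  for t :: "'a::field"
  by (induction S rule: infinite_finite_induct) (simp_all add: power_int_add)

text \<open>When a single coordinate \<open>i\<close> changes, a product over pairs changes only in
  the pairs through \<open>i\<close>; this collects their correction factors.\<close>

lemma prod_pairs_through:
  fixes g :: "nat \<Rightarrow> 'a::comm_monoid_mult"
  assumes i: "i \<in> {1..n}"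
  shows "(\<Prod>a\<in>{1..n}. \<Prod>b\<in>{a<..n}. if a = i then g b else if b = i then g a else 1) = (\<Prod>l\<in>{1..n} - {i}. g l)"
proof -
  have inner: "(\<Prod>b\<in>{a<..n}. if a = i then g b else if b = i then g a else 1)
      = (if a = i then (\<Prod>b\<in>{i<..n}. g b) else if a < i then g a else 1)" if "a \<in> {1..n}" for a
  proof (cases "a < i")
    case True
    then have "i \<in> {a<..n}" using i by simp
    then show ?thesis using True by (simp add: prod.delta)
  next
    case False
    then show ?thesis by (auto intro!: prod.neutral)
  qed
  have split: "{1..n} - {i} = {1..<i} \<union> {i<..n}" using i by auto
  have "(\<Prod>a\<in>{1..n}. \<Prod>b\<in>{a<..n}. if a = i then g b else if b = i then g a else 1)
      = (\<Prod>a\<in>{1..n}. if a = i then (\<Prod>b\<in>{i<..n}. g b) else if a < i then g a else 1)"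
    by (rule prod.cong[OF refl inner])
  also have "\<dots> = (\<Prod>b\<in>{i<..n}. g b) * (\<Prod>a\<in>{1..n} - {i}. if a = i then (\<Prod>b\<in>{i<..n}. g b) else if a < i then g a else 1)"
    using i by (subst prod.remove[of _ i]) auto
  also have "(\<Prod>a\<in>{1..n} - {i}. if a = i then (\<Prod>b\<in>{i<..n}. g b) else if a < i then g a else 1)
      = (\<Prod>a\<in>{1..<i}. g a) * (\<Prod>a\<in>{i<..n}. 1)"
    unfolding split by (subst prod.union_disjoint) (auto intro!: arg_cong2[of _ _ _ _ "(*)"] prod.cong)
  also have "(\<Prod>b\<in>{i<..n}. g b) * ((\<Prod>a\<in>{1..<i}. g a) * (\<Prod>a\<in>{i<..n}. 1)) = (\<Prod>l\<in>{1..n} - {i}. g l)"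
    unfolding split by (subst prod.union_disjoint) (auto simp: mult.commute)
  finally show ?thesis .
qed

section \<open>The theta analogue of the Vandermonde product\<close>

context nome begin

text \<open>The elliptic analogue of \<open>a - b\<close>, which is its limit as \<open>q\<close>
  tends to 0. The prefactor \<open>a\<close> makes it antisymmetric.\<close>

definition pair_theta :: "complex \<Rightarrow> complex \<Rightarrow> complex" where
  "pair_theta a b = a * \<theta> (b / a)"

definition weyl_theta :: "nat \<Rightarrow> (nat \<Rightarrow> complex) \<Rightarrow> complex" where
  "weyl_theta n x = (\<Prod>i\<in>{1..n}. \<Prod>j\<in>{i<..n}. pair_theta (x i) (x j))"

end

text \<open>The last two assumptions place \<open>t\<close> in the annulus in which the series of
  every monomial of degree at most \<open>J\<close> in each variable converges.\<close>

locale bilateral = nome q for q :: complex +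
  fixes n J :: nat and A B :: "nat \<Rightarrow> complex" and t :: complex
  assumes B_nz: "\<forall>m\<in>{1..n}. B m \<noteq> 0" and t_nz: "t \<noteq> 0" and t_lt1: "norm t < 1"
    and AB: "norm (\<Prod>m\<in>{1..n}. A m) < norm (t * q ^ J * (\<Prod>m\<in>{1..n}. B m))"
begin

definition mterm :: "((nat \<Rightarrow> complex) \<Rightarrow> complex) \<Rightarrow> (nat \<Rightarrow> complex) \<Rightarrow> (nat \<Rightarrow> int) \<Rightarrow> complex" where
  "mterm f x k = t powi (\<Sum>i\<in>{1..n}. k i) * f (\<lambda>i. x i * q powi k i) * (\<Prod>i\<in>{1..n}. unit_term n A B (k i) (x i))"

definition msum :: "((nat \<Rightarrow> complex) \<Rightarrow> complex) \<Rightarrow> (nat \<Rightarrow> complex) \<Rightarrow> complex" where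
  "msum f x = (\<Sum>\<^sub>\<infinity>k\<in>PiE {1..n} (\<lambda>_. UNIV). mterm f x k)"

abbreviation nonzero :: "(nat \<Rightarrow> complex) \<Rightarrow> bool" where
  "nonzero x \<equiv> \<forall>i\<in>{1..n}. x i \<noteq> 0"

lemma mterm_monom:
  "mterm (\<lambda>y. \<Prod>i\<in>{1..n}. y i ^ e i) x k = (\<Prod>i\<in>{1..n}. series_term n A B t (e i) (k i) (x i))"
  unfolding mterm_def series_term_def power_int_sum[OF t_nz] by (simp add: prod.distrib)

lemma mterm_summable:
  assumes "mpoly_le {1..n} (\<lambda>_. J) f" "nonzero x"
  shows "(\<lambda>k. norm (mterm f x k)) summable_on (PiE {1..n} (\<lambda>_. UNIV))"
  using assms(1)
proof (induction rule: mpoly_le.induct)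
  case (monom e)
  then show ?case unfolding mterm_monom
    using assms(2) by (intro summable_on_norm_prod_PiE series_term_summable[OF B_nz t_nz t_lt1 AB]) auto
next
  case (add f g)
  have "(\<lambda>k. norm (mterm f x k) + norm (mterm g x k)) summable_on (PiE {1..n} (\<lambda>_. UNIV))"
    by (intro summable_on_add add.IH)
  then show ?case
  proof (rule Infinite_Sum.abs_summable_on_comparison_test')
    fix k show "norm (mterm (\<lambda>y. f y + g y) x k) \<le> norm (mterm f x k) + norm (mterm g x k)"
      unfolding mterm_def by (simp only: distrib_left distrib_right norm_triangle_ineq)
  qed
next
  case (scale f c)
  have "(\<lambda>k. norm c * norm (mterm f x k)) summable_on (PiE {1..n} (\<lambda>_. UNIV))"
    by (intro summable_on_cmult_right scale.IH)
  moreover have "norm (mterm (\<lambda>y. c * f y) x k) = norm c * norm (mterm f x k)" for k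
    by (simp add: mterm_def norm_mult)
  ultimately show ?case by simp
qed

lemma msum_add:
  assumes "mpoly_le {1..n} (\<lambda>_. J) f" "mpoly_le {1..n} (\<lambda>_. J) g" "nonzero x"
  shows "msum (\<lambda>y. f y + g y) x = msum f x + msum g x"
proof -
  have eq: "mterm (\<lambda>y. f y + g y) x = (\<lambda>k. mterm f x k + mterm g x k)"
    by (simp add: fun_eq_iff mterm_def distrib_left distrib_right)
  show ?thesis unfolding msum_def eq
    by (rule infsum_add[OF abs_summable_summable[OF mterm_summable[OF assms(1,3)]]
          abs_summable_summable[OF mterm_summable[OF assms(2,3)]]])
qed

lemma msum_scale: "msum (\<lambda>y. c * f y) x = c * msum f x"
proof -
  have eq: "mterm (\<lambda>y. c * f y) x = (\<lambda>k. c * mterm f x k)"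
    by (simp add: fun_eq_iff mterm_def)
  show ?thesis unfolding msum_def eq by (rule infsum_cmult_right')
qed

text \<open>For a monomial weight the summand is a product over the coordinates, so the multiple
  series factors. Holomorphy and quasi-periodicity are linear in \<open>f\<close> and reduce to this
  case.\<close>

lemma msum_monom:
  assumes "\<And>i. i \<in> {1..n} \<Longrightarrow> e i \<le> J" "nonzero x"
  shows "msum (\<lambda>y. \<Prod>i\<in>{1..n}. y i ^ e i) x = (\<Prod>i\<in>{1..n}. bi_series n A B t (e i) (x i))"
  unfolding msum_def mterm_monom bi_series_def
  by (rule infsum_prod_PiE_abs) (use assms in \<open>auto intro!: series_term_summable[OF B_nz t_nz t_lt1 AB]\<close>)

lemma msum_holomorphic:
  assumes "mpoly_le {1..n} (\<lambda>_. J) f" "nonzero x" and i: "i \<in> {1..n}"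
  shows "(\<lambda>s. msum f (x(i := s))) holomorphic_on - {0}"
  using assms(1)
proof (induction rule: mpoly_le.induct)
  case (monom e)
  have "(\<lambda>s. (\<Prod>l\<in>{1..n}. bi_series n A B t (e l) ((x(i := s)) l))) holomorphic_on - {0}"
  proof (intro holomorphic_on_prod)
    fix l assume l: "l \<in> {1..n}"
    show "(\<lambda>s. bi_series n A B t (e l) ((x(i := s)) l)) holomorphic_on - {0}"
    proof (cases "l = i")
      case True
      then show ?thesis using bi_series_holomorphic[OF B_nz t_nz t_lt1 AB monom[OF l]] by simp
    qed simp
  qed
  then show ?case
  proof (rule holomorphic_transform)
    fix s :: complex assume "s \<in> - {0}"
    then show "(\<Prod>l\<in>{1..n}. bi_series n A B t (e l) ((x(i := s)) l)) = msum (\<lambda>y. \<Prod>i\<in>{1..n}. y i ^ e i) (x(i := s))"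
      by (intro msum_monom[symmetric] monom) (use assms(2) in auto)
  qed
next
  case (add f g)
  then have "(\<lambda>s. msum f (x(i := s)) + msum g (x(i := s))) holomorphic_on - {0}"
    by (intro holomorphic_intros)
  then show ?case
    by (rule holomorphic_transform) (rule msum_add[OF add.hyps, symmetric], use assms(2) in simp)
next
  case (scale f c)
  then show ?case unfolding msum_scale by (intro holomorphic_intros)
qed

text \<open>All monomials share one multiplier, which therefore passes to every polynomial of
  admissible degree.\<close>

lemma msum_shift:
  assumes "mpoly_le {1..n} (\<lambda>_. J) f" "nonzero x" and i: "i \<in> {1..n}"
  shows "msum f (x(i := q * x i)) = kap n B / t * x i powi (- int n) * msum f x"
  using assms(1)
proof (induction rule: mpoly_le.induct)
  case (monom e)
  have "(\<Prod>l\<in>{1..n}. bi_series n A B t (e l) ((x(i := q * x i)) l))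
      = bi_series n A B t (e i) (q * x i) * (\<Prod>l\<in>{1..n} - {i}. bi_series n A B t (e l) (x l))"
    using i by (subst prod.remove[of _ i]) (auto intro!: arg_cong2[of _ _ _ _ "(*)"] prod.cong)
  also have "bi_series n A B t (e i) (q * x i)
      = kap n B / t * x i powi (- int n) * bi_series n A B t (e i) (x i)"
    using assms(2) i by (intro bi_series_shift[OF B_nz _ t_nz]) auto
  finally have "(\<Prod>l\<in>{1..n}. bi_series n A B t (e l) ((x(i := q * x i)) l))
      = kap n B / t * x i powi (- int n) * (\<Prod>l\<in>{1..n}. bi_series n A B t (e l) (x l))"
    using i by (subst (2) prod.remove[of _ i]) auto
  moreover have "nonzero (x(i := q * x i))" using assms(2) by simp
  ultimately show ?case
    by (simp only: msum_monom[where e = e, OF monom assms(2)] msum_monom[where e = e, OF monom])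
next
  case (add f g)
  then show ?case using assms(2) by (simp add: msum_add distrib_left)
next
  case (scale f c)
  then show ?case by (simp add: msum_scale)
qed

text \<open>Permuting the summation indices by the transposition preserves the sum, but reverses the
  sign of every term because the transposition fixes \<open>x\<close>.\<close>

lemma msum_antisymmetric:
  assumes f: "\<And>y. f (y \<circ> Transposition.transpose i j) = - f y"
    and ij: "i \<in> {1..n}" "j \<in> {1..n}" and x: "x i = x j"
  shows "msum f x = 0"
proof -
  let ?\<tau> = "Transposition.transpose i j"
  have perm: "bij_betw ?\<tau> {1..n} {1..n}"
    using ij by (auto intro!: bij_betwI[where g = ?\<tau>] simp: Transposition.transpose_def split: if_splits)
  have x\<tau>: "x (?\<tau> l) = x l" for l using x by (simp add: Transposition.transpose_def)
  have "mterm f x (k \<circ> ?\<tau>) = - mterm f x k" for k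
  proof -
    have "(\<Sum>l\<in>{1..n}. (k \<circ> ?\<tau>) l) = (\<Sum>l\<in>{1..n}. k l)"
      using sum.reindex_bij_betw[OF perm, of k] by simp
    moreover have "(\<lambda>l. x l * q powi (k \<circ> ?\<tau>) l) = (\<lambda>l. x l * q powi k l) \<circ> ?\<tau>"
      by (simp add: fun_eq_iff x\<tau>)
    moreover have "(\<Prod>l\<in>{1..n}. unit_term n A B ((k \<circ> ?\<tau>) l) (x l)) = (\<Prod>l\<in>{1..n}. unit_term n A B (k l) (x l))"
      using prod.reindex_bij_betw[OF perm, of "\<lambda>l. unit_term n A B (k l) (x l)"] by (simp add: x\<tau>)
    ultimately show ?thesis by (simp only: mterm_def f) simp
  qed
  then have "(\<Sum>\<^sub>\<infinity>k\<in>PiE {1..n} (\<lambda>_. UNIV). mterm f x (k \<circ> ?\<tau>)) = - msum f x"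
    unfolding msum_def by (simp add: infsum_uminus)
  moreover have "(\<Sum>\<^sub>\<infinity>k\<in>PiE {1..n} (\<lambda>_. UNIV). mterm f x (k \<circ> ?\<tau>)) = msum f x"
    unfolding msum_def
  proof (rule infsum_reindex_bij_betw[of "\<lambda>k. k \<circ> ?\<tau>"])
    show "bij_betw (\<lambda>k. k \<circ> ?\<tau>) (PiE {1..n} (\<lambda>_. UNIV)) (PiE {1..n} (\<lambda>_. UNIV :: int set))"
      using ij by (intro bij_betwI[where g = "\<lambda>k. k \<circ> ?\<tau>"])
        (auto simp: PiE_def extensional_def Transposition.transpose_def fun_eq_iff split: if_splits)
  qed
  ultimately show ?thesis by simp
qed

text \<open>The last factor has degree one in each variable and contains all dependence on
  \<open>t\<close>. It completes the degree \<open>n - 1\<close> of \<open>weyl_theta\<close> to the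
  multiplier of \<open>msum\<close>.\<close>

definition full_theta :: "(nat \<Rightarrow> complex) \<Rightarrow> complex" where
  "full_theta x = weyl_theta n x * \<theta> (t * (\<Prod>m\<in>{1..n}. B m) * (\<Prod>i\<in>{1..n}. x i))"

section \<open>Quasi-periodicity and zeros of the theta product\<close>

lemma pair_theta_shift_left:
  assumes "a \<noteq> 0" "b \<noteq> 0"
  shows "pair_theta (q * a) b = - (b / a) * pair_theta a b"
proof -
  have "\<theta> (q * (b / (q * a))) = - \<theta> (b / (q * a)) / (b / (q * a))"
    using assms by (intro theta_shift) auto
  then show ?thesis using assms by (simp add: pair_theta_def field_simps)
qed

lemma pair_theta_shift_right:
  assumes "a \<noteq> 0" "b \<noteq> 0"
  shows "pair_theta a (q * b) = - (a / b) * pair_theta a b"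
proof -
  have "\<theta> (q * (b / a)) = - \<theta> (b / a) / (b / a)"
    using assms by (intro theta_shift) auto
  then show ?thesis using assms by (simp add: pair_theta_def field_simps)
qed

lemma weyl_theta_shift:
  assumes x: "nonzero x" and i: "i \<in> {1..n}"
  shows "weyl_theta n (x(i := q * x i)) = (\<Prod>l\<in>{1..n} - {i}. - (x l / x i)) * weyl_theta n x"
proof -
  let ?g = "\<lambda>l. - (x l / x i)"
  have "pair_theta ((x(i := q * x i)) a) ((x(i := q * x i)) b)
      = (if a = i then ?g b else if b = i then ?g a else 1) * pair_theta (x a) (x b)"
    if "a \<in> {1..n}" "b \<in> {a<..n}" for a b
    using that x i by (auto simp: pair_theta_shift_left pair_theta_shift_right)
  then have "weyl_theta n (x(i := q * x i))
      = (\<Prod>a\<in>{1..n}. \<Prod>b\<in>{a<..n}. (if a = i then ?g b else if b = i then ?g a else 1) * pair_theta (x a) (x b))"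
    unfolding weyl_theta_def by (intro prod.cong refl) auto
  also have "\<dots> = (\<Prod>a\<in>{1..n}. \<Prod>b\<in>{a<..n}. if a = i then ?g b else if b = i then ?g a else 1) * weyl_theta n x"
    by (simp add: prod.distrib weyl_theta_def)
  also have "(\<Prod>a\<in>{1..n}. \<Prod>b\<in>{a<..n}. if a = i then ?g b else if b = i then ?g a else 1) = (\<Prod>l\<in>{1..n} - {i}. ?g l)"
    by (rule prod_pairs_through[OF i])
  finally show ?thesis .
qed

text \<open>The pairs through \<open>i\<close> contribute \<open>(- 1 / x i) ^ (n - 1)\<close> and
  the product of the other coordinates; the last theta factor contributes \<open>- 1 / Y\<close>.
  The coordinates in \<open>Y\<close> cancel the others, so the multiplier depends on
  \<open>x i\<close> alone.\<close>

lemma full_theta_shift: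
  assumes x: "nonzero x" and i: "i \<in> {1..n}"
  shows "full_theta (x(i := q * x i)) = kap n B / t * x i powi (- int n) * full_theta x"
proof -
  define Y where "Y = t * (\<Prod>m\<in>{1..n}. B m) * (\<Prod>l\<in>{1..n}. x l)"
  have Y0: "Y \<noteq> 0" using B_nz x t_nz by (simp add: Y_def)
  have xi: "x i \<noteq> 0" using x i by simp
  have P: "(\<Prod>l\<in>{1..n}. (x(i := q * x i)) l) = q * (\<Prod>l\<in>{1..n}. x l)"
  proof -
    have "(\<Prod>l\<in>{1..n}. (x(i := q * x i)) l) = q * x i * (\<Prod>l\<in>{1..n} - {i}. x l)"
      by (subst prod.remove[of _ i]) (use i in \<open>auto intro!: prod.cong\<close>)
    then show ?thesis using prod.remove[of "{1..n}" i x] i by (simp add: mult.assoc)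
  qed
  have "t * (\<Prod>m\<in>{1..n}. B m) * (\<Prod>l\<in>{1..n}. (x(i := q * x i)) l) = q * Y"
    unfolding P Y_def by (simp add: mult_ac)
  then have "full_theta (x(i := q * x i)) = (\<Prod>l\<in>{1..n} - {i}. - (x l / x i)) * weyl_theta n x * (- \<theta> Y / Y)"
    unfolding full_theta_def weyl_theta_shift[OF assms] by (simp add: theta_shift[OF Y0])
  also have "(\<Prod>l\<in>{1..n} - {i}. - (x l / x i)) = (\<Prod>l\<in>{1..n} - {i}. - 1 / x i) * (\<Prod>l\<in>{1..n} - {i}. x l)"
    by (subst prod.distrib[symmetric]) simp
  also have "(\<Prod>l\<in>{1..n} - {i}. - 1 / x i) = (- 1 / x i) ^ (n - 1)"
    using i by simp
  also have "(\<Prod>l\<in>{1..n} - {i}. x l) = (\<Prod>l\<in>{1..n}. x l) / x i"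
    using i xi prod.remove[of "{1..n}" i x] by simp
  also have "(- 1 / x i) ^ (n - 1) * ((\<Prod>l\<in>{1..n}. x l) / x i) * weyl_theta n x * (- \<theta> Y / Y)
     = ((- 1 / x i) ^ (n - 1) * (- 1 / x i)) * ((\<Prod>l\<in>{1..n}. x l) / Y) * (weyl_theta n x * \<theta> Y)"
    by simp
  also have "(- 1 / x i) ^ (n - 1) * (- 1 / x i) = (- 1) ^ n * x i powi (- int n)"
  proof -
    have "(- 1 / x i) ^ (n - 1) * (- 1 / x i) = (- 1 / x i) ^ n"
      using i by (cases n) auto
    also have "\<dots> = (- 1) ^ n / x i ^ n" by (rule power_divide)
    finally show ?thesis by (simp only: power_int_minus power_int_of_nat divide_inverse)
  qed
  also have "(\<Prod>l\<in>{1..n}. x l) / Y = 1 / (t * (\<Prod>m\<in>{1..n}. B m))"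
    using x by (simp add: Y_def)
  also have "(- 1) ^ n * x i powi (- int n) * (1 / (t * (\<Prod>m\<in>{1..n}. B m))) * (weyl_theta n x * \<theta> Y)
     = kap n B / t * x i powi (- int n) * full_theta x"
  proof -
    have "kap n B = (- 1) ^ n / (\<Prod>m\<in>{1..n}. B m)"
      unfolding kap_def prod_dividef by simp
    then show ?thesis by (simp add: full_theta_def Y_def mult_ac)
  qed
  finally show ?thesis .
qed

lemma full_theta_holomorphic:
  assumes x: "nonzero x" and i: "i \<in> {1..n}"
  shows "(\<lambda>s. full_theta (x(i := s))) holomorphic_on - {0}"
proof -
  have coord: "(\<lambda>s. (x(i := s)) l) holomorphic_on - {0}" for l
    by (cases "l = i") auto
  have nz: "(x(i := s)) l \<noteq> 0" if "l \<in> {1..n}" "s \<in> - {0}" for s l using x that by auto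
  have "(\<lambda>s. pair_theta ((x(i := s)) a) ((x(i := s)) b)) holomorphic_on - {0}"
    if "a \<in> {1..n}" "b \<in> {a<..n}" for a b
    unfolding pair_theta_def using nz[of a] nz[of b] that
    by (intro holomorphic_on_mult theta_holomorphic holomorphic_on_divide coord) auto
  moreover have "(\<lambda>s. \<theta> (t * (\<Prod>m\<in>{1..n}. B m) * (\<Prod>l\<in>{1..n}. (x(i := s)) l))) holomorphic_on - {0}"
    by (intro theta_holomorphic holomorphic_on_mult holomorphic_on_prod coord holomorphic_on_const)
       (use B_nz nz t_nz in auto)
  ultimately show ?thesis
    unfolding full_theta_def weyl_theta_def
    by (intro holomorphic_on_mult holomorphic_on_prod) auto
qed

lemma pair_theta_eq_0_iff:
  "a \<noteq> 0 \<Longrightarrow> b \<noteq> 0 \<Longrightarrow> pair_theta a b = 0 \<longleftrightarrow> (\<exists>m. b = a * q powi m)"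
  using theta_eq_0_iff[of "b / a"] by (simp add: pair_theta_def field_simps)

lemma weyl_theta_eq_0_iff:
  assumes x: "nonzero x"
  shows "weyl_theta n x = 0 \<longleftrightarrow> (\<exists>i\<in>{1..n}. \<exists>j\<in>{1..n}. i \<noteq> j \<and> (\<exists>m. x i = x j * q powi m))"
proof
  assume "weyl_theta n x = 0"
  then obtain i j where ij: "i \<in> {1..n}" "j \<in> {i<..n}" "pair_theta (x i) (x j) = 0"
    by (auto simp: weyl_theta_def)
  then have "\<exists>m. x j = x i * q powi m" using x pair_theta_eq_0_iff[of "x i" "x j"] by auto
  then show "\<exists>i\<in>{1..n}. \<exists>j\<in>{1..n}. i \<noteq> j \<and> (\<exists>m. x i = x j * q powi m)"
    using ij by (intro bexI[of _ j] bexI[of _ i]) auto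
next
  assume "\<exists>i\<in>{1..n}. \<exists>j\<in>{1..n}. i \<noteq> j \<and> (\<exists>m. x i = x j * q powi m)"
  then obtain i j m where ij: "i \<in> {1..n}" "j \<in> {1..n}" "i \<noteq> j" and m: "x i = x j * q powi m"
    by blast
  have m': "x j = x i * q powi (- m)" using m by (simp add: power_int_minus)
  consider "i < j" | "j < i" using ij by linarith
  then obtain a b where ab: "a \<in> {1..n}" "b \<in> {a<..n}" "pair_theta (x a) (x b) = 0"
  proof cases
    case 1
    then show ?thesis using that[of i j] ij m' x pair_theta_eq_0_iff[of "x i" "x j"] by auto
  next
    case 2
    then show ?thesis using that[of j i] ij m x pair_theta_eq_0_iff[of "x j" "x i"] by auto
  qed
  then show "weyl_theta n x = 0"
    unfolding weyl_theta_def by (intro prod_zero bexI[of _ a] bexI[of _ b]) auto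
qed

end

section \<open>Proportionality of the series and the theta product\<close>

lemma fsigma_punctured_plane: "fsigma (- {0 :: complex})"
proof -
  define G where "G = (\<lambda>n::nat. {z :: complex. inverse (real (Suc n)) \<le> norm z})"
  have "closed (G n)" for n
    unfolding G_def by (intro closed_Collect_le continuous_intros)
  then have "fsigma (\<Union>(range G))" by (rule fsigma.intros)
  moreover have "\<exists>n. inverse (real (Suc n)) < norm z" if "z \<noteq> 0" for z :: complex
    using reals_Archimedean[of "norm z"] that by auto
  then have "\<Union>(range G) = - {0}"
    unfolding G_def by (force intro: less_imp_le)
  ultimately show ?thesis by simp
qed

lemma infsum_finite_sum:
  fixes f :: "'b \<Rightarrow> 'a \<Rightarrow> complex"
  assumes "\<And>l. l \<in> F \<Longrightarrow> f l summable_on S"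
  shows "(\<Sum>\<^sub>\<infinity>k\<in>S. \<Sum>l\<in>F. f l k) = (\<Sum>l\<in>F. \<Sum>\<^sub>\<infinity>k\<in>S. f l k)"
proof -
  have "(\<lambda>k. \<Sum>l\<in>F. f l k) summable_on S \<and>
    (\<Sum>\<^sub>\<infinity>k\<in>S. \<Sum>l\<in>F. f l k) = (\<Sum>l\<in>F. \<Sum>\<^sub>\<infinity>k\<in>S. f l k)"
    using assms
    by (induction F rule: infinite_finite_induct) (auto simp: infsum_add intro!: summable_on_add)
  then show ?thesis ..
qed

context bilateral begin

text \<open>The difference \<open>g\<close> of the two sides vanishes at all \<open>n\<close>
  coordinates of \<open>x\<close>: at \<open>s = x i\<close> by construction, at the others because
  two coordinates then coincide. Its multiplier has degree \<open>n\<close>, and nonvanishing of the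
  last theta factor at \<open>x\<close> rules out the exceptional constant of
  \<open>theta_space_zero\<close>.\<close>

lemma msum_update_ratio:
  assumes f: "mpoly_le {1..n} (\<lambda>_. J) f"
    and anti: "\<And>y i j. i \<in> {1..n} \<Longrightarrow> j \<in> {1..n} \<Longrightarrow> i \<noteq> j \<Longrightarrow> f (y \<circ> Transposition.transpose i j) = - f y"
    and x: "nonzero x" and i: "i \<in> {1..n}" and s: "s \<noteq> 0" and nz: "full_theta x \<noteq> 0"
  shows "msum f (x(i := s)) * full_theta x = msum f x * full_theta (x(i := s))"
proof -
  define g where "g = (\<lambda>s. msum f (x(i := s)) * full_theta x - msum f x * full_theta (x(i := s)))"
  define P where "P = x ` {1..n}"
  have weyl: "weyl_theta n x \<noteq> 0"
    and th: "\<theta> (t * (\<Prod>m\<in>{1..n}. B m) * (\<Prod>i\<in>{1..n}. x i)) \<noteq> 0"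
    using nz by (auto simp: full_theta_def)
  have dist: "l = l'" if "l \<in> {1..n}" "l' \<in> {1..n}" "x l = x l' * q powi m" for l l' m
    using weyl that weyl_theta_eq_0_iff[OF x] by blast
  have inj: "inj_on x {1..n}"
    using dist[where m = 0] by (auto simp: inj_on_def)
  have card: "card P = n" using card_image[OF inj] by (simp add: P_def)
  have prodP: "\<Prod>P = (\<Prod>l\<in>{1..n}. x l)" unfolding P_def by (subst prod.reindex[OF inj]) simp
  have "g s = 0"
  proof (rule theta_space_zero[where f = g and P = P and K = "kap n B / t"])
    show "finite P" "0 \<notin> P" using x by (auto simp: P_def)
    show "g holomorphic_on - {0}"
      unfolding g_def by (intro holomorphic_intros msum_holomorphic[OF f x i] full_theta_holomorphic[OF x i])
    show "s \<noteq> 0" by (rule s)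
    show "g (q * s) = kap n B / t * s powi (- int (card P)) * g s" if s: "s \<noteq> 0" for s
    proof -
      have nz': "nonzero (x(i := s))" using x s by simp
      have "msum f (x(i := q * s)) = kap n B / t * s powi (- int n) * msum f (x(i := s))"
        using msum_shift[OF f nz' i] by (simp only: fun_upd_upd fun_upd_same)
      moreover have "full_theta (x(i := q * s)) = kap n B / t * s powi (- int n) * full_theta (x(i := s))"
        using full_theta_shift[OF nz' i] by (simp only: fun_upd_upd fun_upd_same)
      ultimately show ?thesis
        by (simp add: g_def card right_diff_distrib mult_ac)
    qed
    show "g p = 0" if pP: "p \<in> P" for p
    proof -
      obtain l where l: "l \<in> {1..n}" "p = x l" using pP unfolding P_def by blast
      show ?thesis
      proof (cases "l = i")
        case True
        then show ?thesis using l by (simp add: g_def)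
      next
        case False
        let ?x = "x(i := x l)"
        have eq: "?x i = ?x l" using False by simp
        have "msum f ?x = 0" by (rule msum_antisymmetric[where f = f and i = i and j = l, OF anti[OF i l(1)] i l(1) eq]) (use False in auto)
        moreover have "full_theta ?x = 0"
        proof -
          have nz: "nonzero ?x" using x l by simp
          have "\<exists>a\<in>{1..n}. \<exists>b\<in>{1..n}. a \<noteq> b \<and> (\<exists>m. ?x a = ?x b * q powi m)"
            by (rule bexI[OF _ i], rule bexI[OF _ l(1)], rule conjI, use False in simp, rule exI[of _ 0])
               (use False in simp)
          then have "weyl_theta n ?x = 0" by (simp only: weyl_theta_eq_0_iff[OF nz])
          then show ?thesis by (simp add: full_theta_def)
        qed
        ultimately show ?thesis using l by (simp add: g_def)
      qed
    qed
    show "p = p'" if "p \<in> P" "p' \<in> P" "p = p' * q powi m" for p p' m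
      using that dist unfolding P_def by blast
    \<comment> \<open>Equality would make \<open>t\<close> times the products of the
      \<open>B m\<close> and of the coordinates a power of \<open>q\<close>, hence a zero of the
      last factor of \<open>full_theta x\<close>.\<close>
    show "kap n B / t \<noteq> (- 1) ^ card P * \<Prod>P * q powi m" for m
    proof
      let ?b = "\<Prod>m\<in>{1..n}. B m" and ?X = "\<Prod>l\<in>{1..n}. x l"
      assume "kap n B / t = (- 1) ^ card P * \<Prod>P * q powi m"
      moreover have "kap n B = (- 1) ^ n / ?b"
        unfolding kap_def prod_dividef by simp
      moreover have b: "?b \<noteq> 0" "?X \<noteq> 0" using B_nz x by auto
      ultimately have "(- 1) ^ n * (1 / (?b * t)) = (- 1) ^ n * (?X * q powi m)"
        by (simp add: card prodP mult.assoc)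
      then have "1 / (?b * t) = ?X * q powi m"
        by (subst (asm) mult_left_cancel) auto
      then have "t * ?b * ?X * q powi m = 1" using b t_nz by (simp add: field_simps)
      then have "t * ?b * ?X = q powi (- m)" by (simp add: power_int_minus field_simps)
      then show False using th theta_eq_0_iff[of "t * ?b * ?X"] b t_nz by auto
    qed
  qed
  then show ?thesis by (simp add: g_def)
qed

text \<open>Countability allows one value of \<open>s\<close> to avoid the zeros belonging to two
  different points at once. If the function is constant, its value at \<open>s = x i\<close> is
  nonzero.\<close>

lemma countable_zeros_full_theta:
  assumes x: "nonzero x" and i: "i \<in> {1..n}" and nz: "full_theta x \<noteq> 0"
  shows "countable {s \<in> - {0}. full_theta (x(i := s)) = 0}"
proof (cases "(\<lambda>s. full_theta (x(i := s))) constant_on - {0}")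
  case True
  then obtain c where c: "\<And>s. s \<in> - {0} \<Longrightarrow> full_theta (x(i := s)) = c"
    by (auto simp: constant_on_def)
  have "c \<noteq> 0" using c[of "x i"] nz x i by auto
  then have "{s \<in> - {0}. full_theta (x(i := s)) = 0} = {}" using c by auto
  then show ?thesis by (simp only: countable_empty)
next
  case False
  then show ?thesis
    by (intro holomorphic_countable_zeros full_theta_holomorphic[OF x i])
       (auto intro: fsigma_punctured_plane connected_punctured_universe)
qed

text \<open>Coordinates are adjusted one at a time. Replacing \<open>x i\<close> by
  \<open>y i\<close> directly could meet a zero of the theta product, so both points are moved to a
  common new value at which neither theta product vanishes.\<close>

lemma msum_proportional:
  assumes f: "mpoly_le {1..n} (\<lambda>_. J) f"
    and anti: "\<And>y i j. i \<in> {1..n} \<Longrightarrow> j \<in> {1..n} \<Longrightarrow> i \<noteq> j \<Longrightarrow> f (y \<circ> Transposition.transpose i j) = - f y"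
    and x: "nonzero x" "full_theta x \<noteq> 0" and y: "nonzero y" "full_theta y \<noteq> 0"
    and out: "\<And>i. i \<notin> {1..n} \<Longrightarrow> x i = y i"
  shows "msum f x * full_theta y = msum f y * full_theta x"
proof -
  have "msum f x * full_theta y = msum f y * full_theta x"
    if "m \<le> n" "nonzero x" "full_theta x \<noteq> 0" "nonzero y" "full_theta y \<noteq> 0" "\<And>i. i \<notin> {1..m} \<Longrightarrow> x i = y i"
    for m x y
    using that
  proof (induction m arbitrary: x y)
    case 0
    then have "x = y" by auto
    then show ?case by simp
  next
    case (Suc m)
    have i: "Suc m \<in> {1..n}" using Suc.prems by simp
    let ?Z = "\<lambda>x. {s \<in> - {0}. full_theta (x(Suc m := s)) = 0}"
    have "countable (?Z x \<union> ?Z y \<union> {0})"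
      using countable_zeros_full_theta[OF _ i] Suc.prems by simp
    then have "?Z x \<union> ?Z y \<union> {0} \<noteq> UNIV"
      using uncountable_UNIV_complex by metis
    then obtain s where s: "s \<noteq> 0" "full_theta (x(Suc m := s)) \<noteq> 0" "full_theta (y(Suc m := s)) \<noteq> 0"
      by auto
    let ?x = "x(Suc m := s)" and ?y = "y(Suc m := s)"
    have "msum f ?x * full_theta ?y = msum f ?y * full_theta ?x"
    proof (rule Suc.IH)
      show "?x i = ?y i" if "i \<notin> {1..m}" for i using Suc.prems(6)[of i] that by auto
      show "nonzero ?x" "nonzero ?y" using s Suc.prems by simp_all
      show "full_theta ?x \<noteq> 0" "full_theta ?y \<noteq> 0" by (fact s)+
    qed (use Suc.prems in simp)
    moreover have "msum f ?x * full_theta x = msum f x * full_theta ?x"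
      by (rule msum_update_ratio[OF f anti Suc.prems(2) i s(1) Suc.prems(3)])
    moreover have "msum f ?y * full_theta y = msum f y * full_theta ?y"
      by (rule msum_update_ratio[OF f anti Suc.prems(4) i s(1) Suc.prems(5)])
    \<comment> \<open>Eliminates the two intermediate points; \<open>b'\<close> and
      \<open>d'\<close> are their nonzero theta values.\<close>
    moreover have "a * d = c * b" if "a' * d' = c' * b'" "a' * b = a * b'" "c' * d = c * d'" "b' \<noteq> 0" "d' \<noteq> 0"
      for a b c d a' b' c' d' :: complex
    proof -
      have "a * d * (b' * d') = (a * b') * d * d'" by (simp add: mult_ac)
      also have "\<dots> = (a' * d') * b * d" by (simp only: that(2)[symmetric] mult_ac)
      also have "\<dots> = (c' * d) * b * b'" by (simp only: that(1) mult_ac)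
      also have "\<dots> = c * b * (b' * d')" by (simp only: that(3) mult_ac)
      finally show ?thesis using that by simp
    qed
    ultimately show ?case using s by blast
  qed
  then show ?thesis using assms by blast
qed

text \<open>Where the theta product vanishes, quasi-periodicity moves the argument to a point with two equal coordinates.\<close>

lemma msum_eq_0:
  assumes f: "mpoly_le {1..n} (\<lambda>_. J) f"
    and anti: "\<And>y i j. i \<in> {1..n} \<Longrightarrow> j \<in> {1..n} \<Longrightarrow> i \<noteq> j \<Longrightarrow> f (y \<circ> Transposition.transpose i j) = - f y"
    and x: "nonzero x" and z: "weyl_theta n x = 0"
  shows "msum f x = 0"
proof -
  obtain i j m where ij: "i \<in> {1..n}" "j \<in> {1..n}" "i \<noteq> j" and m: "x i = x j * q powi m"
    using z weyl_theta_eq_0_iff[OF x] by blast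
  have xj: "x j \<noteq> 0" using x ij by simp
  have step: "msum f (x(i := x j * q powi (k + 1))) = 0 \<longleftrightarrow> msum f (x(i := x j * q powi k)) = 0" for k
  proof -
    let ?x = "x(i := x j * q powi k)"
    have nz: "nonzero ?x" using x xj by simp
    have "kap n B / t * (?x i) powi (- int n) \<noteq> 0"
      using kap_nz[OF B_nz] t_nz xj by simp
    moreover have "x(i := x j * q powi (k + 1)) = ?x(i := q * ?x i)"
      by (simp add: power_int_add_1 mult_ac)
    ultimately show ?thesis using msum_shift[OF f nz ij(1)] by (metis mult_eq_0_iff)
  qed
  have eq: "(x(i := x j)) i = (x(i := x j)) j" using ij by simp
  have "msum f (x(i := x j)) = 0"
    by (rule msum_antisymmetric[where f = f and i = i and j = j, OF anti[OF ij] ij(1,2) eq])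
  then have "msum f (x(i := x j * q powi 0)) = 0" by simp
  have "msum f (x(i := x j * q powi m)) = 0"
  proof (induction m rule: int_induct[where k = 0])
    case base
    show ?case by fact
  next
    case (step1 k)
    then show ?case by (simp only: step)
  next
    case (step2 k)
    then show ?case using step[of "k - 1"] by (simp only: diff_add_cancel simp_thms)
  qed
  moreover have "x(i := x j * q powi m) = x" using m by auto
  ultimately show ?thesis by simp
qed

end

text \<open>Uniqueness of Laurent coefficients on a circle: average over the \<open>L\<close>-th roots of unity and let \<open>L\<close> tend to infinity.\<close>

lemma infsum_weight_zero:
  fixes wt :: "'a \<Rightarrow> int" and c :: "'a \<Rightarrow> complex"
  assumes \<rho>: "0 < \<rho>" and summable: "(\<lambda>k. \<rho> powi wt k * norm (c k)) summable_on S"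
    and zero: "\<And>t. norm t = \<rho> \<Longrightarrow> (\<Sum>\<^sub>\<infinity>k\<in>S. t powi wt k * c k) = 0"
  shows "(\<Sum>\<^sub>\<infinity>k\<in>{k\<in>S. wt k = 0}. c k) = 0"
proof -
  define C where "C = (\<lambda>k. complex_of_real \<rho> powi wt k * c k)"
  have normC: "norm (C k) = \<rho> powi wt k * norm (c k)" for k
    using \<rho> by (simp add: C_def norm_mult norm_power_int)
  have Cabs: "(\<lambda>k. norm (C k)) summable_on S" using summable by (simp add: normC)
  have Csum: "C summable_on X" if "X \<subseteq> S" for X
    using abs_summable_summable[OF Cabs] summable_on_subset_banach that by blast
  \<comment> \<open>The average keeps exactly the weights divisible by \<open>L\<close>; those other
    than 0 are disposed of afterwards by the choice of \<open>L\<close>.\<close>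
  have mult: "(\<Sum>\<^sub>\<infinity>k\<in>{k\<in>S. int L dvd wt k}. C k) = 0" if L: "L > 0" for L :: nat
  proof -
    define \<omega> where "\<omega> = cis (2 * pi / real L)"
    have w_norm: "norm (\<omega> ^ l) = 1" for l by (simp add: \<omega>_def norm_power)
    have w_L: "\<omega> ^ L = 1" using L by (simp add: \<omega>_def Complex.DeMoivre)
    have w_nz: "\<omega> \<noteq> 0" by (simp add: \<omega>_def)
    have geom: "(\<Sum>l<L. (\<omega> powi m) ^ l) = (if int L dvd m then of_nat L else 0)" for m
    proof (cases "int L dvd m")
      case True
      then obtain u where "m = int L * u" by blast
      then have "\<omega> powi m = 1" using w_L by (simp add: power_int_mult power_int_of_nat)
      then show ?thesis using True by simp
    next
      case False
      have "\<omega> powi m \<noteq> 1"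
      proof
        assume "\<omega> powi m = 1"
        then have "cis (real_of_int m * (2 * pi / real L)) = 1"
          by (simp add: \<omega>_def cis_power_int mult.commute)
        then obtain u where "real_of_int m * (2 * pi / real L) = 2 * pi * of_int u"
          unfolding cis_conv_exp exp_eq_1 by (auto simp: mult_ac)
        then have "real_of_int m = real L * of_int u" using L by (simp add: field_simps)
        then have "m = int L * u" by (metis of_int_eq_iff of_int_mult of_int_of_nat_eq)
        then show False using False by simp
      qed
      moreover have "(\<omega> powi m) ^ L = 1"
        using w_L by (metis mult.commute power_int_1_left power_int_mult power_int_of_nat)
      ultimately show ?thesis using False by (simp add: sum_gp_strict geometric_sum)
    qed
    have "0 = (\<Sum>l<L. (\<Sum>\<^sub>\<infinity>k\<in>S. (of_real \<rho> * \<omega> ^ l) powi wt k * c k))"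
      using zero \<rho> by (intro sum.neutral[symmetric] ballI) (simp add: norm_mult w_norm)
    also have "\<dots> = (\<Sum>l<L. (\<Sum>\<^sub>\<infinity>k\<in>S. (\<omega> powi wt k) ^ l * C k))"
    proof (intro sum.cong refl infsum_cong)
      fix l k
      have "(\<omega> ^ l) powi wt k = (\<omega> powi wt k) ^ l"
        by (metis mult.commute power_int_mult power_int_of_nat)
      then show "(of_real \<rho> * \<omega> ^ l) powi wt k * c k = (\<omega> powi wt k) ^ l * C k"
        by (simp add: C_def power_int_mult_distrib mult_ac)
    qed
    also have "\<dots> = (\<Sum>\<^sub>\<infinity>k\<in>S. \<Sum>l<L. (\<omega> powi wt k) ^ l * C k)"
    proof (rule infsum_finite_sum[symmetric])
      fix l
      have "(\<lambda>k. norm ((\<omega> powi wt k) ^ l * C k)) summable_on S"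
        using Cabs by (simp add: norm_mult norm_power norm_power_int \<omega>_def)
      then show "(\<lambda>k. (\<omega> powi wt k) ^ l * C k) summable_on S" by (rule abs_summable_summable)
    qed
    also have "\<dots> = (\<Sum>\<^sub>\<infinity>k\<in>S. (if int L dvd wt k then of_nat L else 0) * C k)"
      by (simp only: geom flip: sum_distrib_right)
    also have "\<dots> = (\<Sum>\<^sub>\<infinity>k\<in>{k\<in>S. int L dvd wt k}. of_nat L * C k)"
      by (rule infsum_cong_neutral) auto
    also have "\<dots> = of_nat L * (\<Sum>\<^sub>\<infinity>k\<in>{k\<in>S. int L dvd wt k}. C k)"
      by (rule infsum_cmult_right')
    finally show ?thesis using L by simp
  qed
  have "norm (\<Sum>\<^sub>\<infinity>k\<in>{k\<in>S. wt k = 0}. C k) \<le> \<epsilon>" if \<epsilon>: "\<epsilon> > 0" for \<epsilon>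
  proof -
    obtain F where F: "finite F" "F \<subseteq> S" "(\<Sum>\<^sub>\<infinity>k\<in>S - F. norm (C k)) < \<epsilon>"
    proof -
      have "((\<lambda>F. \<Sum>k\<in>F. norm (C k)) \<longlongrightarrow> (\<Sum>\<^sub>\<infinity>k\<in>S. norm (C k))) (finite_subsets_at_top S)"
        using Cabs by (rule infsum_tendsto)
      then have "\<forall>\<^sub>F F in finite_subsets_at_top S. dist (\<Sum>k\<in>F. norm (C k)) (\<Sum>\<^sub>\<infinity>k\<in>S. norm (C k)) < \<epsilon>"
        using \<epsilon> by (rule tendstoD)
      then obtain F where F: "finite F" "F \<subseteq> S" "dist (\<Sum>k\<in>F. norm (C k)) (\<Sum>\<^sub>\<infinity>k\<in>S. norm (C k)) < \<epsilon>"
        by (auto simp: eventually_finite_subsets_at_top)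
      have "(\<Sum>\<^sub>\<infinity>k\<in>S - F. norm (C k)) = (\<Sum>\<^sub>\<infinity>k\<in>S. norm (C k)) - (\<Sum>k\<in>F. norm (C k))"
        using F Cabs by (subst infsum_Diff) auto
      then show ?thesis using that F by (auto simp: dist_real_def)
    qed
    \<comment> \<open>\<open>L\<close> exceeds every \<open>\<bar>wt k\<bar>\<close> on
      \<open>F\<close>, so a nonzero weight divisible by \<open>L\<close> occurs only outside
      \<open>F\<close>, where the norms sum to less than \<epsilon>.\<close>
    define L where "L = nat (Max (insert 0 ((\<lambda>k. \<bar>wt k\<bar>) ` F))) + 1"
    have L: "L > 0" by (simp add: L_def)
    have big: "\<bar>wt k\<bar> < int L" if "k \<in> F" for k
    proof -
      have "\<bar>wt k\<bar> \<le> Max (insert 0 ((\<lambda>k. \<bar>wt k\<bar>) ` F))" using F(1) that by (intro Max_ge) auto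
      moreover from this have "0 \<le> Max (insert 0 ((\<lambda>k. \<bar>wt k\<bar>) ` F))" using abs_ge_zero[of "wt k"] by linarith
      ultimately show ?thesis by (simp add: L_def)
    qed
    let ?R = "{k\<in>S. int L dvd wt k} - {k\<in>S. wt k = 0}"
    have R: "?R \<subseteq> S - F"
    proof
      fix k assume k: "k \<in> ?R"
      have "k \<notin> F"
      proof
        assume "k \<in> F"
        then have "\<bar>wt k\<bar> < int L" by (rule big)
        moreover have "int L \<le> \<bar>wt k\<bar>" using k by (intro zdvd_imp_le) auto
        ultimately show False by simp
      qed
      then show "k \<in> S - F" using k by auto
    qed
    have "(\<Sum>\<^sub>\<infinity>k\<in>?R. C k) = (\<Sum>\<^sub>\<infinity>k\<in>{k\<in>S. int L dvd wt k}. C k) - (\<Sum>\<^sub>\<infinity>k\<in>{k\<in>S. wt k = 0}. C k)"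
      by (intro infsum_Diff Csum) auto
    then have "norm (\<Sum>\<^sub>\<infinity>k\<in>{k\<in>S. wt k = 0}. C k) = norm (\<Sum>\<^sub>\<infinity>k\<in>?R. C k)"
      using mult[OF L] by simp
    also have "\<dots> \<le> (\<Sum>\<^sub>\<infinity>k\<in>?R. norm (C k))"
      by (intro norm_infsum_bound summable_on_subset_banach[OF Cabs]) auto
    also have "\<dots> \<le> (\<Sum>\<^sub>\<infinity>k\<in>S - F. norm (C k))"
      using R by (intro infsum_mono_neutral summable_on_subset_banach[OF Cabs]) auto
    also have "\<dots> < \<epsilon>" by (rule F(3))
    finally show ?thesis by simp
  qed
  then have "norm (\<Sum>\<^sub>\<infinity>k\<in>{k\<in>S. wt k = 0}. C k) \<le> 0"
    by (meson field_le_epsilon add_0 le_add_same_cancel1 dense_ge)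
  moreover have "(\<Sum>\<^sub>\<infinity>k\<in>{k\<in>S. wt k = 0}. C k) = (\<Sum>\<^sub>\<infinity>k\<in>{k\<in>S. wt k = 0}. c k)"
    by (intro infsum_cong) (auto simp: C_def)
  ultimately show ?thesis by simp
qed

text \<open>The same \<open>p\<close> is attached to every coordinate, which preserves antisymmetry.
  It is the place of the parameters \<open>h j\<close>.\<close>

definition vander_poly :: "nat \<Rightarrow> complex poly \<Rightarrow> (nat \<Rightarrow> complex) \<Rightarrow> complex" where
  "vander_poly n p y = vander n y * (\<Prod>i\<in>{1..n}. poly p (y i))"

lemma mpoly_le_vander_poly: "mpoly_le {1..n} (\<lambda>_. n - 1 + degree p) (vander_poly n p)"
proof -
  have "mpoly_le {1..n} (\<lambda>i. \<Sum>l\<in>{1..n}. if i = l then degree p else 0) (\<lambda>y. \<Prod>i\<in>{1..n}. poly p (y i))"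
    by (intro mpoly_le_prod mpoly_le_poly) auto
  then have "mpoly_le {1..n} (\<lambda>i. (if i \<in> {1..n} then n - 1 else 0) + (\<Sum>l\<in>{1..n}. if i = l then degree p else 0))
      (\<lambda>y. vander n y * (\<Prod>i\<in>{1..n}. poly p (y i)))"
    by (intro mpoly_le_mult mpoly_le_vander) auto
  then have "mpoly_le {1..n} (\<lambda>_. n - 1 + degree p) (\<lambda>y. vander n y * (\<Prod>i\<in>{1..n}. poly p (y i)))"
    by (rule mpoly_le_mono) auto
  then show ?thesis by (simp add: vander_poly_def[abs_def])
qed

lemma vander_poly_transpose:
  assumes ij: "i \<in> {1..n}" "j \<in> {1..n}" "i \<noteq> j"
  shows "vander_poly n p (y \<circ> Transposition.transpose i j) = - vander_poly n p y"
proof -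
  have "bij_betw (Transposition.transpose i j) {1..n} {1..n}"
    using ij by (auto intro!: bij_betwI[where g = "Transposition.transpose i j"] simp: Transposition.transpose_def split: if_splits)
  then have "(\<Prod>l\<in>{1..n}. poly p ((y \<circ> Transposition.transpose i j) l)) = (\<Prod>l\<in>{1..n}. poly p (y l))"
    using prod.reindex_bij_betw[of _ "{1..n}" "{1..n}" "\<lambda>l. poly p (y l)"] by simp
  then show ?thesis by (simp only: vander_poly_def vander_transpose[OF ij]) simp
qed

lemma infsum_minus:
  fixes f g :: "'a \<Rightarrow> complex"
  assumes "f summable_on S" "g summable_on S"
  shows "(\<Sum>\<^sub>\<infinity>k\<in>S. f k - g k) = infsum f S - infsum g S"
  using infsum_add[of f S "\<lambda>k. - g k"] summable_on_cmult_right[OF assms(2), of "-1"] assms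
  by (simp add: infsum_uminus)

section \<open>Sums over the root lattice\<close>

context nome begin

definition shifted_term :: "nat \<Rightarrow> (nat \<Rightarrow> complex) \<Rightarrow> (nat \<Rightarrow> complex) \<Rightarrow> complex poly \<Rightarrow> (nat \<Rightarrow> complex) \<Rightarrow> (nat \<Rightarrow> int) \<Rightarrow> complex" where
  "shifted_term n A B p x k = vander_poly n p (\<lambda>i. x i * q powi k i) * (\<Prod>i\<in>{1..n}. unit_term n A B (k i) (x i))"

text \<open>The auxiliary variable \<open>t\<close> of the locale \<^locale>\<open>bilateral\<close> relaxes the constraint \<open>\<Sum>k i = 0\<close>;
  comparing coefficients of \<open>t\<close> restores it.\<close>

theorem root_lattice_sum_proportional:
  assumes B: "\<forall>m\<in>{1..n}. B m \<noteq> 0"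
    and conv: "norm (\<Prod>m\<in>{1..n}. A m) < norm (q ^ (n - 1 + degree p) * (\<Prod>m\<in>{1..n}. B m))"
    and x: "\<forall>i\<in>{1..n}. x i \<noteq> 0" and y: "\<forall>i\<in>{1..n}. y i \<noteq> 0"
    and out: "\<And>i. i \<notin> {1..n} \<Longrightarrow> x i = y i"
    and xy: "(\<Prod>i\<in>{1..n}. x i) = (\<Prod>i\<in>{1..n}. y i)"
    and wy: "weyl_theta n y \<noteq> 0"
  shows "(\<Sum>\<^sub>\<infinity>k\<in>{k \<in> PiE {1..n} (\<lambda>_. UNIV). (\<Sum>i\<in>{1..n}. k i) = 0}. shifted_term n A B p x k) * weyl_theta n y
       = (\<Sum>\<^sub>\<infinity>k\<in>{k \<in> PiE {1..n} (\<lambda>_. UNIV). (\<Sum>i\<in>{1..n}. k i) = 0}. shifted_term n A B p y k) * weyl_theta n x"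
proof -
  let ?J = "n - 1 + degree p"
  let ?S = "PiE {1..n} (\<lambda>_. UNIV :: int set)"
  let ?wt = "\<lambda>k. \<Sum>i\<in>{1..n}. k i :: int"
  define b where "b = (\<Prod>m\<in>{1..n}. B m)"
  define X where "X = (\<Prod>i\<in>{1..n}. x i)"
  have b: "b \<noteq> 0" and X: "X \<noteq> 0" using B x by (auto simp: b_def X_def)
  \<comment> \<open>The inner radius of the annulus of admissible \<open>t\<close>;
    \<open>conv\<close> puts it below 1.\<close>
  define \<rho>0 where "\<rho>0 = norm (\<Prod>m\<in>{1..n}. A m) / norm (q ^ ?J * b)"
  have \<rho>0: "\<rho>0 < 1" using conv b by (simp add: \<rho>0_def b_def norm_mult norm_power)
  have \<rho>0_ge: "0 \<le> \<rho>0" by (simp add: \<rho>0_def)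
  \<comment> \<open>The theta factor in \<open>t\<close> vanishes only if \<open>t * b * X\<close>
    is a power of \<open>q\<close>, hence on countably many circles. Uncountability of the interval
    provides a radius avoiding all of them.\<close>
  have "uncountable {\<rho>0<..<1}" using \<rho>0 by (simp add: uncountable_open_interval)
  moreover have "countable (range (\<lambda>m::int. norm q powi m / norm (b * X)))" by simp
  ultimately obtain \<rho> where \<rho>: "\<rho>0 < \<rho>" "\<rho> < 1" "\<rho> \<notin> range (\<lambda>m::int. norm q powi m / norm (b * X))"
    by (meson countable_subset greaterThanLessThan_iff subsetI)
  have \<rho>pos: "0 < \<rho>" using \<rho> \<rho>0_ge by linarith
  have loc: "bilateral q n ?J A B t" if t: "norm t = \<rho>" for t
  proof unfold_locales
    show "t \<noteq> 0" "norm t < 1" using t \<rho> \<rho>pos by auto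
    have "norm (\<Prod>m\<in>{1..n}. A m) < \<rho> * norm (q ^ ?J * b)"
      using \<rho>(1) b by (simp add: \<rho>0_def pos_divide_less_eq norm_mult norm_power)
    then show "norm (\<Prod>m\<in>{1..n}. A m) < norm (t * q ^ ?J * (\<Prod>m\<in>{1..n}. B m))"
      using t by (simp add: b_def norm_mult mult.assoc)
  qed (use B in auto)
  have mterm: "bilateral.mterm q n A B t (vander_poly n p) v k = t powi ?wt k * shifted_term n A B p v k" 
    if "norm t = \<rho>" for t v k
    by (simp add: bilateral.mterm_def[OF loc[OF that]] shifted_term_def mult.assoc)
  have summable: "(\<lambda>k. \<rho> powi ?wt k * norm (shifted_term n A B p v k)) summable_on ?S"
    if v: "\<forall>i\<in>{1..n}. v i \<noteq> 0" for v
  proof -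
    have n: "norm (complex_of_real \<rho>) = \<rho>" using \<rho>pos by simp
    have "(\<lambda>k. norm (bilateral.mterm q n A B (of_real \<rho>) (vander_poly n p) v k)) summable_on ?S"
      by (rule bilateral.mterm_summable[OF loc[OF n] mpoly_le_vander_poly v])
    then show ?thesis unfolding mterm[OF n] norm_mult norm_power_int n .
  qed
  have zero_abs: "(\<lambda>k. norm (shifted_term n A B p v k)) summable_on {k \<in> ?S. ?wt k = 0}"
    if v: "\<forall>i\<in>{1..n}. v i \<noteq> 0" for v
  proof -
    have "(\<lambda>k. \<rho> powi ?wt k * norm (shifted_term n A B p v k)) summable_on {k \<in> ?S. ?wt k = 0}"
      by (rule summable_on_subset_banach[OF summable[OF v]]) auto
    then show ?thesis by (rule summable_on_cong[THEN iffD1, rotated]) auto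
  qed
  define c where "c = (\<lambda>k. shifted_term n A B p x k * weyl_theta n y - shifted_term n A B p y k * weyl_theta n x)"
  have "(\<Sum>\<^sub>\<infinity>k\<in>{k\<in>?S. ?wt k = 0}. c k) = 0"
  proof (rule infsum_weight_zero[OF \<rho>pos])
    have "(\<lambda>k. norm (weyl_theta n y) * (\<rho> powi ?wt k * norm (shifted_term n A B p x k))
       + norm (weyl_theta n x) * (\<rho> powi ?wt k * norm (shifted_term n A B p y k))) summable_on ?S"
      by (intro summable_on_add summable_on_cmult_right summable x y)
    then show "(\<lambda>k. \<rho> powi ?wt k * norm (c k)) summable_on ?S"
    proof (rule summable_on_comparison_test)
      fix k
      have "norm (c k) \<le> norm (shifted_term n A B p x k) * norm (weyl_theta n y) + norm (shifted_term n A B p y k) * norm (weyl_theta n x)"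
        unfolding c_def by (rule order_trans[OF norm_triangle_ineq4]) (simp add: norm_mult)
      then have "\<rho> powi ?wt k * norm (c k)
         \<le> \<rho> powi ?wt k * (norm (shifted_term n A B p x k) * norm (weyl_theta n y) + norm (shifted_term n A B p y k) * norm (weyl_theta n x))"
        using \<rho>pos by (intro mult_left_mono) auto
      then show "\<rho> powi ?wt k * norm (c k) \<le> norm (weyl_theta n y) * (\<rho> powi ?wt k * norm (shifted_term n A B p x k))
       + norm (weyl_theta n x) * (\<rho> powi ?wt k * norm (shifted_term n A B p y k))"
        by (simp only: distrib_left mult_ac)
      show "0 \<le> \<rho> powi ?wt k * norm (c k)" using \<rho>pos by simp
    qed
  next
    fix t :: complex assume t: "norm t = \<rho>"
    interpret bilateral q n ?J A B t by (rule loc[OF t])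
    note anti = vander_poly_transpose[where p = p]
    note f = mpoly_le_vander_poly[of n p]
    have "msum (vander_poly n p) x * weyl_theta n y = msum (vander_poly n p) y * weyl_theta n x"
    \<comment> \<open>The point \<open>x\<close> may be degenerate; then its series vanishes too,
      and both sides are zero.\<close>
    proof (cases "weyl_theta n x = 0")
      case True
      then show ?thesis using msum_eq_0[OF f anti x] by simp
    next
      case False
      have Y: "\<theta> (t * b * X) \<noteq> 0"
      proof
        assume "\<theta> (t * b * X) = 0"
        then obtain m where "t * b * X = q powi m"
          using theta_eq_0_iff[of "t * b * X"] t_nz b X by auto
        then have "norm (t * b * X) = norm q powi m" by (simp add: norm_power_int)
        then have "\<rho> = norm q powi m / norm (b * X)"
          using t b X by (simp add: norm_mult field_simps)
        then show False using \<rho>(3) by blast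
      qed
      have fx: "full_theta x = weyl_theta n x * \<theta> (t * b * X)"
        by (simp add: full_theta_def b_def X_def)
      \<comment> \<open>Equal coordinate products give both points the same theta factor in
        \<open>t\<close>. It cancels and leaves a relation whose coefficients do not depend on
        \<open>t\<close>.\<close>
      have fy: "full_theta y = weyl_theta n y * \<theta> (t * b * X)"
        by (simp only: full_theta_def b_def X_def xy)
      have "msum (vander_poly n p) x * full_theta y = msum (vander_poly n p) y * full_theta x"
        by (rule msum_proportional[OF f anti x _ y _ out]) (use fx fy Y False wy in auto)
      then show ?thesis using Y by (simp add: fx fy)
    qed
    moreover have "msum (vander_poly n p) v = (\<Sum>\<^sub>\<infinity>k\<in>?S. t powi ?wt k * shifted_term n A B p v k)" for v
      unfolding msum_def mterm[OF t] ..
    ultimately have "(\<Sum>\<^sub>\<infinity>k\<in>?S. t powi ?wt k * shifted_term n A B p x k * weyl_theta n y)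
       - (\<Sum>\<^sub>\<infinity>k\<in>?S. t powi ?wt k * shifted_term n A B p y k * weyl_theta n x) = 0"
      by (simp add: infsum_cmult_left')
    moreover have sm: "(\<lambda>k. t powi ?wt k * shifted_term n A B p v k * u) summable_on ?S"
      if v: "\<forall>i\<in>{1..n}. v i \<noteq> 0" for v u
      using abs_summable_summable[OF mterm_summable[OF f v]]
      unfolding mterm[OF t] by (rule summable_on_cmult_left)
    ultimately have "(\<Sum>\<^sub>\<infinity>k\<in>?S. t powi ?wt k * shifted_term n A B p x k * weyl_theta n y
       - t powi ?wt k * shifted_term n A B p y k * weyl_theta n x) = 0"
      by (subst infsum_minus) (use x y in auto)
    then show "(\<Sum>\<^sub>\<infinity>k\<in>?S. t powi ?wt k * c k) = 0"
      by (simp add: c_def right_diff_distrib mult.assoc)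
  qed
  moreover have "(\<Sum>\<^sub>\<infinity>k\<in>{k\<in>?S. ?wt k = 0}. c k)
     = (\<Sum>\<^sub>\<infinity>k\<in>{k\<in>?S. ?wt k = 0}. shifted_term n A B p x k) * weyl_theta n y
      - (\<Sum>\<^sub>\<infinity>k\<in>{k\<in>?S. ?wt k = 0}. shifted_term n A B p y k) * weyl_theta n x"
  proof -
    have "(\<lambda>k. shifted_term n A B p v k * u) summable_on {k\<in>?S. ?wt k = 0}"
      if "\<forall>i\<in>{1..n}. v i \<noteq> 0" for v u
      by (rule summable_on_cmult_left, rule abs_summable_summable, rule zero_abs[OF that])
    from infsum_minus[OF this[OF x] this[OF y]] show ?thesis
      unfolding c_def infsum_cmult_left' .
  qed
  ultimately show ?thesis by simp
qed

end

section \<open>Reduction of the Karlsson--Minton series\<close>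

lemma powi_prod: "(\<Prod>i\<in>S. f i) powi k = (\<Prod>i\<in>S. f i powi k)"
  for f :: "'b \<Rightarrow> 'a::field"
  by (induction S rule: infinite_finite_induct) (simp_all add: power_int_mult_distrib)

context nome begin

text \<open>Normalised to be 1 at \<open>k = 0\<close> for a generic point, as the summand of
  \<open>Psi\<close> is. It differs from \<open>shifted_term\<close> by a factor independent of
  \<open>k\<close>.\<close>

definition shift_ratio :: "nat \<Rightarrow> (nat \<Rightarrow> complex) \<Rightarrow> (nat \<Rightarrow> complex) \<Rightarrow> complex poly \<Rightarrow> (nat \<Rightarrow> complex) \<Rightarrow> (nat \<Rightarrow> int) \<Rightarrow> complex" where
  "shift_ratio n A B p x k = vander_poly n p (\<lambda>i. x i * q powi k i) / vander_poly n p x *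
     (\<Prod>i\<in>{1..n}. \<Prod>m\<in>{1..n}. qpoch (B m * x i) q (k i) / qpoch (A m * x i) q (k i))"

lemma shifted_term_eq:
  assumes B: "\<forall>m\<in>{1..n}. B m \<noteq> 0" and x: "\<forall>i\<in>{1..n}. x i \<noteq> 0"
    and gA: "\<And>i m. i \<in> {1..n} \<Longrightarrow> m \<in> {1..n} \<Longrightarrow> generic q (A m * x i)"
    and gB: "\<And>i m. i \<in> {1..n} \<Longrightarrow> m \<in> {1..n} \<Longrightarrow> generic q (B m * x i)"
    and V: "vander_poly n p x \<noteq> 0"
  shows "shifted_term n A B p x k = shift_ratio n A B p x k * (vander_poly n p x * (\<Prod>i\<in>{1..n}. numer n A B (x i)))"
proof -
  have "(\<Prod>i\<in>{1..n}. unit_term n A B (k i) (x i))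
      = (\<Prod>i\<in>{1..n}. numer n A B (x i) * (\<Prod>m\<in>{1..n}. qpoch (B m * x i) q (k i) / qpoch (A m * x i) q (k i)))"
    using B x gA gB by (intro prod.cong refl unit_term_qpoch) auto
  then show ?thesis
    using V by (simp add: shifted_term_def shift_ratio_def prod.distrib)
qed

text \<open>The symmetric coordinates: \<open>ext_point\<close> and \<open>ext_index\<close> add the coordinate \<open>Suc r\<close>, which stands
  for \<open>q powi (- \<bar>k\<bar>) / a\<close> and absorbs all factors of the summand with index \<open>\<bar>k\<bar>\<close>. The parameters \<open>d\<close> and \<open>c\<close>
  join the \<open>e i\<close> and \<open>b i\<close> as the last entries of \<open>A_param\<close> and \<open>B_param\<close>.\<close>

definition ext_point :: "nat \<Rightarrow> complex \<Rightarrow> (nat \<Rightarrow> complex) \<Rightarrow> nat \<Rightarrow> complex" where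
  "ext_point r a z i = (if i \<in> {1..r} then z i else if i = Suc r then 1 / a else 1)"

definition A_param :: "nat \<Rightarrow> complex \<Rightarrow> complex \<Rightarrow> (nat \<Rightarrow> complex) \<Rightarrow> (nat \<Rightarrow> complex) \<Rightarrow> nat \<Rightarrow> complex" where
  "A_param r a d e z m = (if m = Suc r then a * q / d else a * q / (e m * z m))"

definition B_param :: "nat \<Rightarrow> (nat \<Rightarrow> complex) \<Rightarrow> complex \<Rightarrow> (nat \<Rightarrow> complex) \<Rightarrow> nat \<Rightarrow> complex" where
  "B_param r b c z m = (if m = Suc r then c else b m / z m)"

text \<open>Its value at \<open>y\<close> is the product of the q-shifted factorials of
  \<open>a * q * y / h j\<close> of length \<open>N j\<close>. Its change along the lattice
  reproduces the factors with \<open>g j\<close> and \<open>h j\<close>, up to a power of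
  \<open>q\<close> at the last coordinate.\<close>

definition km_poly :: "nat \<Rightarrow> complex \<Rightarrow> (nat \<Rightarrow> complex) \<Rightarrow> (nat \<Rightarrow> nat) \<Rightarrow> complex poly" where
  "km_poly s a h N = (\<Prod>j\<in>{1..s}. \<Prod>l<N j. [:1, - (a * q / h j * q ^ l):])"

definition ext_index :: "nat \<Rightarrow> (nat \<Rightarrow> int) \<Rightarrow> nat \<Rightarrow> int" where
  "ext_index r k = (\<lambda>i\<in>{1..Suc r}. if i = Suc r then - absk r k else k i)"

lemma ext_point_simps [simp]:
  "i \<in> {1..r} \<Longrightarrow> ext_point r a z i = z i" "ext_point r a z (Suc r) = 1 / a"
  by (auto simp: ext_point_def)

lemma A_param_simps [simp]:
  "i \<in> {1..r} \<Longrightarrow> A_param r a d e z i = a * q / (e i * z i)" "A_param r a d e z (Suc r) = a * q / d"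
  by (auto simp: A_param_def)

lemma B_param_simps [simp]:
  "i \<in> {1..r} \<Longrightarrow> B_param r b c z i = b i / z i" "B_param r b c z (Suc r) = c"
  by (auto simp: B_param_def)

lemma ext_index_simps [simp]:
  "i \<in> {1..r} \<Longrightarrow> ext_index r k i = k i" "ext_index r k (Suc r) = - absk r k"
  by (auto simp: ext_index_def)

lemma prod_atLeastAtMost_Suc: "(\<Prod>i\<in>{1..Suc r}. g i) = (\<Prod>i\<in>{1..r}. g i) * g (Suc r)"
  for g :: "nat \<Rightarrow> 'a::comm_monoid_mult"
  by simp

lemma poly_km_poly: "poly (km_poly s a h N) y = (\<Prod>j\<in>{1..s}. \<Prod>l<N j. 1 - a * q / h j * y * q ^ l)"
  unfolding km_poly_def poly_prod by (intro prod.cong refl) (simp add: mult_ac)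

lemma generic_mult_power: "generic q u \<Longrightarrow> generic q (u * q ^ N)"
  unfolding generic_def
proof
  fix m assume "\<forall>n. u * q powi n \<noteq> 1"
  then have "u * q powi (int N + m) \<noteq> 1" by blast
  then show "u * q ^ N * q powi m \<noteq> 1" by (simp add: powi_add mult.assoc)
qed

text \<open>The factors with index \<open>absk r k\<close> move to the last coordinate, where the
  index has the opposite sign. Each such reflection leaves the \<open>K\<close>-th power of a
  constant, and the prescribed \<open>w\<close> is the product of these constants.\<close>

lemma psi_term_eq_shift_ratio:
  assumes gen: "psi_generic r s q a b c d e z g h"
    and g: "\<And>j. j \<in> {1..s} \<Longrightarrow> g j = a * q ^ (1 + N j) / h j"
    and w: "w = a ^ (r + 1) * q powi (1 - (\<Sum>j\<in>{1..s}. int (N j))) /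
      ((\<Prod>i\<in>{1..r}. b i) * c * d * (\<Prod>i\<in>{1..r}. e i))"
  shows "psi_term r s q a b c d e z g h w k
    = shift_ratio (Suc r) (A_param r a d e z) (B_param r b c z) (km_poly s a h N) (ext_point r a z) (ext_index r k)"
proof -
  note gen' = gen[unfolded psi_generic_def]
  have nz: "a \<noteq> 0" "c \<noteq> 0" "d \<noteq> 0" using gen' by auto
  have nzi: "b i \<noteq> 0" "e i \<noteq> 0" "z i \<noteq> 0" "1 - a * z i \<noteq> 0" if "i \<in> {1..r}" for i
    using gen' that by auto
  have nzj: "g j \<noteq> 0" "h j \<noteq> 0" if "j \<in> {1..s}" for j using gen' that by auto
  define K where "K = absk r k"
  define p where "p = km_poly s a h N"
  define x where "x = ext_point r a z"
  define \<kappa> where "\<kappa> = ext_index r k"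
  define A where "A = A_param r a d e z"
  define B where "B = B_param r b c z"
  define T1 where "T1 = (\<Prod>i\<in>{1..r}. \<Prod>j\<in>{i<..r}. (z i * q powi k i - z j * q powi k j) / (z i - z j))"
  define T2 where "T2 = (\<Prod>i\<in>{1..r}. (1 - a * z i * q powi (k i + K)) / (1 - a * z i))"
  define T3 where "T3 = (\<Prod>i\<in>{1..r}. \<Prod>j\<in>{1..r}. qpoch (b j * z i / z j) q (k i) / qpoch (a * z i * q / (e j * z j)) q (k i))"
  define T4 where "T4 = (\<Prod>i\<in>{1..r}. qpoch (e i * z i) q K / qpoch (a * z i * q / b i) q K)"
  define C5 where "C5 = (\<Prod>i\<in>{1..r}. qpoch (c * z i) q (k i) / qpoch (a * z i * q / d) q (k i))"
  define G5 where "G5 = (\<Prod>i\<in>{1..r}. \<Prod>j\<in>{1..s}. qpoch (g j * z i) q (k i) / qpoch (a * z i * q / h j) q (k i))"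
  define C6 where "C6 = qpoch d q K / qpoch (a * q / c) q K"
  define G6 where "G6 = (\<Prod>j\<in>{1..s}. qpoch (h j) q K / qpoch (a * q / g j) q K)"
  \<comment> \<open>The constants left by reflecting \<open>T4\<close>, \<open>C6\<close> and
    \<open>G6\<close>, respectively.\<close>
  define M1 where "M1 = (\<Prod>m\<in>{1..r}. (a * q / (e m * z m)) / (b m / z m))"
  define M2 where "M2 = (a * q / d) / c"
  define M3 where "M3 = (\<Prod>j\<in>{1..s}. inverse (q ^ N j))"
  have psi: "psi_term r s q a b c d e z g h w k = T1 * T2 * T3 * T4 * (C5 * G5) * (C6 * G6) * w powi K"
    unfolding psi_term_def Let_def K_def[symmetric] T1_def T2_def T3_def T4_def C5_def G5_def C6_def G6_def
    by (simp add: prod_dividef prod.distrib)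
  \<comment> \<open>Multiplying the difference between coordinate \<open>i\<close> and the last one
    by \<open>- a\<close> gives \<open>(1 - a * z i * q powi (k i + K)) * q powi (- K)\<close>. The
    stray power of \<open>q\<close> occurs \<open>r\<close> times.\<close>
  have V: "vander (Suc r) (\<lambda>i. x i * q powi \<kappa> i) / vander (Suc r) x = T1 * T2 * (inverse q ^ r) powi K"
  proof -
    have "vander r (\<lambda>i. x i * q powi \<kappa> i) = vander r (\<lambda>i. z i * q powi k i)"
      by (rule vander_cong) (simp add: x_def \<kappa>_def)
    moreover have "vander r x = vander r z"
      by (rule vander_cong) (simp add: x_def)
    moreover have "vander r (\<lambda>i. z i * q powi k i) / vander r z = T1"
      by (simp add: vander_def T1_def prod_dividef)
    moreover have "(\<Prod>i\<in>{1..r}. x i * q powi \<kappa> i - x (Suc r) * q powi \<kappa> (Suc r)) / (\<Prod>i\<in>{1..r}. x i - x (Suc r))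
        = T2 * (inverse q ^ r) powi K"
    proof -
      have "(x i * q powi \<kappa> i - x (Suc r) * q powi \<kappa> (Suc r)) / (x i - x (Suc r))
         = (1 - a * z i * q powi (k i + K)) / (1 - a * z i) * inverse q powi K" if i: "i \<in> {1..r}" for i
      proof -
        have "q powi (- K) * q powi K = 1" by (simp flip: powi_add)
        then have "(z i * q powi k i - 1 / a * q powi (- K)) * (- a) = (1 - a * z i * q powi (k i + K)) * q powi (- K)"
          using nz by (simp add: powi_add algebra_simps)
        moreover have "(z i - 1 / a) * (- a) = 1 - a * z i"
          using nz by (simp add: algebra_simps)
        ultimately have "(z i * q powi k i - 1 / a * q powi (- K)) / (z i - 1 / a)
            = (1 - a * z i * q powi (k i + K)) * q powi (- K) / (1 - a * z i)"
          using nz by (metis mult_divide_mult_cancel_right neg_equal_0_iff_equal)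
        then show ?thesis using i by (simp add: x_def \<kappa>_def K_def power_int_minus power_int_inverse)
      qed
      then have "(\<Prod>i\<in>{1..r}. (x i * q powi \<kappa> i - x (Suc r) * q powi \<kappa> (Suc r)) / (x i - x (Suc r)))
          = T2 * (\<Prod>i\<in>{1..r}. inverse q powi K)"
        unfolding T2_def prod.distrib[symmetric] by (intro prod.cong refl)
      moreover have "(\<Prod>i\<in>{1..r}. inverse q powi K) = (inverse q ^ r) powi K"
        by (simp add: power_int_power power_int_power' mult.commute)
      ultimately show ?thesis by (simp add: prod_dividef)
    qed
    ultimately show ?thesis by (simp only: vander_Suc times_divide_times_eq[symmetric]) (simp add: mult_ac)
  qed
  have P: "(\<Prod>i\<in>{1..Suc r}. poly p (x i * q powi \<kappa> i)) / (\<Prod>i\<in>{1..Suc r}. poly p (x i)) = G5 * (G6 * M3 powi K)"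
  proof -
    have "poly p (z i * q powi k i) / poly p (z i)
       = (\<Prod>j\<in>{1..s}. qpoch (g j * z i) q (k i) / qpoch (a * z i * q / h j) q (k i))" if i: "i \<in> {1..r}" for i
    proof -
      have "(\<Prod>l<N j. 1 - a * q / h j * (z i * q powi k i) * q ^ l) / (\<Prod>l<N j. 1 - a * q / h j * z i * q ^ l)
          = qpoch (g j * z i) q (k i) / qpoch (a * z i * q / h j) q (k i)" if j: "j \<in> {1..s}" for j
      proof -
        have u: "generic q (a * z i * q / h j)" using gen' i j by auto
        have "g j * z i = a * z i * q / h j * q ^ N j" using g[OF j] by simp
        then show ?thesis using qpoch_shift_ratio[OF u, of "N j" "k i"] by (simp add: mult_ac)
      qed
      then show ?thesis unfolding p_def poly_km_poly prod_dividef[symmetric] by (intro prod.cong refl)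
    qed
    then have 1: "(\<Prod>i\<in>{1..r}. poly p (x i * q powi \<kappa> i) / poly p (x i)) = G5"
      unfolding G5_def by (intro prod.cong refl) (simp add: x_def \<kappa>_def)
    \<comment> \<open>Reflection turns \<open>q / h j\<close> back into \<open>h j\<close> and, by
      the special form of \<open>g j\<close>, turns \<open>q / h j * q ^ N j\<close> into
      \<open>a * q / g j\<close>.\<close>
    have "(\<Prod>l<N j. 1 - a * q / h j * (1 / a * q powi (- K)) * q ^ l) / (\<Prod>l<N j. 1 - a * q / h j * (1 / a) * q ^ l)
        = qpoch (h j) q K / qpoch (a * q / g j) q K * inverse (q ^ N j) powi K" if j: "j \<in> {1..s}" for j
    proof -
      have hj: "h j \<noteq> 0" "generic q (h j)" using gen' j by auto
      have u: "generic q (q / h j)" using generic_reflect hj by blast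
      have un: "generic q (q / h j * q ^ N j)" by (rule generic_mult_power[OF u])
      have "(\<Prod>l<N j. 1 - q / h j * q powi (- K) * q ^ l) / (\<Prod>l<N j. 1 - q / h j * q ^ l)
         = qpoch (q / h j * q ^ N j) q (- K) / qpoch (q / h j) q (- K)"
        using qpoch_shift_ratio[OF u, of "N j" "- K"] by simp
      also have "\<dots> = ((q / h j) / (q / h j * q ^ N j)) powi K *
          (qpoch (q / (q / h j)) q K / qpoch (q / (q / h j * q ^ N j)) q K)"
        by (rule qpoch_reflect_ratio) (use hj u un in auto)
      also have "(q / h j) / (q / h j * q ^ N j) = inverse (q ^ N j)"
        using hj by (simp add: field_simps)
      also have "q / (q / h j) = h j" using hj by simp
      also have "q / (q / h j * q ^ N j) = a * q / g j"
        unfolding g[OF j] using hj nz by (simp add: field_simps)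
      finally show ?thesis using nz by (simp add: mult_ac)
    qed
    then have "poly p (1 / a * q powi (- K)) / poly p (1 / a)
       = (\<Prod>j\<in>{1..s}. qpoch (h j) q K / qpoch (a * q / g j) q K * inverse (q ^ N j) powi K)"
      unfolding p_def poly_km_poly prod_dividef[symmetric] by (intro prod.cong refl)
    also have "\<dots> = G6 * M3 powi K"
      unfolding G6_def M3_def prod.distrib powi_prod ..
    finally have 2: "poly p (x (Suc r) * q powi \<kappa> (Suc r)) / poly p (x (Suc r)) = G6 * M3 powi K"
      by (simp add: x_def \<kappa>_def K_def)
    show ?thesis
      unfolding prod_atLeastAtMost_Suc times_divide_times_eq[symmetric] prod_dividef[symmetric] 1 2 ..
  qed
  have Q: "(\<Prod>i\<in>{1..Suc r}. \<Prod>m\<in>{1..Suc r}. qpoch (B m * x i) q (\<kappa> i) / qpoch (A m * x i) q (\<kappa> i))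
      = T3 * C5 * (T4 * M1 powi K * (C6 * M2 powi K))"
  proof -
    let ?D = "\<lambda>i m. qpoch (B m * x i) q (\<kappa> i) / qpoch (A m * x i) q (\<kappa> i)"
    have 1: "(\<Prod>i\<in>{1..r}. \<Prod>m\<in>{1..r}. ?D i m) = T3"
      unfolding T3_def by (intro prod.cong refl) (simp add: x_def \<kappa>_def A_def B_def mult_ac)
    have 2: "(\<Prod>i\<in>{1..r}. ?D i (Suc r)) = C5"
      unfolding C5_def by (intro prod.cong refl) (simp add: x_def \<kappa>_def A_def B_def mult_ac)
    have 3: "?D (Suc r) m = qpoch (e m * z m) q K / qpoch (a * z m * q / b m) q K *
        ((a * q / (e m * z m)) / (b m / z m)) powi K" if m: "m \<in> {1..r}" for m
    proof -
      have g1: "generic q (e m * z m)" "generic q (a * z m * q / b m)" using gen' m by auto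
      have g2: "generic q (q / (e m * z m))" "generic q (q / (a * z m * q / b m))"
        by (rule generic_reflect; use g1 nz nzi[OF m] in simp)+
      have v: "q / (a * z m * q / b m) = b m / z m * (1 / a)" by simp
      have "qpoch (b m / z m * (1 / a)) q (- K) / qpoch (q / (e m * z m)) q (- K)
         = ((q / (e m * z m)) / (b m / z m * (1 / a))) powi K *
           (qpoch (q / (q / (e m * z m))) q K / qpoch (q / (b m / z m * (1 / a))) q K)"
        by (rule qpoch_reflect_ratio) (use g2(1) g2(2)[unfolded v] nz nzi[OF m] in auto)
      also have "(q / (e m * z m)) / (b m / z m * (1 / a)) = (a * q / (e m * z m)) / (b m / z m)"
        using nz by simp
      also have "q / (q / (e m * z m)) = e m * z m" by simp
      also have "q / (b m / z m * (1 / a)) = a * z m * q / b m" using nz by simp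
      finally show ?thesis using nz m by (simp add: x_def \<kappa>_def A_def B_def K_def mult_ac)
    qed
    have 3: "(\<Prod>m\<in>{1..r}. ?D (Suc r) m) = T4 * M1 powi K"
      unfolding T4_def M1_def powi_prod prod.distrib[symmetric] by (intro prod.cong refl 3)
    have 4: "?D (Suc r) (Suc r) = C6 * M2 powi K"
    proof -
      have g1: "generic q d" "generic q (a * q / c)" using gen' by auto
      have g2: "generic q (q / d)" "generic q (q / (a * q / c))"
        by (rule generic_reflect; use g1 nz in simp)+
      have v: "q / (a * q / c) = c * (1 / a)" by simp
      have "qpoch (c * (1 / a)) q (- K) / qpoch (q / d) q (- K)
         = ((q / d) / (c * (1 / a))) powi K * (qpoch (q / (q / d)) q K / qpoch (q / (c * (1 / a))) q K)"
        by (rule qpoch_reflect_ratio) (use g2(1) g2(2)[unfolded v] nz in auto)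
      also have "(q / d) / (c * (1 / a)) = M2" using nz by (simp add: M2_def)
      also have "q / (q / d) = d" by simp
      also have "q / (c * (1 / a)) = a * q / c" using nz by simp
      finally show ?thesis using nz by (simp add: x_def \<kappa>_def A_def B_def K_def C6_def mult_ac)
    qed
    show ?thesis
      by (simp only: prod_atLeastAtMost_Suc prod.distrib 1 2 3 4) (simp only: mult_ac)
  qed
  \<comment> \<open>The four constants come from the Vandermonde quotient, the parameters
    \<open>e i\<close> and \<open>b i\<close>, the parameters \<open>d\<close> and \<open>c\<close>,
    and the polynomial.\<close>
  have W: "w = inverse q ^ r * M1 * M2 * M3"
  proof -
    have M1: "M1 = (a * q) ^ r / ((\<Prod>i\<in>{1..r}. b i) * (\<Prod>i\<in>{1..r}. e i))"
    proof -
      have "M1 = (\<Prod>m\<in>{1..r}. a * q / (b m * e m))"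
        unfolding M1_def by (intro prod.cong refl) (use nzi in auto)
      then show ?thesis by (simp add: prod_dividef prod.distrib)
    qed
    have M3: "M3 = q powi (- (\<Sum>j\<in>{1..s}. int (N j)))"
      unfolding M3_def power_int_minus power_int_sum[OF q_nz] using prod_inversef[of "\<lambda>j. q ^ N j" "{1..s}"] by (simp add: o_def)
    have "q powi (1 - (\<Sum>j\<in>{1..s}. int (N j))) = q * M3"
      unfolding M3 by (simp add: powi_add[of 1 "- _", simplified] flip: powi_add)
    then show ?thesis
      unfolding w M1 M2_def by (simp add: field_simps power_mult_distrib)
  qed
  have "shift_ratio (Suc r) A B p x \<kappa>
     = vander (Suc r) (\<lambda>i. x i * q powi \<kappa> i) / vander (Suc r) x *
       ((\<Prod>i\<in>{1..Suc r}. poly p (x i * q powi \<kappa> i)) / (\<Prod>i\<in>{1..Suc r}. poly p (x i))) *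
       (\<Prod>i\<in>{1..Suc r}. \<Prod>m\<in>{1..Suc r}. qpoch (B m * x i) q (\<kappa> i) / qpoch (A m * x i) q (\<kappa> i))"
    unfolding shift_ratio_def vander_poly_def by simp
  also have "\<dots> = psi_term r s q a b c d e z g h w k"
    unfolding V P Q psi unfolding W by (simp add: power_int_mult_distrib mult_ac)
  finally show ?thesis unfolding x_def \<kappa>_def A_def B_def p_def ..
qed

end

section \<open>Inversion of all coordinates\<close>

lemma prod_pairs_mult:
  fixes g :: "nat \<Rightarrow> 'a::comm_monoid_mult"
  shows "(\<Prod>i\<in>{1..n}. \<Prod>j\<in>{i<..n}. g i * g j) = (\<Prod>i\<in>{1..n}. g i) ^ (n - 1)"
proof (induction n)
  case (Suc n)
  have "(\<Prod>i\<in>{1..n}. g i) ^ (n - 1) * (\<Prod>i\<in>{1..n}. g i) = (\<Prod>i\<in>{1..n}. g i) ^ n"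
    by (cases n) (simp_all add: mult.commute)
  then show ?case
    unfolding prod_pairs_Suc Suc.IH by (simp add: prod.distrib power_mult_distrib mult.assoc[symmetric])
qed simp

lemma prod_square_split:
  fixes g :: "nat \<Rightarrow> nat \<Rightarrow> 'a::comm_monoid_mult"
  shows "(\<Prod>i\<in>{1..n}. \<Prod>j\<in>{1..n}. g i j) = (\<Prod>i\<in>{1..n}. g i i) * (\<Prod>i\<in>{1..n}. \<Prod>j\<in>{i<..n}. g i j * g j i)"
proof (induction n)
  case (Suc n)
  have "(\<Prod>i\<in>{1..Suc n}. \<Prod>j\<in>{1..Suc n}. g i j)
      = (\<Prod>i\<in>{1..n}. \<Prod>j\<in>{1..n}. g i j) * (\<Prod>i\<in>{1..n}. g i (Suc n)) * ((\<Prod>j\<in>{1..n}. g (Suc n) j) * g (Suc n) (Suc n))"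
    by (simp add: prod.distrib mult_ac)
  then show ?case
    unfolding prod_pairs_Suc Suc.IH by (simp add: prod.distrib mult_ac)
qed simp

lemma vander_inverse:
  fixes u :: "nat \<Rightarrow> complex"
  assumes u: "\<forall>i\<in>{1..n}. u i \<noteq> 0"
  shows "vander n (\<lambda>i. 1 / u i) = (\<Prod>i\<in>{1..n}. \<Prod>j\<in>{i<..n}. - 1) * vander n u / (\<Prod>i\<in>{1..n}. u i) ^ (n - 1)"
proof -
  have "vander n (\<lambda>i. 1 / u i) = (\<Prod>i\<in>{1..n}. \<Prod>j\<in>{i<..n}. - 1 * (u i - u j) / (u i * u j))"
    unfolding vander_def
  proof (intro prod.cong refl)
    fix i j assume "i \<in> {1..n}" "j \<in> {i<..n}"
    then have "u i \<noteq> 0" "u j \<noteq> 0" using u by auto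
    then show "1 / u i - 1 / u j = - 1 * (u i - u j) / (u i * u j)" by (simp add: field_simps)
  qed
  then show ?thesis
    by (simp only: prod_dividef prod.distrib[where g = "\<lambda>i. - 1"] prod.distrib vander_def prod_pairs_mult)
       (simp only: prod.distrib[symmetric] prod_pairs_mult)
qed

text \<open>By hypothesis \<open>p'\<close> is, up to the constant \<open>C\<close>, the polynomial
  \<open>p\<close> with its coefficients reversed, \<open>D\<close> being the formal degree.\<close>

lemma vander_poly_inverse:
  assumes u: "\<forall>i\<in>{1..n}. u i \<noteq> 0"
    and p: "\<And>u. u \<noteq> 0 \<Longrightarrow> u ^ D * poly p' (1 / u) = C * poly p u"
  shows "vander_poly n p' (\<lambda>i. 1 / u i)
    = (\<Prod>i\<in>{1..n}. \<Prod>j\<in>{i<..n}. - 1) * C ^ n * vander_poly n p u / (\<Prod>i\<in>{1..n}. u i) ^ (n - 1 + D)"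
proof -
  have "(\<Prod>i\<in>{1..n}. poly p' (1 / u i)) = (\<Prod>i\<in>{1..n}. C * poly p (u i) / u i ^ D)"
  proof (rule prod.cong[OF refl])
    fix i assume "i \<in> {1..n}"
    then have "u i \<noteq> 0" using u by auto
    then show "poly p' (1 / u i) = C * poly p (u i) / u i ^ D"
      using p[of "u i"] by (simp add: field_simps)
  qed
  also have "\<dots> = C ^ n * (\<Prod>i\<in>{1..n}. poly p (u i)) / (\<Prod>i\<in>{1..n}. u i) ^ D"
    by (simp add: prod_dividef prod.distrib prod_power_distrib)
  finally show ?thesis
    unfolding vander_poly_def vander_inverse[OF u] by (simp add: power_add)
qed

context nome begin

text \<open>Inverting the coordinates and negating the indices reflects every q-shifted factorial
  and exchanges the two parameter families. The resulting monomials cancel because the indices sum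
  to zero: the product of the coordinates is then constant along the lattice, and the powers of the
  products of \<open>B m / A m\<close> multiply to 1.\<close>

lemma shift_ratio_reflect:
  assumes y: "\<forall>i\<in>{1..n}. y i \<noteq> 0"
    and A: "\<forall>m\<in>{1..n}. A m \<noteq> 0" and B: "\<forall>m\<in>{1..n}. B m \<noteq> 0"
    and A': "\<And>m. m \<in> {1..n} \<Longrightarrow> A' m = q / B m" and B': "\<And>m. m \<in> {1..n} \<Longrightarrow> B' m = q / A m"
    and x': "\<And>i. i \<in> {1..n} \<Longrightarrow> x' i = 1 / y i"
    and gA: "\<And>i m. i \<in> {1..n} \<Longrightarrow> m \<in> {1..n} \<Longrightarrow> generic q (A m * y i)"
    and gB: "\<And>i m. i \<in> {1..n} \<Longrightarrow> m \<in> {1..n} \<Longrightarrow> generic q (B m * y i)"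
    and p: "\<And>u. u \<noteq> 0 \<Longrightarrow> u ^ D * poly p' (1 / u) = C * poly p u" and C: "C \<noteq> 0"
    and k: "(\<Sum>i\<in>{1..n}. k i) = 0"
  shows "shift_ratio n A' B' p' x' k = shift_ratio n A B p y (\<lambda>i\<in>{1..n}. - k i)"
proof -
  define l where "l = (\<lambda>i\<in>{1..n}. - k i)"
  let ?u = "\<lambda>i. y i * q powi l i"
  have l: "l i = - k i" if "i \<in> {1..n}" for i using that by (simp add: l_def)
  have "vander_poly n p' (\<lambda>i. x' i * q powi k i) = vander_poly n p' (\<lambda>i. 1 / ?u i)"
    unfolding vander_poly_def
    by (intro arg_cong2[of _ _ _ _ "(*)"] vander_cong prod.cong refl)
       (simp_all add: x' l power_int_minus field_simps)
  moreover have "vander_poly n p' x' = vander_poly n p' (\<lambda>i. 1 / y i)"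
    unfolding vander_poly_def
    by (intro arg_cong2[of _ _ _ _ "(*)"] vander_cong prod.cong refl) (simp_all add: x')
  moreover have "(\<Prod>i\<in>{1..n}. ?u i) = (\<Prod>i\<in>{1..n}. y i)"
  proof -
    have "(\<Sum>i\<in>{1..n}. l i) = 0" using k by (simp add: l sum_negf)
    then have "(\<Prod>i\<in>{1..n}. q powi l i) = 1" using power_int_sum[OF q_nz, of l "{1..n}"] by simp
    then show ?thesis by (simp add: prod.distrib)
  qed
  moreover have "(\<Prod>i\<in>{1..n}. \<Prod>j\<in>{i<..n}. - 1 :: complex) \<noteq> 0" by simp
  moreover have "(\<Prod>i\<in>{1..n}. y i) \<noteq> 0" using y by simp
  ultimately have V: "vander_poly n p' (\<lambda>i. x' i * q powi k i) / vander_poly n p' x' = vander_poly n p ?u / vander_poly n p y"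
    using C y vander_poly_inverse[of n ?u D p' C p, OF _ p] vander_poly_inverse[of n y D p' C p, OF y p] by simp
  have "qpoch (B' m * x' i) q (k i) / qpoch (A' m * x' i) q (k i)
     = (B m / A m) powi k i * (qpoch (B m * y i) q (l i) / qpoch (A m * y i) q (l i))"
    if i: "i \<in> {1..n}" and m: "m \<in> {1..n}" for i m
  proof -
    have nz: "y i \<noteq> 0" "A m \<noteq> 0" "B m \<noteq> 0" using y A B i m by auto
    have "qpoch (B m * y i) q (- k i) / qpoch (A m * y i) q (- k i)
      = ((A m * y i) / (B m * y i)) powi k i * (qpoch (q / (A m * y i)) q (k i) / qpoch (q / (B m * y i)) q (k i))"
      by (rule qpoch_reflect_ratio) (use nz gA[OF i m] gB[OF i m] in auto)
    moreover have "(B m / A m) powi k i * ((A m * y i) / (B m * y i)) powi k i = 1"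
      using nz by (simp flip: power_int_mult_distrib)
    ultimately have "(B m / A m) powi k i * (qpoch (B m * y i) q (- k i) / qpoch (A m * y i) q (- k i))
      = qpoch (q / (A m * y i)) q (k i) / qpoch (q / (B m * y i)) q (k i)"
      by (simp only: mult.assoc[symmetric]) simp
    then show ?thesis by (simp add: A'[OF m] B'[OF m] x'[OF i] l[OF i])
  qed
  then have "(\<Prod>i\<in>{1..n}. \<Prod>m\<in>{1..n}. qpoch (B' m * x' i) q (k i) / qpoch (A' m * x' i) q (k i))
     = (\<Prod>i\<in>{1..n}. \<Prod>m\<in>{1..n}. (B m / A m) powi k i * (qpoch (B m * y i) q (l i) / qpoch (A m * y i) q (l i)))"
    by (intro prod.cong refl) auto
  also have "\<dots> = (\<Prod>i\<in>{1..n}. (\<Prod>m\<in>{1..n}. B m / A m) powi k i) *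
      (\<Prod>i\<in>{1..n}. \<Prod>m\<in>{1..n}. qpoch (B m * y i) q (l i) / qpoch (A m * y i) q (l i))"
    by (simp only: prod.distrib powi_prod)
  also have "(\<Prod>i\<in>{1..n}. (\<Prod>m\<in>{1..n}. B m / A m) powi k i) = 1"
    using A B k by (subst power_int_sum[symmetric]) auto
  finally show ?thesis
    unfolding shift_ratio_def V l_def[symmetric] by simp
qed

lemma generic_nonzero_factor: "generic q u \<Longrightarrow> 1 - u * q ^ l \<noteq> 0"
  unfolding generic_def by (metis power_int_of_nat right_minus_eq)

text \<open>At the last coordinate \<open>1 / a\<close> the products are
  \<open>q / (e m * z m)\<close>, \<open>q / d\<close>, \<open>q / (a * z m * q / b m)\<close> and
  \<open>q / (a * q / c)\<close>, the reflections of the parameters that carry the index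
  \<open>absk r k\<close>.\<close>

lemma psi_generic_parameters:
  assumes gen: "psi_generic r s q a b c d e z g h"
    and i: "i \<in> {1..Suc r}" and m: "m \<in> {1..Suc r}"
  shows "generic q (A_param r a d e z m * ext_point r a z i)"
    and "generic q (B_param r b c z m * ext_point r a z i)"
proof -
  note gen' = gen[unfolded psi_generic_def]
  have cases: "(i \<in> {1..r} \<or> i = Suc r)" "(m \<in> {1..r} \<or> m = Suc r)" using i m by auto
  have nz: "a \<noteq> 0" "c \<noteq> 0" "d \<noteq> 0" using gen' by auto
  have nzi: "b i \<noteq> 0" "e i \<noteq> 0" "z i \<noteq> 0" if "i \<in> {1..r}" for i using gen' that by auto
  have r1: "generic q (q / (e m * z m))" "generic q (q / (a * z m * q / b m))" if "m \<in> {1..r}" for m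
    by (rule generic_reflect; use gen' nz nzi[OF that] that in auto)+
  have r2: "generic q (q / d)" "generic q (q / (a * q / c))"
    by (rule generic_reflect; use gen' nz in auto)+
  show "generic q (A_param r a d e z m * ext_point r a z i)"
    using cases gen' nz r1(1)[of m] r2(1) by (auto simp: mult_ac)
  show "generic q (B_param r b c z m * ext_point r a z i)"
    using cases gen' nz r1(2)[of m] r2(2) by (auto simp: mult_ac)
qed

lemma psi_generic_vander_poly:
  assumes gen: "psi_generic r s q a b c d e z g h"
  shows "vander_poly (Suc r) (km_poly s a h N) (ext_point r a z) \<noteq> 0"
proof -
  note gen' = gen[unfolded psi_generic_def]
  have nz: "a \<noteq> 0" using gen' by auto
  have "vander r (ext_point r a z) = vander r z" by (rule vander_cong) simp
  moreover have "vander r z \<noteq> 0" using gen' by (auto simp: vander_def)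
  ultimately have "vander r (ext_point r a z) \<noteq> 0" by simp
  moreover have "(\<Prod>i\<in>{1..r}. ext_point r a z i - ext_point r a z (Suc r)) \<noteq> 0"
    using gen' nz by (auto simp: field_simps)
  moreover have "\<forall>i\<in>{1..Suc r}. poly (km_poly s a h N) (ext_point r a z i) \<noteq> 0"
  proof
    fix i assume i: "i \<in> {1..Suc r}"
    have "generic q (a * q / h j * ext_point r a z i)" if j: "j \<in> {1..s}" for j
    proof (cases "i = Suc r")
      case True
      have "generic q (q / h j)" using gen' j by (auto intro!: generic_reflect)
      then show ?thesis using True nz by simp
    next
      case False
      then have "i \<in> {1..r}" using i by auto
      then show ?thesis using gen' j by (simp add: mult_ac)
    qed
    then have "1 - a * q / h j * ext_point r a z i * q ^ l \<noteq> 0" if "j \<in> {1..s}" for j l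
      using that generic_nonzero_factor by blast
    then show "poly (km_poly s a h N) (ext_point r a z i) \<noteq> 0"
      unfolding poly_km_poly prod_zero_iff[OF finite_atLeastAtMost] prod_zero_iff[OF finite_lessThan] by blast
  qed
  ultimately show ?thesis
    unfolding vander_poly_def vander_Suc mult_eq_0_iff prod_zero_iff[OF finite_atLeastAtMost] by blast
qed

section \<open>From multi-indices to the root lattice\<close>

abbreviation root_lattice :: "nat \<Rightarrow> (nat \<Rightarrow> int) set" where
  "root_lattice n \<equiv> {k \<in> PiE {1..n} (\<lambda>_. UNIV). (\<Sum>i\<in>{1..n}. k i) = 0}"

text \<open>The last entry is determined by the vanishing sum. Outside the index range a multi-index
  is 0 while a lattice vector is \<open>undefined\<close>, which explains the case distinction in
  the inverse map.\<close>

lemma bij_betw_ext_index: "bij_betw (ext_index r) (multi_idx r) (root_lattice (Suc r))"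
proof (rule bij_betwI[where g = "\<lambda>k i. if i \<in> {1..r} then k i else 0"])
  show "ext_index r \<in> multi_idx r \<rightarrow> root_lattice (Suc r)"
  proof
    fix k assume "k \<in> multi_idx r"
    have "(\<Sum>i\<in>{1..r}. ext_index r k i) = absk r k" unfolding absk_def by (rule sum.cong) auto
    then show "ext_index r k \<in> root_lattice (Suc r)" by (auto simp: ext_index_def)
  qed
  show "(\<lambda>k i. if i \<in> {1..r} then k i else 0) \<in> root_lattice (Suc r) \<rightarrow> multi_idx r"
    by (auto simp: multi_idx_def)
  show "(\<lambda>i. if i \<in> {1..r} then ext_index r k i else 0) = k" if "k \<in> multi_idx r" for k
    using that by (auto simp: multi_idx_def fun_eq_iff)
  show "ext_index r (\<lambda>i. if i \<in> {1..r} then k i else 0) = k" if k: "k \<in> root_lattice (Suc r)" for k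
  proof
    fix i
    have "absk r (\<lambda>i. if i \<in> {1..r} then k i else 0) = (\<Sum>i\<in>{1..r}. k i)"
      unfolding absk_def by (rule sum.cong) auto
    moreover have "(\<Sum>i\<in>{1..r}. k i) + k (Suc r) = 0" using k by simp
    ultimately show "ext_index r (\<lambda>i. if i \<in> {1..r} then k i else 0) i = k i"
      using k by (auto simp: ext_index_def PiE_def extensional_def)
  qed
qed

lemma Psi_eq_shift_ratio_sum:
  assumes gen: "psi_generic r s q a b c d e z g h"
    and g: "\<And>j. j \<in> {1..s} \<Longrightarrow> g j = a * q ^ (1 + N j) / h j"
    and w: "w = a ^ (r + 1) * q powi (1 - (\<Sum>j\<in>{1..s}. int (N j))) /
      ((\<Prod>i\<in>{1..r}. b i) * c * d * (\<Prod>i\<in>{1..r}. e i))"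
  shows "Psi r s q a b c d e z g h w
    = (\<Sum>\<^sub>\<infinity>k\<in>root_lattice (Suc r).
        shift_ratio (Suc r) (A_param r a d e z) (B_param r b c z) (km_poly s a h N) (ext_point r a z) k)"
proof -
  have "psi_term r s q a b c d e z g h w = (\<lambda>k. shift_ratio (Suc r) (A_param r a d e z) (B_param r b c z)
      (km_poly s a h N) (ext_point r a z) (ext_index r k))"
    by (rule ext) (rule psi_term_eq_shift_ratio[OF gen g w])
  then show ?thesis
    unfolding Psi_def by (simp only: infsum_reindex_bij_betw[OF bij_betw_ext_index])
qed

lemma bij_betw_root_lattice_uminus:
  "bij_betw (\<lambda>k. \<lambda>i\<in>{1..n}. - k i) (root_lattice n) (root_lattice n)"
  by (rule bij_betwI[where g = "\<lambda>k. \<lambda>i\<in>{1..n}. - k i"])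
     (auto simp: sum_negf PiE_def extensional_def fun_eq_iff)

section \<open>The theta product, the polynomial and \<open>numer\<close> at the base points\<close>

lemma pair_theta_eq:
  assumes "u \<noteq> 0" "v \<noteq> 0"
  shows "pair_theta u v = (u - v) * (qpinf (q * v / u) q * qpinf (q * u / v) q)"
proof -
  have "qpinf (v / u) q = (1 - v / u) * qpinf (q * v / u) q"
    by (subst qpinf_rec) (simp add: mult.commute)
  moreover have "u * (1 - v / u) = u - v" using assms by (simp add: field_simps)
  ultimately show ?thesis
    unfolding pair_theta_def \<theta>_def by (simp add: mult.assoc[symmetric])
qed

text \<open>Splits off the ordinary Vandermonde product, which will cancel against the one contained
  in \<open>vander_poly\<close>.\<close>

lemma weyl_theta_eq:
  assumes x: "\<forall>i\<in>{1..n}. x i \<noteq> 0"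
  shows "weyl_theta n x = vander n x * (\<Prod>i\<in>{1..n}. \<Prod>j\<in>{i<..n}. qpinf (q * x j / x i) q * qpinf (q * x i / x j) q)"
proof -
  have "weyl_theta n x = (\<Prod>i\<in>{1..n}. \<Prod>j\<in>{i<..n}. (x i - x j) * (qpinf (q * x j / x i) q * qpinf (q * x i / x j) q))"
    unfolding weyl_theta_def by (intro prod.cong refl pair_theta_eq) (use x in auto)
  then show ?thesis by (simp only: prod.distrib vander_def)
qed

text \<open>Inversion of \<open>u\<close> carries the linear factors belonging to
  \<open>h' j\<close> to those belonging to \<open>h j\<close> in reverse order. The reversal of the
  inner product compensates for this.\<close>

lemma km_poly_inverse:
  assumes u: "u \<noteq> 0" and a: "a \<noteq> 0" and h: "\<And>j. j \<in> {1..s} \<Longrightarrow> h j \<noteq> 0"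
    and h': "\<And>j. j \<in> {1..s} \<Longrightarrow> a' * q / h' j = h j / (a * q ^ N j)"
  shows "u ^ (\<Sum>j\<in>{1..s}. N j) * poly (km_poly s a' h' N) (1 / u)
    = (\<Prod>j\<in>{1..s}. \<Prod>l<N j. - (h j / (a * q * q ^ l))) * poly (km_poly s a h N) u"
proof -
  have "u ^ N j * (\<Prod>l<N j. 1 - a' * q / h' j * (1 / u) * q ^ l)
     = (\<Prod>l<N j. - (h j / (a * q * q ^ l))) * (\<Prod>l<N j. 1 - a * q / h j * u * q ^ l)" if j: "j \<in> {1..s}" for j
  proof -
    have "u ^ N j * (\<Prod>l<N j. 1 - a' * q / h' j * (1 / u) * q ^ l)
        = (\<Prod>l<N j. u * (1 - h j / (a * q ^ N j) * (1 / u) * q ^ l))"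
      unfolding h'[OF j] by (simp add: prod.distrib)
    also have "\<dots> = (\<Prod>l<N j. u * (1 - h j / (a * q ^ N j) * (1 / u) * q ^ (N j - Suc l)))"
      by (rule prod.nat_diff_reindex[symmetric])
    also have "\<dots> = (\<Prod>l<N j. - (h j / (a * q * q ^ l)) * (1 - a * q / h j * u * q ^ l))"
    proof (rule prod.cong[OF refl])
      fix l assume "l \<in> {..<N j}"
      then have "q ^ N j = q ^ (N j - Suc l) * (q * q ^ l)"
        by (simp flip: power_add power_Suc)
      then have "h j / (a * q ^ N j) * (1 / u) * q ^ (N j - Suc l) = h j / (a * (q * q ^ l)) * (1 / u)"
        by simp
      then show "u * (1 - h j / (a * q ^ N j) * (1 / u) * q ^ (N j - Suc l))
          = - (h j / (a * q * q ^ l)) * (1 - a * q / h j * u * q ^ l)"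
        using u a h[OF j] by (simp add: field_simps)
    qed
    finally show ?thesis by (simp only: prod.distrib)
  qed
  then have "(\<Prod>j\<in>{1..s}. u ^ N j * (\<Prod>l<N j. 1 - a' * q / h' j * (1 / u) * q ^ l))
     = (\<Prod>j\<in>{1..s}. (\<Prod>l<N j. - (h j / (a * q * q ^ l))) * (\<Prod>l<N j. 1 - a * q / h j * u * q ^ l))"
    by (intro prod.cong refl)
  then show ?thesis
    unfolding poly_km_poly by (simp add: prod.distrib power_sum)
qed

lemma prod_poly_km_poly:
  assumes gen: "\<And>i j. i \<in> {1..n} \<Longrightarrow> j \<in> {1..s} \<Longrightarrow> generic q (a * q / h j * x i)"
  shows "(\<Prod>i\<in>{1..n}. poly (km_poly s a h N) (x i)) = (\<Prod>j\<in>{1..s}. \<Prod>i\<in>{1..n}. qpoch (a * q / h j * x i) q (int (N j)))"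
proof -
  have "(\<Prod>i\<in>{1..n}. poly (km_poly s a h N) (x i)) = (\<Prod>i\<in>{1..n}. \<Prod>j\<in>{1..s}. qpoch (a * q / h j * x i) q (int (N j)))"
    unfolding poly_km_poly by (intro prod.cong refl qpoch_nat[symmetric] gen)
  then show ?thesis by (simp only: prod.swap[of _ "{1..n}"])
qed

text \<open>The data \<open>a0\<close>, \<open>z0\<close> of the parameters are kept apart from the
  data \<open>a\<close>, \<open>z\<close> of the base point, since the parameters of the first
  series are evaluated at both base points.\<close>

lemma prod_numer_ext_point:
  "(\<Prod>i\<in>{1..Suc r}. numer (Suc r) (A_param r a0 d e z0) (B_param r b c z0) (ext_point r a z i))
   = (\<Prod>i\<in>{1..r}. \<Prod>m\<in>{1..r}. qpinf (a0 * q / (e m * z0 m) * z i) q * qpinf (q / (b m / z0 m * z i)) q)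
   * (\<Prod>i\<in>{1..r}. qpinf (a0 * q / d * z i) q * qpinf (q / (c * z i)) q)
   * (\<Prod>m\<in>{1..r}. qpinf (a0 * q / (e m * z0 m) * (1 / a)) q * qpinf (q / (b m / z0 m * (1 / a))) q)
   * (qpinf (a0 * q / d * (1 / a)) q * qpinf (q / (c * (1 / a))) q)"
proof -
  have 1: "numer (Suc r) (A_param r a0 d e z0) (B_param r b c z0) y
     = (\<Prod>m\<in>{1..r}. qpinf (a0 * q / (e m * z0 m) * y) q * qpinf (q / (b m / z0 m * y)) q)
      * (qpinf (a0 * q / d * y) q * qpinf (q / (c * y)) q)" for y
  proof -
    have "(\<Prod>m\<in>{1..r}. qpinf (A_param r a0 d e z0 m * y) q * qpinf (q / (B_param r b c z0 m * y)) q)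
      = (\<Prod>m\<in>{1..r}. qpinf (a0 * q / (e m * z0 m) * y) q * qpinf (q / (b m / z0 m * y)) q)"
      by (intro prod.cong refl) simp
    then show ?thesis unfolding numer_def prod_atLeastAtMost_Suc by simp
  qed
  have "(\<Prod>i\<in>{1..r}. numer (Suc r) (A_param r a0 d e z0) (B_param r b c z0) (ext_point r a z i))
     = (\<Prod>i\<in>{1..r}. (\<Prod>m\<in>{1..r}. qpinf (a0 * q / (e m * z0 m) * z i) q * qpinf (q / (b m / z0 m * z i)) q)
      * (qpinf (a0 * q / d * z i) q * qpinf (q / (c * z i)) q))"
    by (intro prod.cong refl) (simp only: 1 ext_point_simps)
  note row = this
  have "(\<Prod>i\<in>{1..Suc r}. numer (Suc r) (A_param r a0 d e z0) (B_param r b c z0) (ext_point r a z i))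
     = (\<Prod>i\<in>{1..r}. numer (Suc r) (A_param r a0 d e z0) (B_param r b c z0) (ext_point r a z i))
      * numer (Suc r) (A_param r a0 d e z0) (B_param r b c z0) (1 / a)"
    by (simp only: prod_atLeastAtMost_Suc ext_point_simps)
  then show ?thesis
    unfolding row unfolding 1 by (simp only: prod.distrib mult.assoc)
qed

text \<open>The power of \<open>qpinf q q\<close> supplies the diagonal that completes the pairs
  among the first \<open>r\<close> coordinates to a full double product; the pairs with the last
  coordinate give the single product.\<close>

lemma prod_pairs_ext_point:
  assumes z: "\<forall>i\<in>{1..r}. z i \<noteq> 0"
  shows "(\<Prod>i\<in>{1..Suc r}. \<Prod>j\<in>{i<..Suc r}. qpinf (q * ext_point r a z j / ext_point r a z i) q * qpinf (q * ext_point r a z i / ext_point r a z j) q)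
     * qpinf q q ^ r
   = (\<Prod>i\<in>{1..r}. \<Prod>j\<in>{1..r}. qpinf (q * z i / z j) q) * (\<Prod>i\<in>{1..r}. qpinf (q / (a * z i)) q * qpinf (a * z i * q) q)"
proof -
  have "(\<Prod>i\<in>{1..r}. \<Prod>j\<in>{1..r}. qpinf (q * z i / z j) q)
      = (\<Prod>i\<in>{1..r}. qpinf (q * z i / z i) q) * (\<Prod>i\<in>{1..r}. \<Prod>j\<in>{i<..r}. qpinf (q * z i / z j) q * qpinf (q * z j / z i) q)"
    by (rule prod_square_split)
  also have "(\<Prod>i\<in>{1..r}. qpinf (q * z i / z i) q) = qpinf q q ^ r"
    using z by simp
  also have "(\<Prod>i\<in>{1..r}. \<Prod>j\<in>{i<..r}. qpinf (q * z i / z j) q * qpinf (q * z j / z i) q)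
     = (\<Prod>i\<in>{1..r}. \<Prod>j\<in>{i<..r}. qpinf (q * ext_point r a z j / ext_point r a z i) q * qpinf (q * ext_point r a z i / ext_point r a z j) q)"
    by (intro prod.cong refl) (simp add: mult.commute)
  finally have 1: "(\<Prod>i\<in>{1..r}. \<Prod>j\<in>{1..r}. qpinf (q * z i / z j) q) = qpinf q q ^ r *
     (\<Prod>i\<in>{1..r}. \<Prod>j\<in>{i<..r}. qpinf (q * ext_point r a z j / ext_point r a z i) q * qpinf (q * ext_point r a z i / ext_point r a z j) q)" .
  have 2: "(\<Prod>i\<in>{1..r}. qpinf (q * ext_point r a z (Suc r) / ext_point r a z i) q * qpinf (q * ext_point r a z i / ext_point r a z (Suc r)) q)
     = (\<Prod>i\<in>{1..r}. qpinf (q / (a * z i)) q * qpinf (a * z i * q) q)"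
    by (intro prod.cong refl) (simp add: mult_ac)
  show ?thesis unfolding prod_pairs_Suc 1 2 by (simp add: mult_ac)
qed

end

theorem theorem4p2:
  fixes r s :: nat and q a c d :: complex
    and b e f z h :: "nat \<Rightarrow> complex" and N :: "nat \<Rightarrow> nat"
  defines "F \<equiv> \<Prod>i\<in>{1..r}. f i"
      and "w \<equiv> a ^ (r + 1) * q powi (1 - (\<Sum>j\<in>{1..s}. int (N j)))
                 / ((\<Prod>i\<in>{1..r}. b i) * c * d * (\<Prod>i\<in>{1..r}. e i))"
  assumes r: "r \<ge> 1"
    and q: "0 < norm q" "norm q < 1"
    and f_nz: "\<forall>i\<in>{1..r}. f i \<noteq> 0"
    and gen_lhs: "psi_generic r s q a b c d e z (\<lambda>j. a * q ^ (1 + N j) / h j) h"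
    and gen_rhs: "psi_generic r s q (F / a) (\<lambda>i. e i * f i / a) (d / a) (c * F / a)
                    (\<lambda>i. b i * F / (a * f i)) (\<lambda>i. f i / z i) (\<lambda>j. h j / a) (\<lambda>j. F * q ^ (1 + N j) / h j)"
    and den1: "\<forall>j\<in>{1..s}. qpoch (q / h j) q (int (N j)) \<noteq> 0 \<and>
                 (\<forall>i\<in>{1..r}. qpoch (a * z i * q / h j) q (int (N j)) \<noteq> 0)"
    and den2: "qpinf (a * q / c) q \<noteq> 0" "qpinf (q / d) q \<noteq> 0"
    and den3: "\<forall>i\<in>{1..r}. \<forall>j\<in>{1..r}. qpinf (q * f j * z i / (f i * z j)) q \<noteq> 0 \<and>
                 qpinf (q * z i / (b i * z j)) q \<noteq> 0 \<and> qpinf (a * z i * q / (e j * z j)) q \<noteq> 0"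
    and den4: "\<forall>i\<in>{1..r}. qpinf (F * f i * q / (a * z i)) q \<noteq> 0 \<and> qpinf (a * z i * q / (F * f i)) q \<noteq> 0 \<and>
                 qpinf (a * z i * q / b i) q \<noteq> 0 \<and> qpinf (q / (e i * z i)) q \<noteq> 0 \<and>
                 qpinf (q / (c * z i)) q \<noteq> 0 \<and> qpinf (a * z i * q / d) q \<noteq> 0"
    and conv: "norm w < 1"
  shows "Psi r s q a b c d e z (\<lambda>j. a * q ^ (1 + N j) / h j) h w =
     (\<Prod>j\<in>{1..s}. qpoch (F * q / h j) q (int (N j)) / qpoch (q / h j) q (int (N j))
        * (\<Prod>i\<in>{1..r}. qpoch (a * z i * q / (f i * h j)) q (int (N j)) / qpoch (a * z i * q / h j) q (int (N j))))
   * (qpinf (F * q / d) q * qpinf (a * q / (c * F)) q / (qpinf (a * q / c) q * qpinf (q / d) q))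
   * (\<Prod>i\<in>{1..r}. \<Prod>j\<in>{1..r}.
        qpinf (q * z i / z j) q * qpinf (a * z i * q / (e j * f i * z j)) q * qpinf (f j * z i * q / (b i * z j)) q
      / (qpinf (q * f j * z i / (f i * z j)) q * qpinf (q * z i / (b i * z j)) q * qpinf (a * z i * q / (e j * z j)) q))
   * (\<Prod>i\<in>{1..r}.
        qpinf (a * z i * q) q * qpinf (q / (a * z i)) q * qpinf (F * q / (e i * z i)) q
        * qpinf (a * z i * q / (b i * F)) q * qpinf (a * z i * q / (d * f i)) q * qpinf (f i * q / (c * z i)) q
      / (qpinf (F * f i * q / (a * z i)) q * qpinf (a * z i * q / (F * f i)) q * qpinf (a * z i * q / b i) q
        * qpinf (q / (e i * z i)) q * qpinf (q / (c * z i)) q * qpinf (a * z i * q / d) q))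
   * Psi r s q (F / a) (\<lambda>i. e i * f i / a) (d / a) (c * F / a)
        (\<lambda>i. b i * F / (a * f i)) (\<lambda>i. f i / z i) (\<lambda>j. h j / a) (\<lambda>j. F * q ^ (1 + N j) / h j) w"
proof -
  interpret nome q using q by unfold_locales auto
  note gl = gen_lhs[unfolded psi_generic_def] and gr = gen_rhs[unfolded psi_generic_def]
  have nz: "a \<noteq> 0" "c \<noteq> 0" "d \<noteq> 0" using gl by auto
  have nzi: "b i \<noteq> 0" "e i \<noteq> 0" "z i \<noteq> 0" "f i \<noteq> 0" if "i \<in> {1..r}" for i
    using gl f_nz that by auto
  have nzj: "h j \<noteq> 0" if "j \<in> {1..s}" for j using gl that by auto
  have F: "F \<noteq> 0" using f_nz by (simp add: F_def)
  define n where "n = Suc r"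
  \<comment> \<open>The second base point has the coordinates \<open>z i / f i\<close>; its last
    coordinate \<open>F / a\<close> restores the product of all coordinates.\<close>
  define y where "y = (\<lambda>i. z i / f i)"
  define X where "X = ext_point r a z"
  define Y where "Y = ext_point r (a / F) y"
  define X' where "X' = ext_point r (F / a) (\<lambda>i. f i / z i)"
  define A where "A = A_param r a d e z"
  define B where "B = B_param r b c z"
  \<comment> \<open>The primed data are read off the right-hand series. They turn out to be
    \<open>q / B\<close>, \<open>q / A\<close> and \<open>1 / Y\<close>, so that series is the
    inverted form of the sum over the lattice through \<open>Y\<close>.\<close>
  define A' where "A' = A_param r (F / a) (c * F / a) (\<lambda>i. b i * F / (a * f i)) (\<lambda>i. f i / z i)"
  define B' where "B' = B_param r (\<lambda>i. e i * f i / a) (d / a) (\<lambda>i. f i / z i)"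
  define p where "p = km_poly s a h N"
  define p' where "p' = km_poly s (F / a) (\<lambda>j. F * q ^ (1 + N j) / h j) N"
  let ?\<Psi>L = "Psi r s q a b c d e z (\<lambda>j. a * q ^ (1 + N j) / h j) h w"
  let ?\<Psi>R = "Psi r s q (F / a) (\<lambda>i. e i * f i / a) (d / a) (c * F / a)
        (\<lambda>i. b i * F / (a * f i)) (\<lambda>i. f i / z i) (\<lambda>j. h j / a) (\<lambda>j. F * q ^ (1 + N j) / h j) w"
  have idx: "i \<in> {1..r} \<or> i = Suc r" if "i \<in> {1..n}" for i using that by (auto simp: n_def)
  have y_nz: "y i \<noteq> 0" if "i \<in> {1..r}" for i using nzi[OF that] by (simp add: y_def)
  have "X i \<noteq> 0 \<and> Y i \<noteq> 0 \<and> A i \<noteq> 0 \<and> B i \<noteq> 0" if "i \<in> {1..n}" for i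
    using idx[OF that] nz nzi[of i] y_nz[of i] F by (auto simp: X_def Y_def A_def B_def)
  then have X_nz: "\<forall>i\<in>{1..n}. X i \<noteq> 0" and Y_nz: "\<forall>i\<in>{1..n}. Y i \<noteq> 0"
    and A_nz: "\<forall>i\<in>{1..n}. A i \<noteq> 0" and B_nz: "\<forall>i\<in>{1..n}. B i \<noteq> 0"
    by blast+
  have A': "A' m = q / B m" and B': "B' m = q / A m" and X': "X' m = 1 / Y m" if "m \<in> {1..n}" for m
    using idx[OF that] nz nzi[of m] F
    by (auto simp: A'_def B'_def A_def B_def X'_def Y_def y_def field_simps)
  have gXA: "generic q (A m * X i)" and gXB: "generic q (B m * X i)"
    if "i \<in> {1..n}" "m \<in> {1..n}" for i m
    using psi_generic_parameters[OF gen_lhs] that by (auto simp: A_def B_def X_def n_def)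
  have g': "generic q (A' m * X' i)" "generic q (B' m * X' i)"
    if "i \<in> {1..n}" "m \<in> {1..n}" for i m
    using psi_generic_parameters[OF gen_rhs] that by (auto simp: A'_def B'_def X'_def n_def)
  have gYA: "generic q (A m * Y i)" and gYB: "generic q (B m * Y i)"
    if im: "i \<in> {1..n}" "m \<in> {1..n}" for i m
  proof -
    have nz3: "Y i \<noteq> 0" "A m \<noteq> 0" "B m \<noteq> 0" using Y_nz A_nz B_nz im by auto
    have "generic q (q / (B' m * X' i))" "generic q (q / (A' m * X' i))"
      by (rule generic_reflect; use g'[OF im] nz3 A'[OF im(2)] B'[OF im(2)] X'[OF im(1)] in simp)+
    then show "generic q (A m * Y i)" "generic q (B m * Y i)"
      using nz3 by (simp_all add: A'[OF im(2)] B'[OF im(2)] X'[OF im(1)])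
  qed
  have VX: "vander_poly n p X \<noteq> 0"
    unfolding n_def p_def X_def by (rule psi_generic_vander_poly[OF gen_lhs])
  define D where "D = (\<Sum>j\<in>{1..s}. N j)"
  define C where "C = (\<Prod>j\<in>{1..s}. \<Prod>l<N j. - (h j / (a * q * q ^ l)))"
  have p': "u ^ D * poly p' (1 / u) = C * poly p u" if "u \<noteq> 0" for u
    unfolding D_def C_def p_def p'_def
    by (rule km_poly_inverse) (use that nz nzj F in \<open>auto simp: field_simps\<close>)
  have C: "C \<noteq> 0" using nz nzj by (auto simp: C_def)
  have VY: "vander_poly n p Y \<noteq> 0"
  proof -
    have "vander_poly n p' X' \<noteq> 0"
      unfolding n_def p'_def X'_def by (rule psi_generic_vander_poly[OF gen_rhs])
    moreover have "vander_poly n p' X' = vander_poly n p' (\<lambda>i. 1 / Y i)"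
      unfolding vander_poly_def
      by (intro arg_cong2[of _ _ _ _ "(*)"] vander_cong prod.cong refl) (simp_all add: X')
    ultimately show ?thesis
      using vander_poly_inverse[of n Y D p' C p, OF Y_nz p'] by auto
  qed
  have L: "?\<Psi>L = (\<Sum>\<^sub>\<infinity>k\<in>root_lattice n. shift_ratio n A B p X k)"
    unfolding n_def A_def B_def p_def X_def
    by (rule Psi_eq_shift_ratio_sum[OF gen_lhs refl]) (simp only: w_def)
  \<comment> \<open>The argument has the required form in the right-hand parameters as well: the
    powers of \<open>F\<close> cancel, and those of \<open>a\<close> combine to
    \<open>a ^ (r + 1)\<close>.\<close>
  have w': "w = (F / a) ^ (r + 1) * q powi (1 - (\<Sum>j\<in>{1..s}. int (N j))) /
      ((\<Prod>i\<in>{1..r}. e i * f i / a) * (d / a) * (c * F / a) * (\<Prod>i\<in>{1..r}. b i * F / (a * f i)))"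
  proof -
    have 1: "(\<Prod>i\<in>{1..r}. e i * f i / a) = (\<Prod>i\<in>{1..r}. e i) * F / a ^ r"
      by (simp add: prod_dividef prod.distrib F_def)
    have 2: "(\<Prod>i\<in>{1..r}. b i * F / (a * f i)) = (\<Prod>i\<in>{1..r}. b i) * F ^ r / (a ^ r * F)"
      by (simp add: prod_dividef prod.distrib F_def)
    have "(\<Prod>i\<in>{1..r}. e i) \<noteq> 0" "(\<Prod>i\<in>{1..r}. b i) \<noteq> 0" using nzi by auto
    then show ?thesis unfolding w_def 1 2 using nz F by (simp add: power_divide field_simps)
  qed
  have "?\<Psi>R = (\<Sum>\<^sub>\<infinity>k\<in>root_lattice n. shift_ratio n A' B' p' X' k)"
    unfolding n_def A'_def B'_def p'_def X'_def
    by (rule Psi_eq_shift_ratio_sum[OF gen_rhs _ w']) (use nzj F in \<open>simp add: field_simps\<close>)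
  also have "\<dots> = (\<Sum>\<^sub>\<infinity>k\<in>root_lattice n. shift_ratio n A B p Y (\<lambda>i\<in>{1..n}. - k i))"
    by (intro infsum_cong shift_ratio_reflect[OF Y_nz A_nz B_nz A' B' X' gYA gYB p' C]) auto
  also have "\<dots> = (\<Sum>\<^sub>\<infinity>k\<in>root_lattice n. shift_ratio n A B p Y k)"
    by (rule infsum_reindex_bij_betw[OF bij_betw_root_lattice_uminus])
  finally have R: "?\<Psi>R = (\<Sum>\<^sub>\<infinity>k\<in>root_lattice n. shift_ratio n A B p Y k)" .
  define NX where "NX = (\<Prod>i\<in>{1..n}. numer n A B (X i))"
  define NY where "NY = (\<Prod>i\<in>{1..n}. numer n A B (Y i))"
  define \<Xi> where "\<Xi> = (\<lambda>x. \<Prod>i\<in>{1..n}. \<Prod>j\<in>{i<..n}. qpinf (q * x j / x i) q * qpinf (q * x i / x j) q)"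
  have SX: "(\<Sum>\<^sub>\<infinity>k\<in>root_lattice n. shifted_term n A B p X k) = ?\<Psi>L * (vander_poly n p X * NX)"
    unfolding L NX_def infsum_cmult_left'[symmetric]
    by (intro infsum_cong shifted_term_eq[OF B_nz X_nz gXA gXB VX])
  have SY: "(\<Sum>\<^sub>\<infinity>k\<in>root_lattice n. shifted_term n A B p Y k) = ?\<Psi>R * (vander_poly n p Y * NY)"
    unfolding R NY_def infsum_cmult_left'[symmetric]
    by (intro infsum_cong shifted_term_eq[OF B_nz Y_nz gYA gYB VY])
  have prodXY: "(\<Prod>i\<in>{1..n}. X i) = (\<Prod>i\<in>{1..n}. Y i)"
  proof -
    have "(\<Prod>i\<in>{1..r}. X i) = (\<Prod>i\<in>{1..r}. z i)" "(\<Prod>i\<in>{1..r}. Y i) = (\<Prod>i\<in>{1..r}. y i)"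
      by (auto simp: X_def Y_def intro!: prod.cong)
    moreover have "(\<Prod>i\<in>{1..r}. y i) = (\<Prod>i\<in>{1..r}. z i) / F"
      by (simp add: y_def F_def prod_dividef)
    ultimately show ?thesis
      unfolding n_def prod_atLeastAtMost_Suc using F by (simp add: X_def Y_def)
  qed
  \<comment> \<open>The product of the \<open>A m\<close> equals \<open>w * q ^ (r + D)\<close>
    times that of the \<open>B m\<close>, so \<open>norm w < 1\<close> is the convergence condition
    with \<open>D\<close> in place of the degree of \<open>p\<close>, and the degree is at most
    \<open>D\<close>.\<close>
  have conv': "norm (\<Prod>m\<in>{1..n}. A m) < norm (q ^ (n - 1 + degree p) * (\<Prod>m\<in>{1..n}. B m))"
  proof -
    define Z where "Z = (\<Prod>i\<in>{1..r}. z i)"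
    define E where "E = (\<Prod>i\<in>{1..r}. e i)"
    define b0 where "b0 = (\<Prod>i\<in>{1..r}. b i)"
    have nz0: "Z \<noteq> 0" "E \<noteq> 0" "b0 \<noteq> 0" using nzi by (auto simp: Z_def E_def b0_def)
    have "(\<Prod>m\<in>{1..r}. A m) = (\<Prod>m\<in>{1..r}. a * q / (e m * z m))"
      by (intro prod.cong refl) (simp add: A_def)
    then have "(\<Prod>m\<in>{1..r}. A m) = (a * q) ^ r / (E * Z)"
      by (simp add: prod_dividef prod.distrib E_def Z_def)
    then have PA: "(\<Prod>m\<in>{1..n}. A m) = (a * q) ^ r / (E * Z) * (a * q / d)"
      unfolding n_def prod_atLeastAtMost_Suc by (simp add: A_def)
    have "(\<Prod>m\<in>{1..r}. B m) = (\<Prod>m\<in>{1..r}. b m / z m)"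
      by (intro prod.cong refl) (simp add: B_def)
    then have "(\<Prod>m\<in>{1..r}. B m) = b0 / Z"
      by (simp add: prod_dividef b0_def Z_def)
    then have PB: "(\<Prod>m\<in>{1..n}. B m) = b0 / Z * c"
      unfolding n_def prod_atLeastAtMost_Suc by (simp add: B_def)
    have "q powi (1 - (\<Sum>j\<in>{1..s}. int (N j))) = q / q ^ D"
      by (simp add: D_def power_int_diff flip: of_nat_sum)
    then have "(\<Prod>m\<in>{1..n}. A m) = w * (q ^ (r + D) * (\<Prod>m\<in>{1..n}. B m))"
      unfolding PA PB w_def E_def[symmetric] b0_def[symmetric]
      using nz nz0 by (simp add: power_add power_mult_distrib field_simps)
    then have "norm (\<Prod>m\<in>{1..n}. A m) = norm w * norm (q ^ (r + D) * (\<Prod>m\<in>{1..n}. B m))"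
      by (simp only: norm_mult)
    also have "\<dots> < norm (q ^ (r + D) * (\<Prod>m\<in>{1..n}. B m))"
      using conv B_nz by simp
    also have "\<dots> \<le> norm (q ^ (n - 1 + degree p) * (\<Prod>m\<in>{1..n}. B m))"
    proof -
      have "degree p \<le> (\<Sum>j\<in>{1..s}. degree (\<Prod>l<N j. [:1, - (a * q / h j * q ^ l):]))"
        unfolding p_def km_poly_def by (rule degree_prod_sum_le[unfolded o_def]) simp
      also have "\<dots> \<le> D"
        unfolding D_def
      proof (rule sum_mono)
        fix j
        have "degree (\<Prod>l<N j. [:1, - (a * q / h j * q ^ l):]) \<le> (\<Sum>l<N j. degree [:1, - (a * q / h j * q ^ l):])"
          by (rule degree_prod_sum_le[unfolded o_def]) simp
        also have "\<dots> \<le> (\<Sum>l<N j. 1)" by (rule sum_mono) (simp add: degree_pCons_eq_if)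
        finally show "degree (\<Prod>l<N j. [:1, - (a * q / h j * q ^ l):]) \<le> N j" by simp
      qed
      finally have "norm q ^ (r + D) \<le> norm q ^ (n - 1 + degree p)"
        using q by (intro power_decreasing) (auto simp: n_def)
      then show ?thesis by (simp add: norm_mult norm_power mult_right_mono)
    qed
    finally show ?thesis .
  qed
  have QX: "\<Xi> X * qpinf q q ^ r = (\<Prod>i\<in>{1..r}. \<Prod>j\<in>{1..r}. qpinf (q * z i / z j) q)
      * (\<Prod>i\<in>{1..r}. qpinf (q / (a * z i)) q * qpinf (a * z i * q) q)"
    unfolding \<Xi>_def n_def X_def by (rule prod_pairs_ext_point) (use nzi in auto)
  have QY: "\<Xi> Y * qpinf q q ^ r = (\<Prod>i\<in>{1..r}. \<Prod>j\<in>{1..r}. qpinf (q * f j * z i / (f i * z j)) q)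
      * (\<Prod>i\<in>{1..r}. qpinf (F * f i * q / (a * z i)) q * qpinf (a * z i * q / (F * f i)) q)"
  proof -
    have "\<Xi> Y * qpinf q q ^ r = (\<Prod>i\<in>{1..r}. \<Prod>j\<in>{1..r}. qpinf (q * y i / y j) q)
      * (\<Prod>i\<in>{1..r}. qpinf (q / (a / F * y i)) q * qpinf (a / F * y i * q) q)"
      unfolding \<Xi>_def n_def Y_def by (rule prod_pairs_ext_point) (use y_nz in auto)
    also have "(\<Prod>i\<in>{1..r}. \<Prod>j\<in>{1..r}. qpinf (q * y i / y j) q) = (\<Prod>i\<in>{1..r}. \<Prod>j\<in>{1..r}. qpinf (q * f j * z i / (f i * z j)) q)"
      by (intro prod.cong refl) (simp add: y_def mult_ac)
    also have "(\<Prod>i\<in>{1..r}. qpinf (q / (a / F * y i)) q * qpinf (a / F * y i * q) q)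
       = (\<Prod>i\<in>{1..r}. qpinf (F * f i * q / (a * z i)) q * qpinf (a * z i * q / (F * f i)) q)"
      by (intro prod.cong refl) (simp add: y_def mult_ac)
    finally show ?thesis .
  qed
  have qq: "qpinf q q \<noteq> 0" using qpinf_nz q by simp
  have "(\<Prod>i\<in>{1..r}. \<Prod>j\<in>{1..r}. qpinf (q * f j * z i / (f i * z j)) q) \<noteq> 0"
    "(\<Prod>i\<in>{1..r}. qpinf (F * f i * q / (a * z i)) q * qpinf (a * z i * q / (F * f i)) q) \<noteq> 0"
    using den3 den4 by (auto simp only: prod_zero_iff finite_atLeastAtMost mult_eq_0_iff)
  \<comment> \<open>The denominators in \<open>den3\<close> and \<open>den4\<close> that contain
    \<open>f\<close> are the factors of the theta product at \<open>Y\<close>; their nonvanishing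
    makes the second base point nondegenerate.\<close>
  then have \<Xi>Y: "\<Xi> Y \<noteq> 0" using QY by auto
  have vX: "vander n X \<noteq> 0" and vY: "vander n Y \<noteq> 0"
    and PX: "(\<Prod>i\<in>{1..n}. poly p (X i)) \<noteq> 0"
    using VX VY unfolding vander_poly_def by auto
  have wX: "weyl_theta n X = vander n X * \<Xi> X" and wY: "weyl_theta n Y = vander n Y * \<Xi> Y"
    unfolding \<Xi>_def by (rule weyl_theta_eq[OF X_nz], rule weyl_theta_eq[OF Y_nz])
  have wY_nz: "weyl_theta n Y \<noteq> 0" using vY \<Xi>Y by (simp add: wY)
  \<comment> \<open>Outside the index range both points take the default value 1 of
    \<open>ext_point\<close>.\<close>
  have out: "X i = Y i" if "i \<notin> {1..n}" for i
    using that by (auto simp: X_def Y_def ext_point_def n_def)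
  have "?\<Psi>L * (vander_poly n p X * NX) * weyl_theta n Y = ?\<Psi>R * (vander_poly n p Y * NY) * weyl_theta n X"
    unfolding SX[symmetric] SY[symmetric]
    by (rule root_lattice_sum_proportional[OF B_nz conv' X_nz Y_nz out prodXY wY_nz])
  then have main: "?\<Psi>L * ((\<Prod>i\<in>{1..n}. poly p (X i)) * NX * \<Xi> Y) = ?\<Psi>R * ((\<Prod>i\<in>{1..n}. poly p (Y i)) * NY * \<Xi> X)"
  proof -
    assume "?\<Psi>L * (vander_poly n p X * NX) * weyl_theta n Y = ?\<Psi>R * (vander_poly n p Y * NY) * weyl_theta n X"
    then have "(vander n X * vander n Y) * (?\<Psi>L * ((\<Prod>i\<in>{1..n}. poly p (X i)) * NX * \<Xi> Y))
       = (vander n X * vander n Y) * (?\<Psi>R * ((\<Prod>i\<in>{1..n}. poly p (Y i)) * NY * \<Xi> X))"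
      unfolding wX wY vander_poly_def by (simp only: mult_ac)
    then show ?thesis using vX vY by simp
  qed
  \<comment> \<open>Names for the products in the claim: \<open>a1\<close> to \<open>a3\<close> over
    \<open>c1\<close> to \<open>c3\<close> form the double product, \<open>u1\<close> to
    \<open>u6\<close> over \<open>v1\<close> to \<open>v6\<close> the single one, \<open>s1\<close>
    to \<open>s4\<close> are the factors without index, and \<open>pY\<close>, \<open>pX\<close> the
    finite products.\<close>
  define a1 where "a1 = (\<Prod>i\<in>{1..r}. \<Prod>j\<in>{1..r}. qpinf (q * z i / z j) q)"
  define a2 where "a2 = (\<Prod>i\<in>{1..r}. \<Prod>j\<in>{1..r}. qpinf (a * z i * q / (e j * f i * z j)) q)"
  define a3 where "a3 = (\<Prod>i\<in>{1..r}. \<Prod>j\<in>{1..r}. qpinf (f j * z i * q / (b i * z j)) q)"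
  define c1 where "c1 = (\<Prod>i\<in>{1..r}. \<Prod>j\<in>{1..r}. qpinf (q * f j * z i / (f i * z j)) q)"
  define c2 where "c2 = (\<Prod>i\<in>{1..r}. \<Prod>j\<in>{1..r}. qpinf (q * z i / (b i * z j)) q)"
  define c3 where "c3 = (\<Prod>i\<in>{1..r}. \<Prod>j\<in>{1..r}. qpinf (a * z i * q / (e j * z j)) q)"
  define u1 where "u1 = (\<Prod>i\<in>{1..r}. qpinf (a * z i * q) q)"
  define u2 where "u2 = (\<Prod>i\<in>{1..r}. qpinf (q / (a * z i)) q)"
  define u3 where "u3 = (\<Prod>i\<in>{1..r}. qpinf (F * q / (e i * z i)) q)"
  define u4 where "u4 = (\<Prod>i\<in>{1..r}. qpinf (a * z i * q / (b i * F)) q)"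
  define u5 where "u5 = (\<Prod>i\<in>{1..r}. qpinf (a * z i * q / (d * f i)) q)"
  define u6 where "u6 = (\<Prod>i\<in>{1..r}. qpinf (f i * q / (c * z i)) q)"
  define v1 where "v1 = (\<Prod>i\<in>{1..r}. qpinf (F * f i * q / (a * z i)) q)"
  define v2 where "v2 = (\<Prod>i\<in>{1..r}. qpinf (a * z i * q / (F * f i)) q)"
  define v3 where "v3 = (\<Prod>i\<in>{1..r}. qpinf (a * z i * q / b i) q)"
  define v4 where "v4 = (\<Prod>i\<in>{1..r}. qpinf (q / (e i * z i)) q)"
  define v5 where "v5 = (\<Prod>i\<in>{1..r}. qpinf (q / (c * z i)) q)"
  define v6 where "v6 = (\<Prod>i\<in>{1..r}. qpinf (a * z i * q / d) q)"
  define s1 where "s1 = qpinf (F * q / d) q"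
  define s2 where "s2 = qpinf (a * q / (c * F)) q"
  define s3 where "s3 = qpinf (a * q / c) q"
  define s4 where "s4 = qpinf (q / d) q"
  define pY where "pY = (\<Prod>j\<in>{1..s}. qpoch (F * q / h j) q (int (N j)) *
      (\<Prod>i\<in>{1..r}. qpoch (a * z i * q / (f i * h j)) q (int (N j))))"
  define pX where "pX = (\<Prod>j\<in>{1..s}. qpoch (q / h j) q (int (N j)) *
      (\<Prod>i\<in>{1..r}. qpoch (a * z i * q / h j) q (int (N j))))"
  have den_nz: "c1 \<noteq> 0" "c2 \<noteq> 0" "c3 \<noteq> 0" "v1 \<noteq> 0" "v2 \<noteq> 0" "v3 \<noteq> 0" "v4 \<noteq> 0" "v5 \<noteq> 0" "v6 \<noteq> 0"
    "s3 \<noteq> 0" "s4 \<noteq> 0" "pX \<noteq> 0"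
    unfolding c1_def c2_def c3_def v1_def v2_def v3_def v4_def v5_def v6_def s3_def s4_def pX_def
    using den1 den2 den3 den4 by (simp_all only: prod_zero_iff finite_atLeastAtMost mult_eq_0_iff) blast+
  have NX: "NX = c3 * c2 * (v6 * v5) * (v4 * v3) * (s4 * s3)"
  proof -
    \<comment> \<open>In the claim \<open>b\<close> carries the first index of the double product,
      in \<open>numer\<close> the second; hence the exchange of the two products.\<close>
    have "c2 = (\<Prod>i\<in>{1..r}. \<Prod>m\<in>{1..r}. qpinf (q / (b m / z m * z i)) q)"
      unfolding c2_def by (subst prod.swap) (simp add: mult_ac)
    moreover have "c3 = (\<Prod>i\<in>{1..r}. \<Prod>m\<in>{1..r}. qpinf (a * q / (e m * z m) * z i) q)"
      unfolding c3_def by (simp add: mult_ac)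
    moreover have "v6 = (\<Prod>i\<in>{1..r}. qpinf (a * q / d * z i) q)" unfolding v6_def by (simp add: mult_ac)
    moreover have "v4 = (\<Prod>m\<in>{1..r}. qpinf (a * q / (e m * z m) * (1 / a)) q)"
      unfolding v4_def using nz by simp
    moreover have "v3 = (\<Prod>m\<in>{1..r}. qpinf (q / (b m / z m * (1 / a))) q)"
      unfolding v3_def by (simp add: mult_ac)
    moreover have "s4 = qpinf (a * q / d * (1 / a)) q" "s3 = qpinf (q / (c * (1 / a))) q"
      using nz by (simp_all add: s4_def s3_def mult_ac)
    ultimately show ?thesis
      unfolding NX_def n_def A_def B_def X_def prod_numer_ext_point v5_def by (simp only: prod.distrib)
  qed
  have NY: "NY = a2 * a3 * (u5 * u6) * (u3 * u4) * (s1 * s2)"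
  proof -
    have "a3 = (\<Prod>i\<in>{1..r}. \<Prod>m\<in>{1..r}. qpinf (q / (b m / z m * y i)) q)"
      unfolding a3_def by (subst prod.swap) (simp add: y_def mult_ac)
    moreover have "a2 = (\<Prod>i\<in>{1..r}. \<Prod>m\<in>{1..r}. qpinf (a * q / (e m * z m) * y i) q)"
      unfolding a2_def by (simp add: y_def mult_ac)
    moreover have "u5 = (\<Prod>i\<in>{1..r}. qpinf (a * q / d * y i) q)"
      unfolding u5_def by (simp add: y_def mult_ac)
    moreover have "u6 = (\<Prod>i\<in>{1..r}. qpinf (q / (c * y i)) q)"
      unfolding u6_def by (simp add: y_def mult_ac)
    moreover have "u3 = (\<Prod>m\<in>{1..r}. qpinf (a * q / (e m * z m) * (1 / (a / F))) q)"
      unfolding u3_def using nz by (simp add: mult_ac)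
    moreover have "u4 = (\<Prod>m\<in>{1..r}. qpinf (q / (b m / z m * (1 / (a / F)))) q)"
      unfolding u4_def by (simp add: mult_ac)
    moreover have "s1 = qpinf (a * q / d * (1 / (a / F))) q" "s2 = qpinf (q / (c * (1 / (a / F)))) q"
      using nz by (simp_all add: s1_def s2_def mult_ac)
    ultimately show ?thesis
      unfolding NY_def n_def A_def B_def Y_def prod_numer_ext_point by (simp only: prod.distrib)
  qed
  have gen_h: "generic q (a * q / h j * X i)" "generic q (a * q / h j * Y i)"
    if i: "i \<in> {1..Suc r}" and j: "j \<in> {1..s}" for i j
  proof -
    have "generic q (q / h j)" by (rule generic_reflect) (use gl j in auto)
    moreover have "generic q (F * q / h j)" using gr j nz nzj[OF j] by (auto simp: mult_ac)
    moreover have "generic q (a * z i * q / h j)" "generic q (a * z i * q / (f i * h j))" if i: "i \<in> {1..r}"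
    proof -
      show "generic q (a * z i * q / h j)" using gl i j by auto
      have "generic q (h j / a * (f i / z i))" using gr i j by auto
      then have "generic q (q / (h j / a * (f i / z i)))"
        by (rule generic_reflect[rotated]) (use nz nzi[OF i] nzj[OF j] in simp)
      then show "generic q (a * z i * q / (f i * h j))" by (simp add: mult_ac)
    qed
    ultimately show "generic q (a * q / h j * X i)" "generic q (a * q / h j * Y i)"
      using i nz by (cases "i = Suc r"; simp add: X_def Y_def y_def mult_ac)+
  qed
  have PX: "(\<Prod>i\<in>{1..n}. poly p (X i)) = pX"
  proof -
    have "(\<Prod>i\<in>{1..r}. qpoch (a * q / h j * X i) q (int (N j))) = (\<Prod>i\<in>{1..r}. qpoch (a * z i * q / h j) q (int (N j)))" for j
      by (intro prod.cong refl) (simp add: X_def mult_ac)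
    moreover have "a * q / h j * X (Suc r) = q / h j" for j using nz by (simp add: X_def)
    moreover have "(\<Prod>i\<in>{1..Suc r}. poly p (X i))
        = (\<Prod>j\<in>{1..s}. \<Prod>i\<in>{1..Suc r}. qpoch (a * q / h j * X i) q (int (N j)))"
      unfolding p_def by (rule prod_poly_km_poly) (rule gen_h)
    ultimately show ?thesis
      unfolding n_def pX_def by (simp only: prod_atLeastAtMost_Suc) (simp only: mult.commute)
  qed
  have PY: "(\<Prod>i\<in>{1..n}. poly p (Y i)) = pY"
  proof -
    have "(\<Prod>i\<in>{1..r}. qpoch (a * q / h j * Y i) q (int (N j))) = (\<Prod>i\<in>{1..r}. qpoch (a * z i * q / (f i * h j)) q (int (N j)))" for j
      by (intro prod.cong refl) (simp add: Y_def y_def mult_ac)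
    moreover have "a * q / h j * Y (Suc r) = F * q / h j" for j using nz by (simp add: Y_def)
    moreover have "(\<Prod>i\<in>{1..Suc r}. poly p (Y i))
        = (\<Prod>j\<in>{1..s}. \<Prod>i\<in>{1..Suc r}. qpoch (a * q / h j * Y i) q (int (N j)))"
      unfolding p_def by (rule prod_poly_km_poly) (rule gen_h)
    ultimately show ?thesis
      unfolding n_def pY_def by (simp only: prod_atLeastAtMost_Suc) (simp only: mult.commute)
  qed
  have QX': "\<Xi> X * qpinf q q ^ r = a1 * (u2 * u1)" and QY': "\<Xi> Y * qpinf q q ^ r = c1 * (v1 * v2)"
    unfolding QX QY a1_def u2_def u1_def c1_def v1_def v2_def by (simp_all only: prod.distrib)
  \<comment> \<open>The power of \<open>qpinf q q\<close> on both sides brings the two theta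
    products into the form of the claim.\<close>
  have "?\<Psi>L * (pX * NX * (\<Xi> Y * qpinf q q ^ r)) = ?\<Psi>R * (pY * NY * (\<Xi> X * qpinf q q ^ r))"
    using main unfolding PX PY by (simp only: mult.assoc[symmetric])
  then have "?\<Psi>L * (pX * NX * (c1 * (v1 * v2))) = ?\<Psi>R * (pY * NY * (a1 * (u2 * u1)))"
    unfolding QX' QY' .
  moreover have "pX * NX * (c1 * (v1 * v2)) \<noteq> 0" using den_nz by (simp add: NX)
  ultimately have "?\<Psi>L = ?\<Psi>R * (pY * NY * (a1 * (u2 * u1))) / (pX * NX * (c1 * (v1 * v2)))"
    by (rule nonzero_eq_divide_eq[THEN iffD2, rotated])
  also have "\<dots> = pY / pX * (s1 * s2 / (s3 * s4)) * (a1 * a2 * a3 / (c1 * c2 * c3))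
      * (u1 * u2 * u3 * u4 * u5 * u6 / (v1 * v2 * v3 * v4 * v5 * v6)) * ?\<Psi>R"
    unfolding NX NY by (simp only: times_divide_eq_left times_divide_eq_right times_divide_times_eq divide_divide_eq_left mult_ac)
  finally show ?thesis
    unfolding pY_def pX_def s1_def s2_def s3_def s4_def a1_def a2_def a3_def c1_def c2_def c3_def
      u1_def u2_def u3_def u4_def u5_def u6_def v1_def v2_def v3_def v4_def v5_def v6_def
    by (simp only: prod.distrib prod_dividef times_divide_times_eq)
qed

end
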